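(* In the setting described in the context, assume (A1) and (A2$'$), and let $\nu>0$ satisfy $\frac p2(b_1-b_2e^{\nu\tau})-\nu>0$ and $b_3-b_4e^{\nu\tau}>0$. Then for any $\nu_1\in(0,\nu)$ there exists $\hat\Delta\in(0,1]$ such that for every admissible step size $\Delta\in(0,\hat\Delta]$, $$\limsup_{k\to\infty}\frac{1}{k\Delta}\log\big(\mathbb E|Y^\Delta(t_k)|^p\big)\le-\nu_1\qquad\text{and}\qquad\limsup_{k\to\infty}\frac1{k\Delta}\log|Y^\Delta(t_k)|\le-\frac{\nu_1}{p}\quad\text{a.s.}$$
   Context: Setting: $\tau>0$; $\mathcal C=C([-\tau,0];\mathbb R^n)$ with sup norm $\|\cdot\|$; $|\cdot|$ Euclidean/trace norm; $B$ a $d$-dimensional Brownian motion on a filtered probability space with the usual conditions; $f:\mathcal C\to\mathbb R^n$, $g:\mathcal C\to\mathbb R^{n\times d}$ with $f(\mathbf 0)=0$, $g(\mathbf 0)=0$ ($\mathbf 0$ the zero function); $\xi\in\mathcal C$ the initial datum. $\mathcal W$: bounded Borel $\rho:[-\tau,0]\to[0,\infty)$ with $\int_{-\tau}^0\rho=1$. (A1): for each $\ell>0$ there is $R_\ell>0$ with $|f(\phi)-f(\bar\phi)|\vee|g(\phi)-g(\bar\phi)|\le R_\ell(|\phi(0)-\bar\phi(0)|+\frac1\tau\int_{-\tau}^0|\phi-\bar\phi|\mathrm d\theta)$ whenever $\|\phi\|\vee\|\bar\phi\|\le\ell$. (A2$'$): there are $p\ge2$, $\varrho>0$, $b_1,b_2,b_3,b_4>0$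 with $b_1>b_2$, $b_3>b_4$, and $\rho_3,\rho_4\in\mathcal W$ such that for all $\phi\in\mathcal C$: $2\phi(0)^Tf(\phi)+(p-1)|g(\phi)|^2\le-b_1|\phi(0)|^2+b_2\int_{-\tau}^0|\phi(\theta)|^2\rho_3(\theta)\mathrm d\theta-b_3|\phi(0)|^{2+\varrho}+b_4\int_{-\tau}^0|\phi(\theta)|^{2+\varrho}\rho_4(\theta)\mathrm d\theta$. Scheme: $\Psi(\phi,\bar\phi)=|\phi(0)-\bar\phi(0)|^2+\frac1\tau\int_{-\tau}^0|\phi-\bar\phi|^2\mathrm d\theta$; $\Gamma:[1,\infty)\to[0,\infty)$ strictly increasing continuous, $\Gamma(l)\to\infty$, with $\sup\{\frac{|f(\phi)-f(\bar\phi)|}{\Psi^{1/2}}\vee\frac{|g(\phi)-g(\bar\phi)|^2}{\Psi}:\|\phi\|\vee\|\bar\phi\|\le l,\phi\ne\bar\phi\}\le\Gamma(l)$ for $l\ge1$; $\Gamma^{-1}$ its inverse on $[\Gamma(1),\infty)$; $K=\Gamma(1)\vee|f(\mathbf 0)|\vee|g(\mathbf 0)|^2$; $\lambda\in(0,1/2)$ fixed; $\Delta=\tau/N$ for integer $N\ge\tau$; $t_k=k\Delta$; $\Lambda(x)=(|x|\wedge\Gamma^{-1}(K\Delta^{-\lambda}))x/|x|$ ($x/|x|:=0$ if $x=0$). $\breve Y^\Delta(t_k)=\xi(t_k)$, $k=-N,\dots,0$; $Y^\Delta(t_k)=\Lambda(\breve Y^\Delta(t_k))$, $k\ge-N$;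 $\breve Y^\Delta(t_{k+1})=Y^\Delta(t_k)+f(\bar Y^\Delta_{t_k})\Delta+g(\bar Y^\Delta_{t_k})(B(t_{k+1})-B(t_k))$, $k\ge0$, with $\bar Y^\Delta_{t_k}(\theta)=\frac{(j+1)\Delta-\theta}{\Delta}Y^\Delta(t_{k+j})+\frac{\theta-j\Delta}{\Delta}Y^\Delta(t_{k+j+1})$ on $[j\Delta,(j+1)\Delta]$, $j=-N,\dots,-1$. *)

theory Defs
  imports "HOL-Probability.Probability"
begin

definition in_C :: "real \<Rightarrow> (real \<Rightarrow> 'a::real_normed_vector) \<Rightarrow> bool" where
  "in_C \<tau> \<phi> \<longleftrightarrow> continuous_on {-\<tau>..0} \<phi>"

definition supn :: "real \<Rightarrow> (real \<Rightarrow> 'a::real_normed_vector) \<Rightarrow> real" where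
  "supn \<tau> \<phi> = (SUP \<theta>\<in>{-\<tau>..0}. norm (\<phi> \<theta>))"

definition Psi :: "real \<Rightarrow> (real \<Rightarrow> 'a::euclidean_space) \<Rightarrow> (real \<Rightarrow> 'a) \<Rightarrow> real" where
  "Psi \<tau> \<phi> \<psi> = (norm (\<phi> 0 - \<psi> 0))\<^sup>2 + (1/\<tau>) * integral {-\<tau>..0} (\<lambda>\<theta>. (norm (\<phi> \<theta> - \<psi> \<theta>))\<^sup>2)"

definition weight :: "real \<Rightarrow> (real \<Rightarrow> real) \<Rightarrow> bool" where
  "weight \<tau> \<rho> \<longleftrightarrow> set_borel_measurable borel {-\<tau>..0} \<rho> \<and> bounded (\<rho> ` {-\<tau>..0})
     \<and> (\<forall>\<theta>\<in>{-\<tau>..0}. 0 \<le> \<rho> \<theta>) \<and> integral {-\<tau>..0} \<rho> = 1"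

definition std_BM :: "'w measure \<Rightarrow> (real \<Rightarrow> 'w \<Rightarrow> real^'d) \<Rightarrow> bool" where
  "std_BM M B \<longleftrightarrow> prob_space M \<and> (\<forall>t\<ge>0. B t \<in> borel_measurable M)
    \<and> (AE \<omega> in M. B 0 \<omega> = 0)
    \<and> (AE \<omega> in M. continuous_on {0..} (\<lambda>t. B t \<omega>))
    \<and> (\<forall>ts::real list. sorted_wrt (<) ts \<and> (\<forall>t\<in>set ts. 0 \<le> t) \<longrightarrow>
         prob_space.indep_vars M (\<lambda>_. borel)
            (\<lambda>(i, c) \<omega>. (B (ts ! Suc i) \<omega> - B (ts ! i) \<omega>) $ c) ({..<length ts - 1} \<times> UNIV)
       \<and> (\<forall>i < length ts - 1. \<forall>c.
            distributed M lborel (\<lambda>\<omega>. (B (ts ! Suc i) \<omega> - B (ts ! i) \<omega>) $ c)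
              (\<lambda>x. ennreal (normal_density 0 (sqrt (ts ! Suc i - ts ! i)) x))))"

text \<open>Truncation map Lambda with radius r: (|x| min r) x/|x|, with x/|x| = 0 for x = 0.\<close>
definition Lam :: "real \<Rightarrow> 'a::real_normed_vector \<Rightarrow> 'a" where
  "Lam r x = min (norm x) r *\<^sub>R sgn x"

text \<open>Piecewise linear segment at grid index m (history h indexed by m = k + N):
  on [j Delta, (j+1) Delta], j = -N..-1, interpolate h(m+j) and h(m+j+1).\<close>
definition seg :: "real \<Rightarrow> (nat \<Rightarrow> 'a::real_normed_vector) \<Rightarrow> nat \<Rightarrow> real \<Rightarrow> 'a" where
  "seg \<Delta> h m \<theta> = (let j = min \<lfloor>\<theta> / \<Delta>\<rfloor> (-1) in
      ((real_of_int (j + 1) * \<Delta> - \<theta>) / \<Delta>) *\<^sub>R h (nat (int m + j))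
    + ((\<theta> - real_of_int j * \<Delta>) / \<Delta>) *\<^sub>R h (nat (int m + j + 1)))"

text \<open>History of the truncated EM scheme along a Brownian path b:
  tem_hist ... m j = Y^Delta(t_{j-N}) for j <= N + m.\<close>
fun tem_hist :: "real \<Rightarrow> nat \<Rightarrow> real \<Rightarrow> ((real \<Rightarrow> real^'n) \<Rightarrow> real^'n)
    \<Rightarrow> ((real \<Rightarrow> real^'n) \<Rightarrow> real^'d^'n) \<Rightarrow> (real \<Rightarrow> real^'n) \<Rightarrow> (real \<Rightarrow> real^'d)
    \<Rightarrow> nat \<Rightarrow> nat \<Rightarrow> real^'n" where
  "tem_hist \<Delta> N r f g \<xi> b 0 = (\<lambda>j. Lam r (\<xi> ((real j - real N) * \<Delta>)))"
| "tem_hist \<Delta> N r f g \<xi> b (Suc m) =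
     (let h = tem_hist \<Delta> N r f g \<xi> b m; \<phi> = seg \<Delta> h (N + m) in
       h (N + Suc m := Lam r (h (N + m) + \<Delta> *\<^sub>R f \<phi>
             + g \<phi> *v (b (real (Suc m) * \<Delta>) - b (real m * \<Delta>)))))"

definition tem_Y :: "real \<Rightarrow> nat \<Rightarrow> real \<Rightarrow> ((real \<Rightarrow> real^'n) \<Rightarrow> real^'n)
    \<Rightarrow> ((real \<Rightarrow> real^'n) \<Rightarrow> real^'d^'n) \<Rightarrow> (real \<Rightarrow> real^'n) \<Rightarrow> (real \<Rightarrow> real^'d)
    \<Rightarrow> nat \<Rightarrow> real^'n" where
  "tem_Y \<Delta> N r f g \<xi> b k = tem_hist \<Delta> N r f g \<xi> b k (N + k)"

definition eln :: "real \<Rightarrow> ereal" where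
  "eln x = (if x \<le> 0 then -\<infinity> else ereal (ln x))"

end

theory Submission
  imports Defs
begin

text \<open>
  One step of the scheme adds to the current value $y$ a drift $w$ of size
  $O(\Delta^{1-\lambda})$ and a symmetric Gaussian vector $v$. Averaging over $\pm v$
  removes the odd terms in $v$, so a fourth order expansion of $|y+w+v|^p$ around $|y| = 1$,
  together with homogeneity, gives
  $E|y+w+v|^p \le |y|^p + \frac p2|y|^{p-2}(2 y\cdot w + (p-1)E|v|^2) + \mathit{error}$.
  The covariance is controlled by the dissipativity condition itself, which
  yields $E|v|^2 \le 2|y||w| + D$ with $D = O(\Delta)$; this is why the error is $o(\Delta)$ for every $p \ge 2$
  and every $\lambda < 1/2$. Constant functions in the same condition show $r^\varrho = O(\Gamma(r))$
  for the truncation radius $r$, so the superlinear part of the error is absorbed as well.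
  Jensen and Young then give a linear delay inequality for the moments of order $p$ and
  $p + \varrho$, which is summed with the weights $e^{\nu k \Delta}$; the almost sure
  statement follows by Markov and Borel--Cantelli.
\<close>

section \<open>Taylor estimates for powers of the norm\<close>

text \<open>The critical configuration is y = 0 with a history that is not small: |y|^p has no
  fourth order expansion there, and a noise error of order (E|v|^2)^(p/2) cannot be avoided.
  Bounding E|v|^2 by the growth function would give this error the size \<Delta>^((1-\<lambda>)p/2),
  which is not o(\<Delta>) for p close to 2. In the bound 2|y||w| + D the first part vanishes at y =
  0 and scales like the drift; it only produces errors like |w|^2, of order \<Delta>^(2-2\<lambda>),
  and this is where \<lambda> < 1/2 enters. The second part gives D^(p/2), of order \<Delta>^(p/2),
  which is o(\<Delta>) for p > 2. At p = 2 this gain is lost, so that case rests on the exact second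
  moment. The superlinear part of D^(p/2) has order p + p\<rho>/2 in the state (\<rho> being
  \<open>vrho\<close>), above the order p + \<rho> that dissipativity can absorb. The surplus
  \<rho>(p/2 - 1) is paid with the truncation radius, because \<Delta> r^\<rho> =
  O(\<Delta>^(1-\<lambda>)).\<close>

lemma powr_taylor3_le:
  fixes q :: real
  assumes q: "q \<ge> 1"
  obtains C :: real and M :: nat where "C \<ge> 0" "M \<ge> 2"
    "\<And>x. x \<ge> -1 \<Longrightarrow> (1 + x) powr q \<le> 1 + q * x + q * (q - 1) / 2 * x^2
        + q * (q - 1) * (q - 2) / 6 * x^3 + C * (x^4 + x^(2 * M))"
proof -
  define d where "d = (\<lambda>m t. (\<Prod>i<m. q - real i) * t powr (q - real m))"
  \<comment> \<open>\<open>2 * M\<close> is an even exponent not below q. Near 0 the Taylor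
    remainder costs x^4; for |x| \<ge> 1/2 the whole left side is dominated by x^(2M). The split is
    needed since for non-integer q < 4 the fourth derivative blows up at x = -1.\<close>
  define M where "M = max 2 (nat \<lceil>q\<rceil>)"
  \<comment> \<open>On [1/2, 3/2] both t and 1/t are at most 2, so 2^|q-4| bounds t^(q-4) whatever
    the sign of q - 4.\<close>
  define C1 where "C1 = \<bar>\<Prod>i<4. q - real i\<bar> * (2 powr \<bar>q - 4\<bar>)"
  define B where "B = \<bar>q * (q - 1) * (q - 2) / 6\<bar>"
  \<comment> \<open>For |x| \<ge> 1/2, 1 + |x| \<le> 3|x| yields 3^(2M), |x|^3 \<le> 8x^4 yields 8B
    for the cubic term and |x| \<le> 16x^4 yields 16q for the linear one. The quadratic term is
    nonnegative and is dropped.\<close>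
  define C2 where "C2 = 3 ^ (2 * M) + 8 * B + 16 * q"
  have C1: "C1 \<ge> 0" by (simp add: C1_def)
  have B: "B \<ge> 0" by (simp add: B_def)
  have C2: "C2 \<ge> 0" using q B by (simp add: C2_def)
  have M: "M \<ge> 2" "q \<le> real (2 * M)" unfolding M_def by linarith+
  have small: "(1 + x) powr q \<le> 1 + q * x + q * (q - 1) / 2 * x^2
        + q * (q - 1) * (q - 2) / 6 * x^3 + C1 * x^4" if x: "\<bar>x\<bar> \<le> 1/2" for x
  proof (cases "x = 0")
    case False
    have D: "\<forall>m t. m < 4 \<and> 1/2 \<le> t \<and> t \<le> 3/2 \<longrightarrow> (d m has_real_derivative d (Suc m) t) (at t)"
      unfolding d_def
      by (intro allI impI) (auto intro!: derivative_eq_intros simp: algebra_simps)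
    have d0: "d 0 = (\<lambda>t. t powr q)" by (simp add: d_def)
    have "\<exists>t. (if 1 + x < 1 then 1 + x < t \<and> t < 1 else 1 < t \<and> t < 1 + x) \<and>
      (1 + x) powr q = (\<Sum>m<4. d m 1 / fact m * (1 + x - 1) ^ m) + d 4 t / fact 4 * (1 + x - 1) ^ 4"
      using x False by (intro Taylor[OF _ d0 D]) (auto simp: abs_le_iff)
    then obtain t where t: "if 1 + x < 1 then 1 + x < t \<and> t < 1 else 1 < t \<and> t < 1 + x"
      "(1 + x) powr q = (\<Sum>m<4. d m 1 / fact m * (1 + x - 1) ^ m) + d 4 t / fact 4 * (1 + x - 1) ^ 4"
      by blast
    have tt: "1/2 \<le> t" "t \<le> 3/2" using t(1) x by (auto split: if_splits)
    have "t powr (q - 4) \<le> 2 powr \<bar>q - 4\<bar>"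
    proof (cases "q \<ge> 4")
      case True then show ?thesis using tt by (auto intro!: powr_mono2)
    next
      case False
      have "t powr (q - 4) = (1 / t) powr (4 - q)"
        using tt by (simp add: powr_divide powr_minus_divide[symmetric])
      also have "\<dots> \<le> 2 powr (4 - q)" using tt False by (intro powr_mono2) (auto simp: field_simps)
      finally show ?thesis using False by simp
    qed
    then have "d 4 t \<le> C1"
      unfolding d_def C1_def by (intro mult_mono) auto
    then have "d 4 t / fact 4 * x^4 \<le> C1 * x^4"
      using C1 by (intro mult_right_mono) (auto simp: fact_numeral field_simps)
    moreover have "(\<Sum>m<4. d m 1 / fact m * (1 + x - 1) ^ m) = 1 + q * x + q * (q - 1) / 2 * x^2
        + q * (q - 1) * (q - 2) / 6 * x^3"
      by (simp add: d_def eval_nat_numeral)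
    ultimately show ?thesis using t(2) by simp
  qed (use C1 in auto)
  have large: "(1 + x) powr q \<le> 1 + q * x + q * (q - 1) / 2 * x^2
        + q * (q - 1) * (q - 2) / 6 * x^3 + C2 * (x^4 + x^(2*M))" if x: "x \<ge> -1" "\<bar>x\<bar> \<ge> 1/2" for x
  proof -
    have "(1 + x) powr q \<le> (1 + \<bar>x\<bar>) powr q" using x q by (intro powr_mono2) auto
    also have "\<dots> \<le> (1 + \<bar>x\<bar>) powr (real (2 * M))" using M q by (intro powr_mono) auto
    also have "\<dots> = (1 + \<bar>x\<bar>) ^ (2*M)" by (subst powr_realpow) auto
    also have "\<dots> \<le> (3 * \<bar>x\<bar>) ^ (2*M)" using x by (intro power_mono) auto
    also have "\<dots> = 3 ^ (2*M) * x ^ (2*M)" by (simp add: power_mult_distrib power_even_abs)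
    finally have 1: "(1 + x) powr q \<le> 3 ^ (2*M) * x ^ (2*M)" .
    have x34: "\<bar>x\<bar>^3 \<le> 8 * x^4"
    proof -
      have "\<bar>x\<bar>^3 * 1 \<le> \<bar>x\<bar>^3 * (8 * \<bar>x\<bar>)" using x by (intro mult_left_mono) auto
      also have "\<dots> = 8 * x^4" by (simp add: numeral_eq_Suc)
      finally show ?thesis by simp
    qed
    have x14: "\<bar>x\<bar> \<le> 16 * x^4"
    proof -
      have "(1/2)^3 \<le> \<bar>x\<bar>^3" using x by (intro power_mono) auto
      then have "\<bar>x\<bar> * 1 \<le> \<bar>x\<bar> * (16 * \<bar>x\<bar>^3)" by (intro mult_left_mono) (auto simp: power_divide)
      also have "\<dots> = 16 * x^4" by (simp add: numeral_eq_Suc)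
      finally show ?thesis by simp
    qed
    have "- (q * x) \<le> q * \<bar>x\<bar>" using q by (simp add: abs_if)
    also have "\<dots> \<le> q * (16 * x^4)" using q x14 by (intro mult_left_mono) auto
    finally have 2: "- (q * x) \<le> 16 * q * x^4" by simp
    have "- (q * (q - 1) * (q - 2) / 6 * x^3) \<le> B * \<bar>x\<bar>^3"
      unfolding B_def by (metis abs_ge_minus_self abs_mult power_abs)
    also have "\<dots> \<le> B * (8 * x^4)" using x34 B by (intro mult_left_mono) auto
    finally have 3: "- (q * (q - 1) * (q - 2) / 6 * x^3) \<le> 8 * B * x^4" by (simp add: mult_ac)
    have 4: "0 \<le> q * (q - 1) / 2 * x^2" using q by simp
    have "0 \<le> 3 ^ (2*M) * x^4 + (8 * B + 16 * q) * x^(2*M)"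
      using q B by (intro add_nonneg_nonneg mult_nonneg_nonneg) auto
    then have "3 ^ (2*M) * x ^ (2*M) + 8 * B * x^4 + 16 * q * x^4 \<le> C2 * (x^4 + x^(2*M))"
      unfolding C2_def by (simp add: algebra_simps)
    with 1 2 3 4 show ?thesis by linarith
  qed
  show ?thesis
  proof (rule that[of "C1 + C2" M])
    fix x :: real assume x: "x \<ge> -1"
    have "C1 * x^4 \<le> (C1 + C2) * (x^4 + x^(2*M))" "C2 * (x^4 + x^(2*M)) \<le> (C1 + C2) * (x^4 + x^(2*M))"
      using C1 C2 by (auto intro!: mult_mono)
    then show "(1 + x) powr q \<le> 1 + q * x + q * (q - 1) / 2 * x^2
        + q * (q - 1) * (q - 2) / 6 * x^3 + (C1 + C2) * (x^4 + x^(2*M))"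
      using small[of x] large[of x] x by (cases "\<bar>x\<bar> \<le> 1/2") auto
  qed (use C1 C2 M in auto)
qed

lemma power_add_le:
  fixes x y :: real assumes "0 \<le> x" "0 \<le> y"
  shows "(x + y) ^ n \<le> 2 ^ n * (x ^ n + y ^ n)"
proof -
  have "(x + y) ^ n \<le> (2 * max x y) ^ n" using assms by (intro power_mono) auto
  also have "\<dots> = 2 ^ n * max x y ^ n" by (simp add: power_mult_distrib)
  also have "max x y ^ n \<le> x ^ n + y ^ n" using assms by (auto simp: max_def)
  finally show ?thesis by simp
qed

lemma power_le_add_powers:
  fixes u :: real assumes "0 \<le> u" "i \<le> j" "j \<le> k"
  shows "u ^ j \<le> u ^ i + u ^ k"
proof (cases "u \<le> 1")
  case True
  then show ?thesis using assms power_decreasing[of i j u] by (simp add: add_increasing2)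
next
  case False
  then show ?thesis using assms power_increasing[of j k u] by (simp add: add_increasing)
qed

text \<open>As |y| = 1, the squares of the two norms are 1 + s \<plusminus> c with c = 2(y+w).v;
  they are raised to q = p/2 and the odd powers of c cancel. The coefficient of |v|^2 is q from s
  plus at most 4q(q-1)/2 from c^2, in total q(2q-1) = p(p-1)/2.\<close>

lemma powr_norm_sym_le:
  fixes p :: real
  assumes p: "p \<ge> 2"
  obtains C :: real and L :: nat where "C \<ge> 0"  "L \<ge> 2"
    "\<And>y w v :: 'a::real_inner. norm y = 1 \<Longrightarrow> norm w \<le> 1 \<Longrightarrow>
       (norm (y + w + v) powr p + norm (y + w - v) powr p) / 2
         \<le> 1 + p * (y \<bullet> w) + p * (p - 1) / 2 * (norm v)^2
           + C * ((norm w)^2 + norm w * (norm v)^2 + (norm v)^4 + (norm v)^(2 * L))"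
proof -
  define q where "q = p / 2"
  have q: "q \<ge> 1" using p by (simp add: q_def)
  obtain C0 M where C0: "C0 \<ge> 0" and M: "M \<ge> 2" and T:
    "\<And>x. x \<ge> -1 \<Longrightarrow> (1 + x) powr q \<le> 1 + q * x + q * (q - 1) / 2 * x^2
        + q * (q - 1) * (q - 2) / 6 * x^3 + C0 * (x^4 + x^(2 * M))"
    using powr_taylor3_le[OF q] by metis
  define c3 where "c3 = q * (q - 1) * (q - 2) / 6"
  define L where "L = 2 * M"
  define c4 :: real where "c4 = 16 * (16 * 162 + 512)"
  define cM :: real where "cM = 4^M * (4^M * 9^M + 4^M + 2 * 16^M)"
  define C where "C = q + 30 * (q * (q - 1) / 2) + 400 * \<bar>c3\<bar>
     + C0 * (c4 + cM)"
  have fin: "(norm (y + w + v) powr p + norm (y + w - v) powr p) / 2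
         \<le> 1 + p * (y \<bullet> w) + p * (p - 1) / 2 * (norm v)^2
           + C * ((norm w)^2 + norm w * (norm v)^2 + (norm v)^4 + (norm v)^(2 * L))"
    if y: "norm y = 1" and w: "norm w \<le> 1" for y w v :: 'a
  proof -
    define W where "W = norm w"
    define u where "u = (norm v)^2"
    define s where "s = 2 * (y \<bullet> w) + W^2 + u"
    define c where "c = 2 * ((y + w) \<bullet> v)"
    \<comment> \<open>First powers of y.w and u are kept explicitly; everything else is at most a
      multiple of E, intermediate powers of u being squeezed between u^2 and u^L.\<close>
    define E where "E = W^2 + W * u + u^2 + u^L"
    have W: "0 \<le> W" "W \<le> 1" using w by (auto simp: W_def)
    have u: "0 \<le> u" by (simp add: u_def)
    have E0: "W^2 \<le> E" "W * u \<le> E" "u^2 \<le> E" "u^L \<le> E" "0 \<le> E"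
      using W u by (auto simp: E_def)
    have yy: "y \<bullet> y = 1" using y by (simp add: power2_norm_eq_inner[symmetric])
    have n1: "(norm (y + w + v))^2 = 1 + (s + c)"
      unfolding s_def c_def W_def u_def power2_norm_eq_inner
      by (simp add: inner_add_left inner_add_right yy inner_commute algebra_simps)
    have n2: "(norm (y + w - v))^2 = 1 + (s - c)"
      unfolding s_def c_def W_def u_def power2_norm_eq_inner
      by (simp add: inner_add_left inner_add_right inner_diff_left inner_diff_right yy inner_commute algebra_simps)
    have pw: "norm z powr p = ((norm z)^2) powr q" for z :: 'a
    proof -
      have "((norm z)^2) powr q = (norm z powr 2) powr q" by simp
      also have "\<dots> = norm z powr p" by (subst powr_powr) (simp add: q_def)
      finally show ?thesis ..
    qed
    have g: "s + c \<ge> -1" "s - c \<ge> -1"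
      using zero_le_power2[of "norm (y + w + v)"] zero_le_power2[of "norm (y + w - v)"]
      unfolding n1 n2 by linarith+
    have sabs: "\<bar>s\<bar> \<le> 3 * W + u"
    proof -
      have "\<bar>y \<bullet> w\<bar> \<le> W" using Cauchy_Schwarz_ineq2[of y w] y by (simp add: W_def)
      moreover have "W^2 \<le> W" using W by (simp add: power2_eq_square mult_left_le)
      ultimately show ?thesis unfolding s_def using u W zero_le_power2[of W] by linarith
    qed
    \<comment> \<open>The factor 4 has to be sharp, since this term enters the stated coefficient of
      |v|^2. In the error terms the cruder 16u suffices.\<close>
    have c2: "c^2 \<le> 4 * u + 12 * (W * u)" 
    proof -
      have "norm (y + w) \<le> 1 + W" using norm_triangle_ineq[of y w] y by (simp add: W_def)
      then have "\<bar>c\<bar> \<le> 2 * ((1 + W) * norm v)"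
        unfolding c_def using Cauchy_Schwarz_ineq2[of "y + w" v]
        by (smt (verit) abs_mult mult_right_mono norm_ge_zero)
      then have "\<bar>c\<bar>^2 \<le> (2 * ((1 + W) * norm v))^2" by (intro power_mono) auto
      also have "\<dots> = 4 * (1 + (2 * W + W^2)) * u" by (simp add: u_def power2_eq_square algebra_simps)
      also have "\<dots> \<le> 4 * (1 + 3 * W) * u"
        using W u by (intro mult_right_mono) (auto simp: power2_eq_square mult_left_le)
      finally show ?thesis by (simp add: algebra_simps)
    qed
    have c2': "c^2 \<le> 16 * u"
      using c2 mult_right_mono[OF W(2) u] by linarith
    have L4: "L \<ge> 4" using M by (simp add: L_def)
    have up: "u^j \<le> u^2 + u^L" if "2 \<le> j" "j \<le> L" for j using power_le_add_powers[OF u that] .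
    have u2L: "u^2 + u^L \<le> E" using W u by (simp add: E_def)
    have upE: "u^j \<le> E" if "2 \<le> j" "j \<le> L" for j
      using up[OF that] u2L by linarith
    have Wp: "W^j \<le> W^2" if "2 \<le> j" for j using W that by (intro power_decreasing) auto
    have WpE: "W^j \<le> E" if "2 \<le> j" for j using Wp[OF that] E0 by linarith
    have s2: "s^2 \<le> 18 * E"
    proof -
      have "\<bar>s\<bar>^2 \<le> (3 * W + u)^2" using sabs by (intro power_mono) auto
      also have "\<dots> \<le> 18 * W^2 + 2 * u^2" using zero_le_power2[of "3 * W - u"]
        by (simp add: power2_eq_square algebra_simps)
      finally have "s^2 \<le> 18 * W^2 + 2 * u^2" by simp
      also have "\<dots> \<le> 18 * E" using W u by (simp add: E_def)
      finally show ?thesis .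
    qed
    have s3: "\<bar>s^3 + 3 * s * c^2\<bar> \<le> 400 * E"
    proof -
      have "\<bar>s\<bar>^3 \<le> (3 * W + u)^3" using sabs by (intro power_mono) auto
      also have "\<dots> \<le> 2^3 * ((3 * W)^3 + u^3)" using W u by (intro power_add_le) auto
      also have "\<dots> = 216 * W^3 + 8 * u^3" by (simp add: power_mult_distrib)
      finally have a: "\<bar>s\<bar>^3 \<le> 216 * W^2 + 8 * (u^2 + u^L)" 
        using Wp[of 3] up[of 3] L4 by simp
      have "\<bar>s\<bar> * c^2 \<le> (3 * W + u) * (16 * u)" using sabs c2' W u by (intro mult_mono) auto
      also have "\<dots> = 48 * (W * u) + 16 * u^2" by (simp add: power2_eq_square algebra_simps)
      finally have b: "3 * (\<bar>s\<bar> * c^2) \<le> 144 * (W * u) + 48 * u^2" by linarith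
      have "\<bar>s^3 + 3 * s * c^2\<bar> \<le> \<bar>s\<bar>^3 + 3 * (\<bar>s\<bar> * c^2)"
        by (rule order_trans[OF abs_triangle_ineq]) (simp add: abs_mult power_abs)
      also have "\<dots> \<le> 216 * W^2 + 144 * (W * u) + 56 * u^2 + 8 * u^L" using add_mono[OF a b] by (simp add: algebra_simps)
      also have "\<dots> \<le> 400 * E" using W u by (simp add: E_def)
      finally show ?thesis .
    qed
    have x4: "(s + c)^4 + (s - c)^4 \<le> 2 * (c4 * E)"
    proof -
      have "\<bar>s\<bar>^4 \<le> (3 * W + u)^4" using sabs by (intro power_mono) auto
      also have "\<dots> \<le> 2^4 * ((3 * W)^4 + u^4)" using W u by (intro power_add_le) auto
      also have "\<dots> = 16 * (81 * W^4 + u^4)" by (simp add: power_mult_distrib)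
      also have "\<dots> \<le> 16 * (81 * E + E)" using WpE[of 4] upE[of 4] L4 by auto
      finally have a: "s^4 \<le> 16 * 162 * E" using E0 by (simp add: power_even_abs)
      have "(c^2)^2 \<le> (16 * u)^2" using c2' by (intro power_mono) auto
      then have b: "c^4 \<le> 512 * E" using E0 by (simp add: power_mult_distrib flip: power_mult)
      have "(s + c)^4 \<le> (\<bar>s\<bar> + \<bar>c\<bar>)^4" "(s - c)^4 \<le> (\<bar>s\<bar> + \<bar>c\<bar>)^4"
        using power_mono[OF abs_triangle_ineq[of s c], of 4] power_mono[OF abs_triangle_ineq4[of s c], of 4]
        by (simp_all add: power_even_abs)
      then show ?thesis using a b power_add_le[of "\<bar>s\<bar>" "\<bar>c\<bar>" 4] by (simp add: power_even_abs c4_def)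
    qed
    have xL: "(s + c)^(2*M) + (s - c)^(2*M) \<le> 2 * (cM * E)"
    proof -
      have t: "(2::real)^(2*M) = 4^M" by (simp add: power_mult)
      have "\<bar>s\<bar>^(2*M) \<le> (3 * W + u)^(2*M)" using sabs by (intro power_mono) auto
      also have "\<dots> \<le> 2^(2*M) * ((3 * W)^(2*M) + u^(2*M))" using W u by (intro power_add_le) auto
      also have "\<dots> = 4^M * (9^M * W^(2*M) + u^(2*M))" by (simp add: power_mult_distrib power_mult)
      also have "\<dots> \<le> 4^M * (9^M * E + E)"
        using WpE[of "2*M"] upE[of "2*M"] M by (intro mult_left_mono add_mono) (auto simp: L_def)
      finally have a: "s^(2*M) \<le> (4^M * 9^M + 4^M) * E" by (simp add: power_even_abs algebra_simps)
      have "(c^2)^M \<le> (16 * u)^M" using c2' by (intro power_mono) auto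
      also have "\<dots> \<le> 16^M * E" using upE[of M] M by (auto simp: power_mult_distrib L_def)
      also have "\<dots> \<le> 2 * 16^M * E" using E0 by simp
      finally have b: "c^(2*M) \<le> 2 * 16^M * E" by (simp add: power_mult)
      have "(s + c)^(2*M) \<le> (\<bar>s\<bar> + \<bar>c\<bar>)^(2*M)" "(s - c)^(2*M) \<le> (\<bar>s\<bar> + \<bar>c\<bar>)^(2*M)"
        using power_mono[OF abs_triangle_ineq[of s c], of "2*M"] power_mono[OF abs_triangle_ineq4[of s c], of "2*M"]
        by (simp_all add: power_even_abs)
      moreover have "(\<bar>s\<bar> + \<bar>c\<bar>)^(2*M) \<le> 4^M * ((4^M * 9^M + 4^M) * E + 2 * 16^M * E)"
      proof -
        have "(\<bar>s\<bar> + \<bar>c\<bar>)^(2*M) \<le> 4^M * (s^(2*M) + c^(2*M))"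
          using power_add_le[of "\<bar>s\<bar>" "\<bar>c\<bar>" "2*M"] unfolding t by (simp add: power_even_abs)
        also have "\<dots> \<le> 4^M * ((4^M * 9^M + 4^M) * E + 2 * 16^M * E)"
          using a b by (intro mult_left_mono add_mono) auto
        finally show ?thesis .
      qed
      ultimately show ?thesis by (simp add: cM_def algebra_simps)
    qed
    have Q: "0 \<le> q * (q - 1) / 2" using q by simp
    \<comment> \<open>Summed over both signs of c, the cubic part retains only s^3 + 3 s
      c^2.\<close>
    define P where "P x = 1 + q * x + q * (q - 1) / 2 * x^2 + c3 * x^3" for x
    have P2: "P (s + c) + P (s - c) = 2 * (1 + q * s + q * (q - 1) / 2 * (s^2 + c^2) + c3 * (s^3 + 3 * s * c^2))"
      by (simp add: P_def power2_eq_square power3_eq_cube field_simps)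
    have T': "(1 + x) powr q \<le> P x + C0 * x^4 + C0 * x^(2*M)" if "x \<ge> -1" for x
      using T[OF that] by (simp add: P_def c3_def distrib_left)
    have "norm (y + w + v) powr p + norm (y + w - v) powr p
       \<le> P (s + c) + C0 * (s + c)^4 + C0 * (s + c)^(2*M) + (P (s - c) + C0 * (s - c)^4 + C0 * (s - c)^(2*M))"
      unfolding pw n1 n2 by (intro add_mono T' g)
    also have "\<dots> = 2 * (1 + q * s + q * (q - 1) / 2 * (s^2 + c^2) + c3 * (s^3 + 3 * s * c^2))
          + C0 * ((s + c)^4 + (s - c)^4) + C0 * ((s + c)^(2*M) + (s - c)^(2*M))"
      unfolding P2[symmetric] by (simp add: distrib_left)
    also have "\<dots> \<le> 2 * (1 + q * s + q * (q - 1) / 2 * (18 * E + (4 * u + 12 * (W * u))) + \<bar>c3\<bar> * (400 * E))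
          + C0 * (2 * (c4 * E)) + C0 * (2 * (cM * E))"
    proof -
      have "\<bar>c3 * (s^3 + 3 * s * c^2)\<bar> \<le> \<bar>c3\<bar> * (400 * E)"
        unfolding abs_mult[of c3] by (intro mult_left_mono s3) auto
      then have m1: "c3 * (s^3 + 3 * s * c^2) \<le> \<bar>c3\<bar> * (400 * E)" by simp
      have m2: "q * (q - 1) / 2 * (s^2 + c^2) \<le> q * (q - 1) / 2 * (18 * E + (4 * u + 12 * (W * u)))"
        using s2 c2 by (intro mult_left_mono Q add_mono)
      show ?thesis
        by (intro add_mono mult_left_mono[of _ _ "2::real"] order_refl m1 m2
             mult_left_mono[OF x4 C0] mult_left_mono[OF xL C0]) auto
    qed
    finally have A: "(norm (y + w + v) powr p + norm (y + w - v) powr p) / 2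
       \<le> 1 + p * (y \<bullet> w) + p * (p - 1) / 2 * u + (q * W^2 + q * (q-1) / 2 * (18 * E + 12 * (W * u))
          + \<bar>c3\<bar> * (400 * E) + C0 * ((c4) * E) + C0 * (cM * E))"
      unfolding s_def q_def by (simp add: field_simps power2_eq_square)
    have "q * W^2 \<le> q * E" using E0 q by (intro mult_left_mono) auto
    moreover have "q * (q-1) / 2 * (18 * E + 12 * (W * u)) \<le> q * (q-1) / 2 * (30 * E)"
      using E0 by (intro mult_left_mono Q) auto
    moreover have "C * E = q * E + q * (q-1) / 2 * (30 * E) + \<bar>c3\<bar> * (400 * E)
        + C0 * ((c4) * E) + C0 * (cM * E)"
      unfolding C_def by (simp add: distrib_left distrib_right mult_ac)
    ultimately have "q * W^2 + q * (q-1) / 2 * (18 * E + 12 * (W * u)) + \<bar>c3\<bar> * (400 * E)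
        + C0 * ((c4) * E) + C0 * (cM * E) \<le> C * E"
      by (metis (no_types, lifting) add_mono order_refl)
    with A have "(norm (y + w + v) powr p + norm (y + w - v) powr p) / 2
       \<le> 1 + p * (y \<bullet> w) + p * (p - 1) / 2 * u + C * E" by linarith
    then show ?thesis by (simp add: E_def W_def u_def power_mult flip: power_mult)
  qed
  show ?thesis
    by (rule that[OF _ _ fin]) (use q C0 M in \<open>auto simp: C_def c4_def cM_def L_def intro!: add_nonneg_nonneg mult_nonneg_nonneg\<close>)
qed

section \<open>Moments of a symmetric increment\<close>

text \<open>Isolates what the moment estimates use of a Brownian increment over time \<Delta>: a
  symmetric law, even moments of order \<Delta>^j and covariance \<Delta> times the identity. The
  moment constants are a separate parameter, so that the constants derived from them depend neither
  on \<Delta> nor on the probability space.\<close>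

definition sym_incr :: "'w measure \<Rightarrow> ('w \<Rightarrow> real^'d) \<Rightarrow> real \<Rightarrow> (nat \<Rightarrow> real) \<Rightarrow> bool" where
  "sym_incr M W \<Delta> m \<longleftrightarrow> prob_space M \<and> W \<in> borel_measurable M \<and> 0 < \<Delta>
     \<and> distr M borel (\<lambda>\<omega>. - W \<omega>) = distr M borel W
     \<and> (\<forall>j. integrable M (\<lambda>\<omega>. norm (W \<omega>) ^ (2 * j)) \<and> (\<integral>\<omega>. norm (W \<omega>) ^ (2 * j) \<partial>M) \<le> m j * \<Delta> ^ j)
     \<and> (\<forall>u. (\<integral>\<omega>. (u \<bullet> W \<omega>)^2 \<partial>M) = (norm u)^2 * \<Delta>)"

text \<open>Applied to a matrix as a vector of rows, this identifies \<open>norm\<close> with the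
  trace norm.\<close>

lemma norm_vec_sq: "(norm (x :: 'a::real_inner^'n))^2 = (\<Sum>i\<in>UNIV. (norm (x $ i))^2)"
  by (simp only: power2_norm_eq_inner inner_vec_def)

lemma norm_sq_matrix_vector_mult:
  fixes A :: "real^'d^'n"
  shows "(norm (A *v x))^2 = (\<Sum>i\<in>UNIV. (A $ i \<bullet> x)^2)"
proof -
  have "(A *v x) $ i = A $ i \<bullet> x" for i
    by (simp only: matrix_vector_mult_def inner_vec_def vec_lambda_beta inner_real_def)
  then show ?thesis by (simp add: norm_vec_sq)
qed

lemma norm_matrix_vector_mult_le:
  fixes A :: "real^'d^'n"
  shows "norm (A *v x) \<le> norm A * norm x"
proof -
  have "(norm (A *v x))^2 \<le> (\<Sum>i\<in>UNIV. (norm (A $ i))^2 * (norm x)^2)"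
    unfolding norm_sq_matrix_vector_mult
    by (intro sum_mono) (metis Cauchy_Schwarz_ineq2 power_mult_distrib power_mono abs_ge_zero power2_abs)
  also have "\<dots> = (norm A * norm x)^2"
    by (simp add: power_mult_distrib norm_vec_sq sum_distrib_right)
  finally show ?thesis by (rule power2_le_imp_le) simp
qed

context
  fixes M :: "'w measure" and W :: "'w \<Rightarrow> real^'d" and \<Delta> :: real and m :: "nat \<Rightarrow> real"
  assumes inc: "sym_incr M W \<Delta> m"
begin

lemma sym_incr_prob: "prob_space M" and sym_incr_meas [measurable]: "W \<in> borel_measurable M"
  and sym_incr_pos: "0 < \<Delta>"
  using inc by (auto simp: sym_incr_def)

lemma sym_incr_mult_meas [measurable]: 
  "(\<lambda>\<omega>. (A :: real^'d^'n) *v W \<omega>) \<in> borel_measurable M"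
  by (rule borel_measurable_continuous_on[OF matrix_vector_mult_linear_continuous_on sym_incr_meas])

lemma sym_incr_moment:
  fixes A :: "real^'d^'n"
  shows "integrable M (\<lambda>\<omega>. norm (A *v W \<omega>) ^ (2 * j))"
    and "(\<integral>\<omega>. norm (A *v W \<omega>) ^ (2 * j) \<partial>M) \<le> m j * ((norm A)^2 * \<Delta>) ^ j"
proof -
  have i: "integrable M (\<lambda>\<omega>. norm (W \<omega>) ^ (2 * j))"
    and e: "(\<integral>\<omega>. norm (W \<omega>) ^ (2 * j) \<partial>M) \<le> m j * \<Delta> ^ j"
    using inc by (auto simp: sym_incr_def)
  have le: "norm (A *v x) ^ (2 * j) \<le> norm A ^ (2 * j) * norm x ^ (2 * j)" for x
    by (metis norm_matrix_vector_mult_le power_mono norm_ge_zero power_mult_distrib)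
  show int: "integrable M (\<lambda>\<omega>. norm (A *v W \<omega>) ^ (2 * j))"
    by (rule Bochner_Integration.integrable_bound[OF integrable_mult_right[OF i, of "norm A ^ (2 * j)"]])
       (use le in \<open>auto intro!: AE_I2\<close>)
  have "(\<integral>\<omega>. norm (A *v W \<omega>) ^ (2 * j) \<partial>M) \<le> (\<integral>\<omega>. norm A ^ (2 * j) * norm (W \<omega>) ^ (2 * j) \<partial>M)"
    by (intro integral_mono int integrable_mult_right i le)
  also have "\<dots> \<le> norm A ^ (2 * j) * (m j * \<Delta> ^ j)"
    using e by (simp add: mult_left_mono)
  also have "\<dots> = m j * ((norm A)^2 * \<Delta>) ^ j"
    by (simp add: power_mult_distrib power_mult)
  finally show "(\<integral>\<omega>. norm (A *v W \<omega>) ^ (2 * j) \<partial>M) \<le> m j * ((norm A)^2 * \<Delta>) ^ j" .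
qed

lemma sym_incr_moment_nonneg: "0 \<le> m j"
proof -
  have "0 \<le> (\<integral>\<omega>. norm (W \<omega>) ^ (2 * j) \<partial>M)" by simp
  also have "\<dots> \<le> m j * \<Delta> ^ j" using inc by (auto simp: sym_incr_def)
  finally show ?thesis using sym_incr_pos by (meson zero_le_mult_iff zero_less_power less_le_not_le)
qed

text \<open>An identity is needed here, because this term has to match (p-1)|g|^2 in the
  dissipativity condition with the exact constant. It follows row by row from the isotropic
  covariance.\<close>

lemma sym_incr_variance:
  fixes A :: "real^'d^'n"
  shows "(\<integral>\<omega>. (norm (A *v W \<omega>))^2 \<partial>M) = (norm A)^2 * \<Delta>"
proof -
  have i: "integrable M (\<lambda>\<omega>. (u \<bullet> W \<omega>)^2)" for u
  proof (rule Bochner_Integration.integrable_bound)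
    show "integrable M (\<lambda>\<omega>. (norm u)^2 * norm (W \<omega>) ^ (2 * 1))"
      using inc unfolding sym_incr_def by (intro integrable_mult_right) blast
    show "AE \<omega> in M. norm ((u \<bullet> W \<omega>)^2) \<le> norm ((norm u)^2 * norm (W \<omega>) ^ (2 * 1))"
    proof (rule AE_I2)
      fix \<omega>
      have "\<bar>u \<bullet> W \<omega>\<bar>^2 \<le> (norm u * norm (W \<omega>))^2"
        by (intro power_mono Cauchy_Schwarz_ineq2) auto
      then show "norm ((u \<bullet> W \<omega>)^2) \<le> norm ((norm u)^2 * norm (W \<omega>) ^ (2 * 1))"
        by (simp add: power_mult_distrib)
    qed
  qed simp
  have "(\<integral>\<omega>. (norm (A *v W \<omega>))^2 \<partial>M) = (\<Sum>i\<in>UNIV. \<integral>\<omega>. (A $ i \<bullet> W \<omega>)^2 \<partial>M)"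
    unfolding norm_sq_matrix_vector_mult by (intro Bochner_Integration.integral_sum i)
  also have "\<dots> = (\<Sum>i\<in>UNIV. (norm (A $ i))^2 * \<Delta>)"
    using inc by (simp add: sym_incr_def)
  finally show ?thesis by (simp add: norm_vec_sq sum_distrib_right)
qed

lemma sym_incr_integrable_powr:
  fixes A :: "real^'d^'n"
  assumes "p \<ge> 0"
  shows "integrable M (\<lambda>\<omega>. norm (z + A *v W \<omega>) powr p)"
proof -
  interpret prob_space M by (rule sym_incr_prob)
  define k where "k = nat \<lceil>p\<rceil>"
  have k: "p \<le> real (2 * k)" unfolding k_def by linarith
  show ?thesis
  proof (rule Bochner_Integration.integrable_bound)
    \<comment> \<open>The extra 1 keeps the base above 1, so that the exponent can be raised from p
      to the even integer 2k.\<close>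
    show "integrable M (\<lambda>\<omega>. 2 ^ (2*k) * ((1 + norm z) ^ (2*k) + norm (A *v W \<omega>) ^ (2 * k)))"
      by (intro integrable_mult_right Bochner_Integration.integrable_add sym_incr_moment) auto
    show "AE \<omega> in M. norm (norm (z + A *v W \<omega>) powr p)
        \<le> norm (2 ^ (2*k) * ((1 + norm z) ^ (2*k) + norm (A *v W \<omega>) ^ (2 * k)))"
    proof (rule AE_I2)
      fix \<omega>
      have "norm (z + A *v W \<omega>) powr p \<le> (1 + norm z + norm (A *v W \<omega>)) powr p"
        using assms norm_triangle_ineq[of z "A *v W \<omega>"] by (intro powr_mono2) auto
      also have "\<dots> \<le> (1 + norm z + norm (A *v W \<omega>)) powr (real (2 * k))"
        using k by (intro powr_mono) auto
      also have "\<dots> = (1 + norm z + norm (A *v W \<omega>)) ^ (2 * k)"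
        by (subst powr_realpow) (auto simp: add_pos_nonneg)
      also have "\<dots> \<le> 2 ^ (2*k) * ((1 + norm z) ^ (2*k) + norm (A *v W \<omega>) ^ (2 * k))"
        by (intro power_add_le) auto
      finally show "norm (norm (z + A *v W \<omega>) powr p)
        \<le> norm (2 ^ (2*k) * ((1 + norm z) ^ (2*k) + norm (A *v W \<omega>) ^ (2 * k)))"
        by simp
    qed
  qed measurable
qed

lemma sym_incr_symmetric:
  fixes A :: "real^'d^'n"
  shows "(\<integral>\<omega>. norm (z - A *v W \<omega>) powr p \<partial>M) = (\<integral>\<omega>. norm (z + A *v W \<omega>) powr p \<partial>M)"
proof -
  have c [measurable]: "(\<lambda>x. A *v x) \<in> borel_measurable borel"
    by (intro borel_measurable_continuous_onI matrix_vector_mult_linear_continuous_on)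
  have F: "(\<lambda>x. norm (z + A *v x) powr p) \<in> borel_measurable borel" by measurable
  have "(\<integral>\<omega>. norm (z - A *v W \<omega>) powr p \<partial>M) = (\<integral>\<omega>. norm (z + A *v (- W \<omega>)) powr p \<partial>M)"
    by (simp add: linear_neg[OF matrix_vector_mul_linear])
  also have "\<dots> = (\<integral>x. norm (z + A *v x) powr p \<partial>distr M borel (\<lambda>\<omega>. - W \<omega>))"
    by (subst integral_distr) (use F in auto)
  also have "\<dots> = (\<integral>x. norm (z + A *v x) powr p \<partial>distr M borel W)"
    using inc by (simp add: sym_incr_def)
  also have "\<dots> = (\<integral>\<omega>. norm (z + A *v W \<omega>) powr p \<partial>M)"
    by (subst integral_distr) (use F in auto)
  finally show ?thesis .
qed

end

section \<open>Moments of real order and the expansion over one step\<close>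

lemma powr_add_le:
  fixes x y p :: real assumes "0 \<le> x" "0 \<le> y" "0 \<le> p"
  shows "(x + y) powr p \<le> 2 powr p * (x powr p + y powr p)"
proof -
  have "(x + y) powr p \<le> (2 * max x y) powr p" using assms by (intro powr_mono2) auto
  also have "\<dots> = 2 powr p * max x y powr p" using assms by (simp add: powr_mult)
  also have "max x y powr p \<le> x powr p + y powr p" by (auto simp: max_def)
  finally show ?thesis by simp
qed

lemma powr_half_le:
  fixes a p :: real assumes "0 \<le> a" "0 \<le> p"
  shows "a powr (p / 2) \<le> 1 + a powr p"
proof (cases "a \<le> 1")
  case True
  then have "a powr (p / 2) \<le> 1" using assms by (intro powr_le1) auto
  then show ?thesis by (simp add: add_increasing2)
next
  case False
  then have "a powr (p / 2) \<le> a powr p" using assms by (intro powr_mono) auto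
  then show ?thesis by simp
qed

text \<open>Only even integer moments are at hand. With s = |x|^2/g the bound s^(p/2) \<le> 1 + s^k
  reaches real p, and the normalisation by g preserves the scaling g^(p/2). Taking for g any
  positive upper bound of the variance lets A vanish.\<close>

lemma sym_incr_powr_moment:
  fixes A :: "real^'d^'n"
  assumes inc: "sym_incr M W \<Delta> m" and p: "0 \<le> p" and g: "0 < g" "(norm A)^2 * \<Delta> \<le> g"
  shows "(\<integral>\<omega>. norm (A *v W \<omega>) powr p \<partial>M) \<le> (1 + m (nat \<lceil>p\<rceil>)) * g powr (p / 2)"
proof -
  interpret prob_space M using inc by (rule sym_incr_prob)
  define k where "k = nat \<lceil>p\<rceil>"
  have k: "p / 2 \<le> real k" using p unfolding k_def by linarith
  have le: "norm x powr p \<le> g powr (p / 2) * (1 + norm x ^ (2 * k) / g ^ k)" for x :: "real^'n"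
  proof -
    define s where "s = (norm x)^2 / g"
    have s: "0 \<le> s" using g by (simp add: s_def)
    have "norm x powr p = ((norm x)^2) powr (p / 2)"
    proof -
      have "((norm x)^2) powr (p / 2) = (norm x powr 2) powr (p / 2)" by simp
      also have "\<dots> = norm x powr p" by (subst powr_powr) simp
      finally show ?thesis ..
    qed
    also have "(norm x)^2 = g * s" using g by (simp add: s_def)
    also have "(g * s) powr (p / 2) = g powr (p / 2) * s powr (p / 2)" using g s by (simp add: powr_mult)
    also have "s powr (p / 2) \<le> 1 + s ^ k"
    proof (cases "s \<le> 1")
      case True
      then have "s powr (p / 2) \<le> 1" using p s by (intro powr_le1) auto
      then show ?thesis using s by (simp add: add_increasing2)
    next
      case False
      then have "s powr (p / 2) \<le> s powr (real k)" using k by (intro powr_mono) auto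
      then show ?thesis using False by (simp add: powr_realpow)
    qed
    finally show ?thesis by (simp add: s_def power_divide mult_left_mono flip: power_mult)
  qed
  have "(\<integral>\<omega>. norm (A *v W \<omega>) powr p \<partial>M) \<le> (\<integral>\<omega>. g powr (p / 2) * (1 + norm (A *v W \<omega>) ^ (2 * k) / g ^ k) \<partial>M)"
    using sym_incr_integrable_powr[OF inc p, of 0 A] sym_incr_moment(1)[OF inc, of A k]
    by (intro integral_mono le) (auto intro!: integrable_mult_right Bochner_Integration.integrable_add)
  also have "\<dots> = g powr (p / 2) * (1 + (\<integral>\<omega>. norm (A *v W \<omega>) ^ (2 * k) \<partial>M) / g ^ k)"
    using sym_incr_moment(1)[OF inc, of A k] by (simp add: prob_space)
  also have "\<dots> \<le> g powr (p / 2) * (1 + m k)"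
  proof -
    have "(\<integral>\<omega>. norm (A *v W \<omega>) ^ (2 * k) \<partial>M) \<le> m k * ((norm A)^2 * \<Delta>) ^ k"
      by (rule sym_incr_moment[OF inc])
    also have "\<dots> \<le> m k * g ^ k"
      using g sym_incr_pos[OF inc] by (intro mult_left_mono power_mono sym_incr_moment_nonneg[OF inc]) auto
    finally have "(\<integral>\<omega>. norm (A *v W \<omega>) ^ (2 * k) \<partial>M) / g ^ k \<le> m k" using g by (simp add: field_simps)
    then show ?thesis by (intro mult_left_mono) auto
  qed
  finally show ?thesis by (simp add: k_def mult.commute)
qed

lemma sym_incr_powr_crude:
  fixes A :: "real^'d^'n" and z :: "real^'n"
  assumes inc: "sym_incr M W \<Delta> m" and p: "0 \<le> p" and g: "0 < g" "(norm A)^2 * \<Delta> \<le> g"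
  shows "(\<integral>\<omega>. norm (z + A *v W \<omega>) powr p \<partial>M)
    \<le> 2 powr p * (norm z powr p + (1 + m (nat \<lceil>p\<rceil>)) * g powr (p / 2))"
proof -
  interpret prob_space M using inc by (rule sym_incr_prob)
  have i: "integrable M (\<lambda>\<omega>. norm (A *v W \<omega>) powr p)"
    using sym_incr_integrable_powr[OF inc p, of 0 A] by simp
  have "(\<integral>\<omega>. norm (z + A *v W \<omega>) powr p \<partial>M) \<le> (\<integral>\<omega>. 2 powr p * (norm z powr p + norm (A *v W \<omega>) powr p) \<partial>M)"
  proof (intro integral_mono sym_incr_integrable_powr[OF inc p] integrable_mult_right Bochner_Integration.integrable_add i)
    fix \<omega>
    have "norm (z + A *v W \<omega>) powr p \<le> (norm z + norm (A *v W \<omega>)) powr p"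
      using p by (intro powr_mono2 norm_triangle_ineq) auto
    also have "\<dots> \<le> 2 powr p * (norm z powr p + norm (A *v W \<omega>) powr p)" using p by (intro powr_add_le) auto
    finally show "norm (z + A *v W \<omega>) powr p \<le> 2 powr p * (norm z powr p + norm (A *v W \<omega>) powr p)" .
  qed auto
  also have "\<dots> = 2 powr p * (norm z powr p + (\<integral>\<omega>. norm (A *v W \<omega>) powr p \<partial>M))"
    using i by (simp add: prob_space)
  also have "\<dots> \<le> 2 powr p * (norm z powr p + (1 + m (nat \<lceil>p\<rceil>)) * g powr (p / 2))"
    by (intro mult_left_mono add_left_mono sym_incr_powr_moment[OF inc p g]) auto
  finally show ?thesis .
qed

text \<open>Here a bounds the drift and a + D the variance. With a and D at most 1 the variance is
  at most 2, so its higher powers cost only constants and every error of the pathwise expansion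
  becomes quadratic in (a, D).\<close>

lemma moment_unit_small:
  fixes p :: real and m :: "nat \<Rightarrow> real"
  assumes p: "p \<ge> 2" and m: "\<And>j. 0 \<le> m j"
  obtains C :: real where "C \<ge> 0"
    "\<And>(M :: 'w measure) (W :: 'w \<Rightarrow> real^'d) \<Delta> (A :: real^'d^'n) (y :: real^'n) w a D.
       sym_incr M W \<Delta> m \<Longrightarrow> norm y = 1 \<Longrightarrow> norm w \<le> a \<Longrightarrow> a \<le> 1 \<Longrightarrow> 0 \<le> D \<Longrightarrow> D \<le> 1 \<Longrightarrow>
       (norm A)^2 * \<Delta> \<le> a + D \<Longrightarrow>
       (\<integral>\<omega>. norm (y + w + A *v W \<omega>) powr p \<partial>M)
         \<le> 1 + p * (y \<bullet> w) + p * (p - 1) / 2 * ((norm A)^2 * \<Delta>) + C * (a^2 + D^2)"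
proof -
  obtain C0 L where C0: "C0 \<ge> 0" and L: "L \<ge> 2" and T: "\<And>y w v :: real^'n. norm y = 1 \<Longrightarrow> norm w \<le> 1 \<Longrightarrow>
       (norm (y + w + v) powr p + norm (y + w - v) powr p) / 2
         \<le> 1 + p * (y \<bullet> w) + p * (p - 1) / 2 * (norm v)^2
           + C0 * ((norm w)^2 + norm w * (norm v)^2 + (norm v)^4 + (norm v)^(2 * L))"
    using powr_norm_sym_le[OF p, where 'a = "real^'n"] by metis
  define C where "C = C0 * (4 + 2 * m 2 + 2 * (m L * 2 ^ L))"
  show ?thesis
  proof (rule that[of C])
    show "C \<ge> 0" using C0 m by (simp add: C_def)
    fix M :: "'w measure" and W :: "'w \<Rightarrow> real^'d" and \<Delta> and A :: "real^'d^'n" and y w :: "real^'n" and a D :: real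
    assume inc: "sym_incr M W \<Delta> m" and y: "norm y = 1" and w: "norm w \<le> a" and a: "a \<le> 1"
      and D: "0 \<le> D" "D \<le> 1" and G: "(norm A)^2 * \<Delta> \<le> a + D"
    interpret prob_space M using inc by (rule sym_incr_prob)
    define V where "V = (\<lambda>\<omega>. A *v W \<omega>)"
    define G' where "G' = (norm A)^2 * \<Delta>"
    have G': "0 \<le> G'" "G' \<le> a + D" using G sym_incr_pos[OF inc] by (auto simp: G'_def)
    have a0: "0 \<le> a" using w norm_ge_zero order_trans by blast
    have w1: "norm w \<le> 1" using w a by linarith
    have i: "integrable M (\<lambda>\<omega>. norm (V \<omega>) ^ (2 * j))" for j
      unfolding V_def by (rule sym_incr_moment[OF inc])
    have e: "(\<integral>\<omega>. norm (V \<omega>) ^ (2 * j) \<partial>M) \<le> m j * G' ^ j" for j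
      unfolding V_def G'_def by (rule sym_incr_moment[OF inc])
    have i2: "integrable M (\<lambda>\<omega>. (norm (V \<omega>))^2)" using i[of 1] by simp
    have i4: "integrable M (\<lambda>\<omega>. (norm (V \<omega>))^4)" using i[of 2] by simp
    have e2: "(\<integral>\<omega>. (norm (V \<omega>))^2 \<partial>M) = G'"
      unfolding V_def G'_def by (rule sym_incr_variance[OF inc])
    have e4: "(\<integral>\<omega>. (norm (V \<omega>))^4 \<partial>M) \<le> m 2 * G'^2" using e[of 2] by simp
    have ip: "integrable M (\<lambda>\<omega>. norm (y + w + V \<omega>) powr p)"
      unfolding V_def using p by (intro sym_incr_integrable_powr[OF inc]) auto
    have im: "integrable M (\<lambda>\<omega>. norm (y + w - V \<omega>) powr p)"
    proof -
      have "(- A) *v W \<omega> = - V \<omega>" for \<omega>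
        by (simp add: V_def matrix_vector_mult_def sum_negf vec_eq_iff)
      then show ?thesis using sym_incr_integrable_powr[OF inc, of p "y + w" "- A"] p by simp
    qed
    \<comment> \<open>Symmetry of the law allows the integrand to be averaged over both signs before
      the pointwise bound is applied.\<close>
    have "(\<integral>\<omega>. norm (y + w + V \<omega>) powr p \<partial>M) = (\<integral>\<omega>. (norm (y + w + V \<omega>) powr p + norm (y + w - V \<omega>) powr p) / 2 \<partial>M)"
      using ip im sym_incr_symmetric[OF inc, of "y + w" A p] by (simp add: V_def)
    also have "\<dots> \<le> (\<integral>\<omega>. 1 + p * (y \<bullet> w) + p * (p - 1) / 2 * (norm (V \<omega>))^2
           + C0 * ((norm w)^2 + norm w * (norm (V \<omega>))^2 + (norm (V \<omega>))^4 + (norm (V \<omega>))^(2 * L)) \<partial>M)"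
      by (intro integral_mono T y w1 Bochner_Integration.integrable_add integrable_mult_right integrable_divide ip im i2 i4 i integrable_const)
    also have "\<dots> = 1 + p * (y \<bullet> w) + p * (p - 1) / 2 * G'
           + C0 * ((norm w)^2 + norm w * G' + (\<integral>\<omega>. (norm (V \<omega>))^4 \<partial>M) + (\<integral>\<omega>. (norm (V \<omega>))^(2 * L) \<partial>M))"
      using i2 i4 i[of L] e2 by (simp add: prob_space)
    also have "\<dots> \<le> 1 + p * (y \<bullet> w) + p * (p - 1) / 2 * G'
           + C0 * (a^2 + a * G' + m 2 * G'^2 + m L * (2 ^ L * G'^2))"
    proof (intro add_mono order_refl mult_left_mono C0 e4)
      show "(norm w)^2 \<le> a^2" using w by (intro power_mono) auto
      show "norm w * G' \<le> a * G'" using w G' by (intro mult_right_mono)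
      have "G' ^ L = G'^(L - 2) * G'^2" using L by (metis le_add_diff_inverse2 power_add)
      also have "\<dots> \<le> 2 ^ (L - 2) * G'^2"
        using G' a D by (intro mult_right_mono power_mono) auto
      also have "\<dots> \<le> 2 ^ L * G'^2" by (intro mult_right_mono power_increasing) auto
      finally have "m L * G' ^ L \<le> m L * (2 ^ L * G'^2)" using m by (intro mult_left_mono)
      with e[of L] show "(\<integral>\<omega>. (norm (V \<omega>))^(2 * L) \<partial>M) \<le> m L * (2 ^ L * G'^2)" by linarith
    qed
    also have "\<dots> \<le> 1 + p * (y \<bullet> w) + p * (p - 1) / 2 * G' + C * (a^2 + D^2)"
    proof -
      have "G'^2 \<le> (a + D)^2" using G' by (intro power_mono)
      also have "\<dots> \<le> 2 * (a^2 + D^2)" using zero_le_power2[of "a - D"] by (simp add: power2_eq_square algebra_simps)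
      finally have g2: "G'^2 \<le> 2 * (a^2 + D^2)" .
      have "a * G' \<le> a * (a + D)" using a0 G' by (intro mult_left_mono)
      also have "\<dots> \<le> 2 * (a^2 + D^2)"
      proof -
        have "2 * (a^2 + D^2) - a * (a + D) = ((a - D)^2 + a^2 + 3 * D^2) / 2"
          by (simp add: power2_eq_square field_simps)
        moreover have "0 \<le> ((a - D)^2 + a^2 + 3 * D^2) / 2" by simp
        ultimately show ?thesis by linarith
      qed
      finally have ag: "a * G' \<le> 2 * (a^2 + D^2)" .
      have "a^2 + a * G' + m 2 * G'^2 + m L * (2 ^ L * G'^2)
         \<le> (a^2 + D^2) + 2 * (a^2 + D^2) + m 2 * (2 * (a^2 + D^2)) + m L * (2 ^ L * (2 * (a^2 + D^2)))"
        using g2 ag m by (intro add_mono mult_left_mono) auto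
      also have "\<dots> \<le> (4 + 2 * m 2 + 2 * (m L * 2 ^ L)) * (a^2 + D^2)"
        by (simp add: algebra_simps)
      finally show ?thesis unfolding C_def mult.assoc[of C0] using C0 by (intro add_left_mono mult_left_mono)
    qed
    finally show "(\<integral>\<omega>. norm (y + w + A *v W \<omega>) powr p \<partial>M)
         \<le> 1 + p * (y \<bullet> w) + p * (p - 1) / 2 * ((norm A)^2 * \<Delta>) + C * (a^2 + D^2)"
      by (simp add: V_def G'_def)
  qed
qed

text \<open>Removes the restriction to small a and D. If both are below a threshold \<delta>, the
  error C1 D^2 is at most \<epsilon> D. Otherwise 1 is at most \<delta>^(-p) (D^(p/2) + a^p), so
  even the constant in the crude moment bound passes into the error.\<close>

lemma moment_unit:
  fixes p \<epsilon> :: real and m :: "nat \<Rightarrow> real"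
  assumes p: "p \<ge> 2" and m: "\<And>j. 0 \<le> m j" and eps: "\<epsilon> > 0"
  obtains C :: real where "C \<ge> 0"
    "\<And>(M :: 'w measure) (W :: 'w \<Rightarrow> real^'d) \<Delta> (A :: real^'d^'n) (y :: real^'n) w a D.
       sym_incr M W \<Delta> m \<Longrightarrow> norm y = 1 \<Longrightarrow> norm w \<le> a \<Longrightarrow> 0 \<le> D \<Longrightarrow> (norm A)^2 * \<Delta> \<le> a + D \<Longrightarrow>
       (\<integral>\<omega>. norm (y + w + A *v W \<omega>) powr p \<partial>M)
         \<le> 1 + p * (y \<bullet> w) + p * (p - 1) / 2 * ((norm A)^2 * \<Delta>) + \<epsilon> * D
            + C * (D powr (p / 2) + a^2 + a powr p)"
proof -
  obtain C1 where C1: "C1 \<ge> 0" and S: 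
    "\<And>(M :: 'w measure) (W :: 'w \<Rightarrow> real^'d) \<Delta> (A :: real^'d^'n) (y :: real^'n) w a D.
       sym_incr M W \<Delta> m \<Longrightarrow> norm y = 1 \<Longrightarrow> norm w \<le> a \<Longrightarrow> a \<le> 1 \<Longrightarrow> 0 \<le> D \<Longrightarrow> D \<le> 1 \<Longrightarrow>
       (norm A)^2 * \<Delta> \<le> a + D \<Longrightarrow>
       (\<integral>\<omega>. norm (y + w + A *v W \<omega>) powr p \<partial>M)
         \<le> 1 + p * (y \<bullet> w) + p * (p - 1) / 2 * ((norm A)^2 * \<Delta>) + C1 * (a^2 + D^2)"
    by (fact moment_unit_small[OF p m])
  \<comment> \<open>Chosen so that C1 \<delta> \<le> \<epsilon>; the cap 1 keeps the small regime
    inside the range of the expansion.\<close>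
  define \<delta> where "\<delta> = min 1 (\<epsilon> / (C1 + 1))"
  have d: "0 < \<delta>" "\<delta> \<le> 1" using eps C1 by (auto simp: \<delta>_def)
  have "C1 * \<delta> \<le> C1 * (\<epsilon> / (C1 + 1))" using C1 by (intro mult_left_mono) (auto simp: \<delta>_def)
  also have "\<dots> \<le> \<epsilon>" using C1 eps by (simp add: field_simps)
  finally have d2: "C1 * \<delta> \<le> \<epsilon>" .
  define m' where "m' = 1 + m (nat \<lceil>p\<rceil>)"
  have m': "0 \<le> m'" using m[of "nat \<lceil>p\<rceil>"] by (simp add: m'_def)
  define C2 where "C2 = 2 powr p * (2 powr p + m' * 2 powr (p / 2)) + p"
  have C2: "0 \<le> C2" using m' p by (simp add: C2_def)
  define C3 where "C3 = C2 * (2 + \<delta> powr (- p))"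
  have C3: "0 \<le> C3" using C2 by (simp add: C3_def)
  show ?thesis
  proof (rule that[of "C1 + C3"])
    show "0 \<le> C1 + C3" using C1 C3 by simp
    fix M :: "'w measure" and W :: "'w \<Rightarrow> real^'d" and \<Delta> and A :: "real^'d^'n" and y w :: "real^'n" and a D :: real
    assume inc: "sym_incr M W \<Delta> m" and y: "norm y = 1" and w: "norm w \<le> a"
      and D: "0 \<le> D" and G: "(norm A)^2 * \<Delta> \<le> a + D"
    have a0: "0 \<le> a" using w norm_ge_zero order_trans by blast
    have G0: "0 \<le> (norm A)^2 * \<Delta>" using sym_incr_pos[OF inc] by simp
    show "(\<integral>\<omega>. norm (y + w + A *v W \<omega>) powr p \<partial>M)
         \<le> 1 + p * (y \<bullet> w) + p * (p - 1) / 2 * ((norm A)^2 * \<Delta>) + \<epsilon> * D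
            + (C1 + C3) * (D powr (p / 2) + a^2 + a powr p)"
    proof (cases "a \<le> \<delta> \<and> D \<le> \<delta>")
      case True
      have "C1 * D^2 = (C1 * D) * D" by (simp add: power2_eq_square)
      also have "\<dots> \<le> (C1 * \<delta>) * D" using True C1 D by (intro mult_right_mono mult_left_mono) auto
      also have "\<dots> \<le> \<epsilon> * D" using d2 D by (intro mult_right_mono)
      finally have "C1 * D^2 \<le> \<epsilon> * D" .
      moreover have "C1 * a^2 \<le> (C1 + C3) * (D powr (p / 2) + a^2 + a powr p)"
        using C1 C3 by (intro mult_mono) auto
      ultimately show ?thesis using S[OF inc y w _ D _ G] True d by (simp add: distrib_left)
    next
      case False
      define X where "X = D powr (p / 2) + a powr p"
      have X: "0 \<le> X" by (simp add: X_def)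
      have one: "1 \<le> \<delta> powr (- p) * X"
      proof (cases "a \<le> \<delta>")
        case False
        have "\<delta> powr p \<le> a powr p" using False d p by (intro powr_mono2) auto
        also have "\<dots> \<le> X" by (simp add: X_def)
        finally show ?thesis using d by (simp add: powr_minus field_simps)
      next
        case True
        then have D1: "\<delta> < D" using False by simp
        \<comment> \<open>Since \<delta> \<le> 1, the factor \<delta>^(-p) serves for a large D as
          well as for a large a.\<close>
        have "\<delta> powr p \<le> \<delta> powr (p / 2)" using d p by (intro powr_mono') auto
        also have "\<dots> \<le> D powr (p / 2)" using D1 d p by (intro powr_mono2) auto
        also have "\<dots> \<le> X" by (simp add: X_def)
        finally show ?thesis using d by (simp add: powr_minus field_simps)
      qed
      have pos: "0 < a + D" using False d a0 D by auto
      have "(\<integral>\<omega>. norm (y + w + A *v W \<omega>) powr p \<partial>M)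
         \<le> 2 powr p * (norm (y + w) powr p + m' * (a + D) powr (p / 2))"
        unfolding m'_def by (rule sym_incr_powr_crude[OF inc _ pos G]) (use p in auto)
      also have "\<dots> \<le> 2 powr p * (2 powr p * (1 + X) + m' * (2 powr (p / 2) * (1 + X)))"
      proof (intro mult_left_mono add_mono m')
        have "norm (y + w) powr p \<le> (1 + a) powr p"
          using norm_triangle_ineq[of y w] y w p by (intro powr_mono2) auto
        also have "\<dots> \<le> 2 powr p * (1 powr p + a powr p)" using a0 p by (intro powr_add_le) auto
        also have "\<dots> \<le> 2 powr p * (1 + X)" by (intro mult_left_mono) (auto simp: X_def)
        finally show "norm (y + w) powr p \<le> 2 powr p * (1 + X)" .
        have "(a + D) powr (p / 2) \<le> 2 powr (p / 2) * (a powr (p / 2) + D powr (p / 2))"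
          using a0 D p by (intro powr_add_le) auto
        also have "\<dots> \<le> 2 powr (p / 2) * (1 + X)"
          using powr_half_le[of a p] a0 p by (intro mult_left_mono) (auto simp: X_def)
        finally show "(a + D) powr (p / 2) \<le> 2 powr (p / 2) * (1 + X)" .
      qed auto
      finally have I: "(\<integral>\<omega>. norm (y + w + A *v W \<omega>) powr p \<partial>M)
          \<le> 2 powr p * (2 powr p + m' * 2 powr (p / 2)) * (1 + X)"
        by (simp add: algebra_simps)
      \<comment> \<open>The target contains p(y.w), which may be negative, so it is estimated from
        below and moved to the other side.\<close>
      have "- (y \<bullet> w) \<le> a" using Cauchy_Schwarz_ineq2[of y w] y w by auto
      also have "a \<le> 1 + a powr p"
        using powr_half_le[of a 2] a0 p powr_mono[of 1 p a] by (cases "a \<le> 1") (auto simp: add_increasing2)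
      also have "\<dots> \<le> 1 + X" by (simp add: X_def)
      finally have "p * (- (y \<bullet> w)) \<le> p * (1 + X)" using p by (intro mult_left_mono) auto
      with I have "(\<integral>\<omega>. norm (y + w + A *v W \<omega>) powr p \<partial>M) - p * (y \<bullet> w) \<le> C2 * (1 + X)"
        unfolding C2_def by (simp add: distrib_right)
      also have "\<dots> \<le> C2 * (\<delta> powr (- p) * X + X)" using one C2 by (intro mult_left_mono) auto
      also have "\<dots> \<le> C3 * X" unfolding C3_def using C2 X by (simp add: algebra_simps)
      also have "\<dots> \<le> (C1 + C3) * (D powr (p / 2) + a^2 + a powr p)"
        unfolding X_def using C1 C3 by (intro mult_mono) auto
      finally have "(\<integral>\<omega>. norm (y + w + A *v W \<omega>) powr p \<partial>M)
        \<le> p * (y \<bullet> w) + (C1 + C3) * (D powr (p / 2) + a^2 + a powr p)" by linarith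
      moreover have "0 \<le> p * (p - 1) / 2 * ((norm A)^2 * \<Delta>)" using G0 p by simp
      moreover have "0 \<le> \<epsilon> * D" using eps D by simp
      ultimately show ?thesis by linarith
    qed
  qed
qed

text \<open>Division by t = |y| reduces to the unit sphere. It turns a into a/t and D into D/t^2,
  which is why the variance hypothesis reads a|y| + D. Multiplying back by t^p cancels the
  denominators in D^(p/2) and a^p, so no negative power of |y| remains.\<close>

lemma moment_step:
  fixes p \<epsilon> :: real and m :: "nat \<Rightarrow> real"
  assumes p: "p > 2" and m: "\<And>j. 0 \<le> m j" and eps: "\<epsilon> > 0"
  obtains C :: real where "C \<ge> 0"
    "\<And>(M :: 'w measure) (W :: 'w \<Rightarrow> real^'d) \<Delta> (A :: real^'d^'n) (y :: real^'n) w a D.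
       sym_incr M W \<Delta> m \<Longrightarrow> norm w \<le> a \<Longrightarrow> 0 \<le> D \<Longrightarrow> (norm A)^2 * \<Delta> \<le> a * norm y + D \<Longrightarrow>
       (\<integral>\<omega>. norm (y + w + A *v W \<omega>) powr p \<partial>M)
         \<le> norm y powr p + norm y powr (p - 2) * (p * (y \<bullet> w) + p * (p - 1) / 2 * ((norm A)^2 * \<Delta>) + \<epsilon> * D + C * a^2)
            + C * (D powr (p / 2) + a powr p)"
proof -
  obtain C1 where C1: "C1 \<ge> 0" and U: 
    "\<And>(M :: 'w measure) (W :: 'w \<Rightarrow> real^'d) \<Delta> (A :: real^'d^'n) (y :: real^'n) w a D.
       sym_incr M W \<Delta> m \<Longrightarrow> norm y = 1 \<Longrightarrow> norm w \<le> a \<Longrightarrow> 0 \<le> D \<Longrightarrow> (norm A)^2 * \<Delta> \<le> a + D \<Longrightarrow>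
       (\<integral>\<omega>. norm (y + w + A *v W \<omega>) powr p \<partial>M)
         \<le> 1 + p * (y \<bullet> w) + p * (p - 1) / 2 * ((norm A)^2 * \<Delta>) + \<epsilon> * D
            + C1 * (D powr (p / 2) + a^2 + a powr p)"
    by (fact moment_unit[OF less_imp_le[OF p] m eps])
  define m' where "m' = 1 + m (nat \<lceil>p\<rceil>)"
  have m': "0 \<le> m'" using m[of "nat \<lceil>p\<rceil>"] by (simp add: m'_def)
  define C where "C = C1 + 2 powr p * (1 + m')"
  have C: "C \<ge> C1" "C \<ge> 2 powr p * (1 + m')" "C \<ge> 0" using C1 m' by (auto simp: C_def)
  show ?thesis
  proof (rule that[of C])
    show "0 \<le> C" by fact
    fix M :: "'w measure" and W :: "'w \<Rightarrow> real^'d" and \<Delta> and A :: "real^'d^'n" and y w :: "real^'n" and a D :: real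
    assume inc: "sym_incr M W \<Delta> m" and w: "norm w \<le> a"
      and D: "0 \<le> D" and G: "(norm A)^2 * \<Delta> \<le> a * norm y + D"
    have a0: "0 \<le> a" using w norm_ge_zero order_trans by blast
    interpret prob_space M using inc by (rule sym_incr_prob)
    show "(\<integral>\<omega>. norm (y + w + A *v W \<omega>) powr p \<partial>M)
         \<le> norm y powr p + norm y powr (p - 2) * (p * (y \<bullet> w) + p * (p - 1) / 2 * ((norm A)^2 * \<Delta>) + \<epsilon> * D + C * a^2)
            + C * (D powr (p / 2) + a powr p)"
    proof (cases "y = 0")
      case True
      have "(\<integral>\<omega>. norm (w + A *v W \<omega>) powr p \<partial>M) \<le> 2 powr p * (a powr p + m' * D powr (p / 2))"
      \<comment> \<open>The crude bound divides by a positive variance bound. For y = 0 and D = 0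
        the matrix A vanishes and the step is deterministic.\<close>
      proof (cases "D = 0")
        case False
        have "(\<integral>\<omega>. norm (w + A *v W \<omega>) powr p \<partial>M) \<le> 2 powr p * (norm w powr p + m' * D powr (p / 2))"
          unfolding m'_def by (rule sym_incr_powr_crude[OF inc]) (use p D False G True in auto)
        also have "\<dots> \<le> 2 powr p * (a powr p + m' * D powr (p / 2))"
          using w p by (intro mult_left_mono add_right_mono powr_mono2) auto
        finally show ?thesis .
      next
        case True2: True
        then have "(norm A)^2 * \<Delta> \<le> 0" using G True by simp
        then have "A = 0" using sym_incr_pos[OF inc] by (simp add: mult_le_0_iff)
        then have "(\<integral>\<omega>. norm (w + A *v W \<omega>) powr p \<partial>M) = norm w powr p" by (simp add: prob_space)
        also have "\<dots> \<le> a powr p" using w p by (intro powr_mono2) auto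
        also have "\<dots> \<le> 2 powr p * a powr p" using p by (simp add: ge_one_powr_ge_zero mult_le_cancel_right1)
        finally show ?thesis using True2 by simp
      qed
      also have "\<dots> \<le> C * (D powr (p / 2) + a powr p)"
      proof -
        have "2 powr p * (a powr p + m' * D powr (p / 2)) \<le> 2 powr p * ((1 + m') * (D powr (p / 2) + a powr p))"
          using m' by (intro mult_left_mono) (auto simp: algebra_simps)
        also have "\<dots> \<le> C * (D powr (p / 2) + a powr p)"
          unfolding mult.assoc[symmetric] using C by (intro mult_right_mono) auto
        finally show ?thesis .
      qed
      finally show ?thesis using True by simp
    next
      case False
      define t where "t = norm y"
      have t: "0 < t" using False by (simp add: t_def)
      have sc: "norm (y + w + A *v W \<omega>) powr p = t powr p * norm (y /\<^sub>R t + w /\<^sub>R t + (A /\<^sub>R t) *v W \<omega>) powr p" for \<omega>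
      proof -
        have e: "y /\<^sub>R t + w /\<^sub>R t + (A /\<^sub>R t) *v W \<omega> = (y + w + A *v W \<omega>) /\<^sub>R t"
          by (simp add: scaleR_add_right scaleR_matrix_vector_assoc)
        have "norm (y + w + A *v W \<omega>) = t * norm ((y + w + A *v W \<omega>) /\<^sub>R t)" using t by simp
        then show ?thesis unfolding e using t by (metis powr_mult norm_ge_zero less_imp_le)
      qed
      have tt: "t powr p = t^2 * t powr (p - 2)" "(t^2) powr (p / 2) = t powr p"
      proof -
        show "t powr p = t^2 * t powr (p - 2)" using t by (simp add: powr_diff)
        have "(t^2) powr (p / 2) = (t powr 2) powr (p / 2)" using t by simp
        then show "(t^2) powr (p / 2) = t powr p" by (simp add: powr_powr)
      qed
      have n: "(norm (A /\<^sub>R t))^2 * \<Delta> = ((norm A)^2 * \<Delta>) / t^2"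
        using t by (simp add: power_divide field_simps power_mult_distrib)
      have "(\<integral>\<omega>. norm (y /\<^sub>R t + w /\<^sub>R t + (A /\<^sub>R t) *v W \<omega>) powr p \<partial>M)
        \<le> 1 + p * ((y /\<^sub>R t) \<bullet> (w /\<^sub>R t)) + p * (p - 1) / 2 * ((norm (A /\<^sub>R t))^2 * \<Delta>) + \<epsilon> * (D / t^2)
            + C1 * ((D / t^2) powr (p / 2) + (a / t)^2 + (a / t) powr p)"
      proof (rule U[OF inc])
        show "norm (y /\<^sub>R t) = 1" using t by (simp add: t_def)
        show "norm (w /\<^sub>R t) \<le> a / t" using t w by (simp add: field_simps)
        show "0 \<le> D / t^2" using D by simp
        show "(norm (A /\<^sub>R t))^2 * \<Delta> \<le> a / t + D / t^2"
          unfolding n using G t by (simp add: t_def[symmetric] field_simps power2_eq_square)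
      qed
      then have "t powr p * (\<integral>\<omega>. norm (y /\<^sub>R t + w /\<^sub>R t + (A /\<^sub>R t) *v W \<omega>) powr p \<partial>M)
        \<le> t powr p * (1 + p * ((y /\<^sub>R t) \<bullet> (w /\<^sub>R t)) + p * (p - 1) / 2 * ((norm (A /\<^sub>R t))^2 * \<Delta>) + \<epsilon> * (D / t^2)
            + C1 * ((D / t^2) powr (p / 2) + (a / t)^2 + (a / t) powr p))"
        by (intro mult_left_mono) auto
      also have "\<dots> = t powr p + t powr (p - 2) * (p * (y \<bullet> w) + p * (p - 1) / 2 * ((norm A)^2 * \<Delta>) + \<epsilon> * D + C1 * a^2)
            + C1 * (D powr (p / 2) + a powr p)"
      proof -
        have e1: "t powr p * (D / t^2) powr (p / 2) = D powr (p / 2)" "t powr p * (a / t) powr p = a powr p"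
          using t D a0 by (auto simp: powr_divide tt(2))
        have e2: "t powr p * ((y /\<^sub>R t) \<bullet> (w /\<^sub>R t)) = t powr (p - 2) * (y \<bullet> w)"
          "t powr p * (((norm A)^2 * \<Delta>) / t^2) = t powr (p - 2) * ((norm A)^2 * \<Delta>)"
          "t powr p * (D / t^2) = t powr (p - 2) * D" "t powr p * (a / t)^2 = t powr (p - 2) * a^2"
          unfolding tt(1) using t by (auto simp: field_simps power2_eq_square)
        have gen: "t powr p * (1 + p * X1 + p * (p - 1) / 2 * X2 + \<epsilon> * X3 + C1 * (X4 + X5 + X6))
          = t powr p + p * (t powr p * X1) + p * (p - 1) / 2 * (t powr p * X2) + \<epsilon> * (t powr p * X3)
             + C1 * (t powr p * X4 + t powr p * X5 + t powr p * X6)" for X1 X2 X3 X4 X5 X6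
          by (simp add: algebra_simps)
        show ?thesis unfolding n by (subst gen, unfold e1 e2, simp add: algebra_simps)
      qed
      also have "\<dots> \<le> t powr p + t powr (p - 2) * (p * (y \<bullet> w) + p * (p - 1) / 2 * ((norm A)^2 * \<Delta>) + \<epsilon> * D + C * a^2)
            + C * (D powr (p / 2) + a powr p)"
        using C by (intro add_mono mult_left_mono mult_right_mono order_refl) auto
      finally show ?thesis unfolding sc t_def by simp
    qed
  qed
qed

section \<open>Piecewise linear interpolation\<close>

text \<open>The tent function of the grid point (i - N)\<Delta>. On [-\<tau>,0] the tents form a
  partition of unity, so that \<open>seg\<close> is a convex combination of N + 1 grid values at
  every point.\<close>

definition hat :: "real \<Rightarrow> nat \<Rightarrow> nat \<Rightarrow> real \<Rightarrow> real" where
  "hat \<Delta> N i \<theta> = max 0 (1 - \<bar>\<theta> / \<Delta> + real N - real i\<bar>)"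

lemma hat_nonneg: "0 \<le> hat \<Delta> N i \<theta>"
  by (simp add: hat_def)

lemma continuous_on_hat: "\<Delta> \<noteq> 0 \<Longrightarrow> continuous_on S (hat \<Delta> N i)"
  unfolding hat_def by (intro continuous_intros) auto

lemma sum_hat_scaleR:
  fixes v :: "nat \<Rightarrow> 'a::real_vector"
  assumes N: "1 \<le> N" and x: "0 \<le> x" "x \<le> real N" and j: "j = min (nat \<lfloor>x\<rfloor>) (N - 1)"
  shows "(\<Sum>i\<le>N. max 0 (1 - \<bar>x - real i\<bar>) *\<^sub>R v i) = (real j + 1 - x) *\<^sub>R v j + (x - real j) *\<^sub>R v (Suc j)"
proof -
  have jx: "real j \<le> x" "x \<le> real j + 1" "Suc j \<le> N"
    using j x N by (auto simp: min_def) linarith+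
  have "(\<Sum>i\<le>N. max 0 (1 - \<bar>x - real i\<bar>) *\<^sub>R v i) = (\<Sum>i\<in>{j, Suc j}. max 0 (1 - \<bar>x - real i\<bar>) *\<^sub>R v i)"
  proof (rule sum.mono_neutral_right)
    show "\<forall>i\<in>{..N} - {j, Suc j}. max 0 (1 - \<bar>x - real i\<bar>) *\<^sub>R v i = 0"
    proof
      fix i assume "i \<in> {..N} - {j, Suc j}"
      then have "i < j \<or> Suc (Suc j) \<le> i" by auto
      then have "real i + 1 \<le> real j \<or> real j + 2 \<le> real i" by linarith
      then have "1 - \<bar>x - real i\<bar> \<le> 0" using jx by linarith
      then show "max 0 (1 - \<bar>x - real i\<bar>) *\<^sub>R v i = 0" by (simp add: max_def)
    qed
  qed (use jx in auto)
  also have "\<dots> = (real j + 1 - x) *\<^sub>R v j + (x - real j) *\<^sub>R v (Suc j)"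
    using jx by (simp add: max_def)
  finally show ?thesis .
qed

lemma grid_range:
  assumes "0 < \<Delta>" "\<theta> \<in> {- (real N * \<Delta>)..0}"
  shows "0 \<le> \<theta> / \<Delta> + real N" "\<theta> / \<Delta> + real N \<le> real N"
  using assms by (auto simp: field_simps divide_nonpos_pos)

lemma sum_hat:
  assumes "0 < \<Delta>" "1 \<le> N" "\<theta> \<in> {- (real N * \<Delta>)..0}"
  shows "(\<Sum>i\<le>N. hat \<Delta> N i \<theta>) = 1"
  using sum_hat_scaleR[OF assms(2) grid_range[OF assms(1,3)] refl, of "\<lambda>_. 1::real"]
  by (simp add: hat_def)

lemma seg_eq_sum_hat:
  assumes D: "0 < \<Delta>" and N: "1 \<le> N" and t: "\<theta> \<in> {- (real N * \<Delta>)..0}"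
  shows "seg \<Delta> h (N + m) \<theta> = (\<Sum>i\<le>N. hat \<Delta> N i \<theta> *\<^sub>R h (m + i))"
proof -
  define x where "x = \<theta> / \<Delta> + real N"
  have x: "0 \<le> x" "x \<le> real N" using grid_range[OF D t] by (auto simp: x_def)
  define j where "j = min (nat \<lfloor>x\<rfloor>) (N - 1)"
  have fl: "\<lfloor>x\<rfloor> = \<lfloor>\<theta> / \<Delta>\<rfloor> + int N" by (simp add: x_def)
  \<comment> \<open>\<open>seg\<close> numbers the cells from -N to -1, the tents number them from 0
    to N - 1; at \<theta> = 0 both minima select the last cell.\<close>
  have jj: "min \<lfloor>\<theta> / \<Delta>\<rfloor> (-1) = int j - int N"
    using x N fl unfolding j_def by (auto simp: min_def nat_le_iff) linarith+
  have th: "\<theta> = (x - real N) * \<Delta>" using D by (simp add: x_def)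
  have "seg \<Delta> h (N + m) \<theta> = (real j + 1 - x) *\<^sub>R h (m + j) + (x - real j) *\<^sub>R h (m + Suc j)"
  proof -
    have "nat (int (N + m) + (int j - int N)) = m + j" "nat (int (N + m) + (int j - int N) + 1) = m + Suc j"
      by auto
    moreover have "(real_of_int (int j - int N + 1) * \<Delta> - \<theta>) / \<Delta> = real j + 1 - x"
      "(\<theta> - real_of_int (int j - int N) * \<Delta>) / \<Delta> = x - real j"
      using D by (simp_all add: th field_simps)
    ultimately show ?thesis unfolding seg_def Let_def jj by simp
  qed
  also have "\<dots> = (\<Sum>i\<le>N. max 0 (1 - \<bar>x - real i\<bar>) *\<^sub>R h (m + i))"
    by (rule sum_hat_scaleR[OF N x j_def, symmetric])
  finally show ?thesis by (simp add: hat_def x_def)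
qed

lemma seg_at_0: "0 < \<Delta> \<Longrightarrow> seg \<Delta> h m 0 = h m"
  by (simp add: seg_def)

lemma continuous_on_seg:
  assumes "0 < \<Delta>" "1 \<le> N"
  shows "continuous_on {- (real N * \<Delta>)..0} (seg \<Delta> h (N + m))"
proof (subst continuous_on_cong[OF refl seg_eq_sum_hat[OF assms]])
  show "continuous_on {- (real N * \<Delta>)..0} (\<lambda>\<theta>. \<Sum>i\<le>N. hat \<Delta> N i \<theta> *\<^sub>R h (m + i))"
    using assms by (intro continuous_intros continuous_on_hat) auto
qed auto

text \<open>The endpoint 0 must be included because grid values may vanish; there convexity amounts
  to (t x)^p \<le> t x^p for t in [0,1].\<close>

lemma convex_on_powr_nonneg:
  fixes p :: real assumes p: "1 \<le> p"
  shows "convex_on {0..} (\<lambda>x. x powr p)"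
proof (rule convex_onI)
  have scale: "(t * x) powr p \<le> t * x powr p" if "0 \<le> t" "t \<le> 1" "0 \<le> x" for t x :: real
  proof -
    have "t powr p \<le> t" using p that powr_mono'[of 1 p t] by (cases "t = 0") auto
    then show ?thesis using that by (simp add: powr_mult mult_right_mono)
  qed
  fix t x y :: real assume t: "0 < t" "t < 1" and xy: "x \<in> {0..}" "y \<in> {0..}"
  consider "x = 0" | "y = 0" | "0 < x" "0 < y" using xy by force
  then show "((1 - t) *\<^sub>R x + t *\<^sub>R y) powr p \<le> (1 - t) * x powr p + t * y powr p"
  proof cases
    case 1 then show ?thesis using scale[of t y] t xy by simp
  next
    case 2 then show ?thesis using scale[of "1 - t" x] t xy by simp
  next
    case 3 then show ?thesis using convex_onD[OF powr_convex[OF p], of t x y] t by simp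
  qed
qed auto

lemma norm_seg_powr_le:
  assumes D: "0 < \<Delta>" and N: "1 \<le> N" and t: "\<theta> \<in> {- (real N * \<Delta>)..0}" and s: "1 \<le> s"
  shows "norm (seg \<Delta> h (N + m) \<theta>) powr s \<le> (\<Sum>i\<le>N. hat \<Delta> N i \<theta> * norm (h (m + i)) powr s)"
proof -
  have "norm (seg \<Delta> h (N + m) \<theta>) \<le> (\<Sum>i\<le>N. norm (hat \<Delta> N i \<theta> *\<^sub>R h (m + i)))"
    unfolding seg_eq_sum_hat[OF D N t] by (rule norm_sum)
  also have "\<dots> = (\<Sum>i\<le>N. hat \<Delta> N i \<theta> *\<^sub>R norm (h (m + i)))"
    by (simp add: hat_nonneg)
  finally have "norm (seg \<Delta> h (N + m) \<theta>) powr s \<le> (\<Sum>i\<le>N. hat \<Delta> N i \<theta> *\<^sub>R norm (h (m + i))) powr s"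
    using s by (intro powr_mono2) auto
  also have "\<dots> \<le> (\<Sum>i\<le>N. hat \<Delta> N i \<theta> * norm (h (m + i)) powr s)"
    by (rule convex_on_sum[OF _ _ convex_on_powr_nonneg[OF s]]) (auto simp: hat_nonneg sum_hat[OF D N t])
  finally show ?thesis .
qed

lemma norm_seg_le:
  assumes D: "0 < \<Delta>" and N: "1 \<le> N" and t: "\<theta> \<in> {- (real N * \<Delta>)..0}" and r: "\<And>i. i \<le> N \<Longrightarrow> norm (h (m + i)) \<le> r"
  shows "norm (seg \<Delta> h (N + m) \<theta>) \<le> r"
proof -
  have "norm (seg \<Delta> h (N + m) \<theta>) \<le> (\<Sum>i\<le>N. norm (hat \<Delta> N i \<theta> *\<^sub>R h (m + i)))"
    unfolding seg_eq_sum_hat[OF D N t] by (rule norm_sum)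
  also have "\<dots> \<le> (\<Sum>i\<le>N. hat \<Delta> N i \<theta> * r)"
    by (intro sum_mono) (auto simp: hat_nonneg intro!: mult_left_mono r)
  also have "\<dots> = r" by (simp add: sum_hat[OF D N t] flip: sum_distrib_right)
  finally show ?thesis .
qed

section \<open>Delay weights on the grid\<close>

definition density_on :: "real \<Rightarrow> (real \<Rightarrow> real) \<Rightarrow> bool" where
  "density_on \<tau> \<rho> \<longleftrightarrow> (\<forall>\<theta>\<in>{-\<tau>..0}. 0 \<le> \<rho> \<theta>) \<and> integral {-\<tau>..0} \<rho> = 1"

text \<open>The share of the density that falls to tent i. These shares form a probability vector
  over the N + 1 grid values and replace the delay integral.\<close>

definition hatw :: "real \<Rightarrow> nat \<Rightarrow> (real \<Rightarrow> real) \<Rightarrow> nat \<Rightarrow> real" where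
  "hatw \<Delta> N \<rho> i = integral {- (real N * \<Delta>)..0} (\<lambda>\<theta>. hat \<Delta> N i \<theta> * \<rho> \<theta>)"

lemma integrable_mult_density:
  fixes u :: "real \<Rightarrow> real"
  assumes "density_on \<tau> \<rho>" "continuous_on {-\<tau>..0} u"
  shows "(\<lambda>\<theta>. u \<theta> * \<rho> \<theta>) integrable_on {-\<tau>..0}"
proof -
  \<comment> \<open>The integral of a non-integrable function is 0 by convention, so total mass 1
    carries integrability with it.\<close>
  have "\<rho> integrable_on {-\<tau>..0}"
    using assms(1) not_integrable_integral[of \<rho> "{-\<tau>..0}"] by (auto simp: density_on_def)
  then have "\<rho> absolutely_integrable_on {-\<tau>..0}"
    using assms(1) by (intro nonnegative_absolutely_integrable_1) (auto simp: density_on_def)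
  moreover have "u \<in> borel_measurable (lebesgue_on {-\<tau>..0})"
    using assms(2) by (intro continuous_imp_measurable_on_sets_lebesgue) auto
  moreover have "bounded (u ` {-\<tau>..0})"
    using assms(2) by (intro compact_imp_bounded compact_continuous_image) auto
  ultimately have "(\<lambda>\<theta>. u \<theta> * \<rho> \<theta>) absolutely_integrable_on {-\<tau>..0}"
    by (intro absolutely_integrable_bounded_measurable_product_real) auto
  then show ?thesis by (rule absolutely_integrable_on_def[THEN iffD1, THEN conjunct1])
qed

lemma hatw_nonneg: "density_on (real N * \<Delta>) \<rho> \<Longrightarrow> 0 < \<Delta> \<Longrightarrow> 0 \<le> hatw \<Delta> N \<rho> i"
  unfolding hatw_def
  by (intro integral_nonneg integrable_mult_density continuous_on_hat) (auto simp: hat_nonneg density_on_def)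

lemma sum_hatw:
  assumes d: "density_on (real N * \<Delta>) \<rho>" and D: "0 < \<Delta>" and N: "1 \<le> N"
  shows "(\<Sum>i\<le>N. hatw \<Delta> N \<rho> i) = 1"
proof -
  have "(\<Sum>i\<le>N. hatw \<Delta> N \<rho> i) = integral {- (real N * \<Delta>)..0} (\<lambda>\<theta>. \<Sum>i\<le>N. hat \<Delta> N i \<theta> * \<rho> \<theta>)"
    unfolding hatw_def using D
    by (subst integral_sum) (auto intro!: integrable_mult_density d continuous_on_hat)
  also have "\<dots> = integral {- (real N * \<Delta>)..0} \<rho>"
    by (intro integral_cong) (simp add: sum_hat[OF D N] flip: sum_distrib_right)
  finally show ?thesis using d by (simp add: density_on_def)
qed

text \<open>Jensen's inequality at each \<theta>, with the tents as convex weights, then integration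
  against the density.\<close>

lemma integral_seg_powr_le:
  assumes d: "density_on (real N * \<Delta>) \<rho>" and D: "0 < \<Delta>" and N: "1 \<le> N" and s: "1 \<le> s"
  shows "integral {- (real N * \<Delta>)..0} (\<lambda>\<theta>. norm (seg \<Delta> h (N + m) \<theta>) powr s * \<rho> \<theta>)
    \<le> (\<Sum>i\<le>N. hatw \<Delta> N \<rho> i * norm (h (m + i)) powr s)"
proof -
  have c: "continuous_on {- (real N * \<Delta>)..0} (\<lambda>\<theta>. norm (seg \<Delta> h (N + m) \<theta>) powr s)"
    using s by (intro continuous_on_powr' continuous_intros continuous_on_seg D N) auto
  have i: "(\<lambda>\<theta>. hat \<Delta> N i \<theta> * \<rho> \<theta> * c) integrable_on {- (real N * \<Delta>)..0}" for i c
    using D by (intro integrable_on_mult_left integrable_mult_density d continuous_on_hat) auto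
  have "integral {- (real N * \<Delta>)..0} (\<lambda>\<theta>. norm (seg \<Delta> h (N + m) \<theta>) powr s * \<rho> \<theta>)
    \<le> integral {- (real N * \<Delta>)..0} (\<lambda>\<theta>. \<Sum>i\<le>N. hat \<Delta> N i \<theta> * \<rho> \<theta> * norm (h (m + i)) powr s)"
  proof (intro integral_le integrable_mult_density[OF d c] integrable_sum i)
    fix \<theta> assume t: "\<theta> \<in> {- (real N * \<Delta>)..0}"
    have "norm (seg \<Delta> h (N + m) \<theta>) powr s * \<rho> \<theta> \<le> (\<Sum>i\<le>N. hat \<Delta> N i \<theta> * norm (h (m + i)) powr s) * \<rho> \<theta>"
      using t d by (intro mult_right_mono norm_seg_powr_le D N s) (auto simp: density_on_def)
    then show "norm (seg \<Delta> h (N + m) \<theta>) powr s * \<rho> \<theta> \<le> (\<Sum>i\<le>N. hat \<Delta> N i \<theta> * \<rho> \<theta> * norm (h (m + i)) powr s)"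
      by (simp add: sum_distrib_right sum_distrib_left mult_ac)
  qed auto
  also have "\<dots> = (\<Sum>i\<le>N. hatw \<Delta> N \<rho> i * norm (h (m + i)) powr s)"
    unfolding hatw_def by (subst integral_sum) (auto intro!: i)
  finally show ?thesis .
qed

lemma supn_le:
  assumes "0 \<le> \<tau>" "\<And>\<theta>. \<theta> \<in> {-\<tau>..0} \<Longrightarrow> norm (\<phi> \<theta>) \<le> l"
  shows "supn \<tau> \<phi> \<le> l"
  unfolding supn_def using assms by (intro cSUP_least) auto

lemma density_on_weight: "weight \<tau> \<rho> \<Longrightarrow> density_on \<tau> \<rho>"
  by (simp add: weight_def density_on_def)

lemma density_on_uniform: "0 < \<tau> \<Longrightarrow> density_on \<tau> (\<lambda>_. 1 / \<tau>)"
  by (simp add: density_on_def)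

text \<open>\<open>Psi\<close> is a denominator in the growth condition; continuity turns one point
  of difference into a positive integral, so the quotient can be cleared.\<close>

lemma Psi_pos:
  assumes "0 < \<tau>" "in_C \<tau> \<phi>" "in_C \<tau> \<psi>" "\<theta> \<in> {-\<tau>..0}" "\<phi> \<theta> \<noteq> \<psi> \<theta>"
  shows "0 < Psi \<tau> \<phi> \<psi>"
proof -
  let ?u = "\<lambda>\<theta>. (norm (\<phi> \<theta> - \<psi> \<theta>))^2"
  have c: "continuous_on {-\<tau>..0} ?u"
    using assms by (intro continuous_intros) (auto simp: in_C_def)
  have "integral {-\<tau>..0} ?u \<noteq> 0"
    using integral_eq_0_iff[OF c] assms by auto
  moreover have "0 \<le> integral {-\<tau>..0} ?u"
    by (intro integral_nonneg integrable_continuous_interval c) auto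
  ultimately show ?thesis using assms(1) unfolding Psi_def by (auto intro!: add_nonneg_pos)
qed

section \<open>Brownian increments and independence\<close>

lemma borel_measurable_vec_componentwise:
  fixes F :: "'a \<Rightarrow> real^'n"
  assumes "\<And>i. (\<lambda>x. F x $ i) \<in> borel_measurable M"
  shows "F \<in> borel_measurable M"
proof (rule borel_measurable_euclidean_space[THEN iffD2], rule ballI)
  fix b :: "real^'n" assume "b \<in> Basis"
  then obtain i where "b = axis i 1" unfolding Basis_vec_def by auto
  then have "(\<lambda>x. F x \<bullet> b) = (\<lambda>x. F x $ i)" by (simp add: inner_axis fun_eq_iff)
  then show "(\<lambda>x. F x \<bullet> b) \<in> borel_measurable M" using assms[of i] by metis
qed

lemma borel_measurable_vec_nth:
  fixes F :: "'a \<Rightarrow> 'b::euclidean_space^'n"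
  assumes "F \<in> borel_measurable M"
  shows "(\<lambda>x. F x $ i) \<in> borel_measurable M"
  by (rule borel_measurable_continuous_on[where f = "\<lambda>v. v $ i", OF _ assms]) (intro continuous_intros)

text \<open>(2j)!/(2^j j!) is the moment of order 2j of a standard normal variable. One factor d^j
  comes from expanding the power of a sum of d squares, the last d from adding up the
  components.\<close>

definition gauss_const :: "nat \<Rightarrow> nat \<Rightarrow> real" where
  "gauss_const d j = real d ^ Suc j * (fact (2 * j) / (2 ^ j * fact j))"

lemma sum_power_le:
  fixes x :: "'d::finite \<Rightarrow> real"
  assumes "\<And>c. 0 \<le> x c"
  shows "(\<Sum>c\<in>UNIV. x c) ^ j \<le> real CARD('d) ^ j * (\<Sum>c\<in>UNIV. x c ^ j)"
proof -
  have "Max (range x) \<in> range x" by (intro Max_in) auto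
  then obtain c where c: "x c = Max (range x)" by (metis rangeE)
  have le: "x c' \<le> x c" for c' unfolding c by (intro Max_ge) auto
  have "(\<Sum>c\<in>UNIV. x c) \<le> real CARD('d) * x c"
    using sum_mono[of UNIV x "\<lambda>_. x c"] le by simp
  then have "(\<Sum>c\<in>UNIV. x c) ^ j \<le> (real CARD('d) * x c) ^ j"
    using assms by (intro power_mono sum_nonneg)
  also have "\<dots> = real CARD('d) ^ j * x c ^ j" by (rule power_mult_distrib)
  also have "\<dots> \<le> real CARD('d) ^ j * (\<Sum>c\<in>UNIV. x c ^ j)"
    using assms by (intro mult_left_mono member_le_sum) auto
  finally show ?thesis .
qed

lemma (in prob_space) sym_incr_gaussian:
  fixes W :: "'a \<Rightarrow> real^'d"
  assumes \<Delta>: "0 < \<Delta>" and ind: "indep_vars (\<lambda>_. borel) (\<lambda>c \<omega>. W \<omega> $ c) UNIV"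
    and dis: "\<And>c. distributed M lborel (\<lambda>\<omega>. W \<omega> $ c) (\<lambda>x. ennreal (normal_density 0 (sqrt \<Delta>) x))"
  shows "sym_incr M W \<Delta> (gauss_const CARD('d))"
proof -
  have rv [measurable]: "(\<lambda>\<omega>. W \<omega> $ c) \<in> borel_measurable M" for c
    using ind by (auto simp: indep_vars_def)
  have W [measurable]: "W \<in> borel_measurable M"
    by (rule borel_measurable_vec_componentwise) simp
  have s: "0 < sqrt \<Delta>" using \<Delta> by simp
  \<comment> \<open>By independence the joint law of the components is the product of the marginals,
    and each centred Gaussian marginal is symmetric. The map V carries the product law over to
    vectors.\<close>
  have sym: "distr M borel (\<lambda>\<omega>. - W \<omega>) = distr M borel W"
  proof -
    define V where "V = (\<lambda>x :: 'd \<Rightarrow> real. (\<chi> c. x c))"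
    have V [measurable]: "V \<in> measurable (\<Pi>\<^sub>M c\<in>UNIV. borel) borel"
      by (rule borel_measurable_vec_componentwise) (simp add: V_def)
    have dV: "distr M borel U = distr (distr M (\<Pi>\<^sub>M c\<in>UNIV. borel) (\<lambda>\<omega>. \<lambda>c\<in>UNIV. U \<omega> $ c)) borel V"
      if [measurable]: "U \<in> borel_measurable M" for U :: "'a \<Rightarrow> real^'d"
    proof -
      have r: "(\<lambda>\<omega>. \<lambda>c\<in>UNIV. U \<omega> $ c) \<in> measurable M (\<Pi>\<^sub>M c\<in>UNIV. borel)"
        by (intro measurable_restrict borel_measurable_vec_nth) simp
      have "V \<circ> (\<lambda>\<omega>. \<lambda>c\<in>UNIV. U \<omega> $ c) = U" by (simp add: V_def fun_eq_iff vec_eq_iff)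
      then show ?thesis using distr_distr[OF V r] by simp
    qed
    have ind': "indep_vars (\<lambda>_. borel) (\<lambda>c \<omega>. (- W \<omega>) $ c) UNIV"
      using indep_vars_compose2[OF ind, of "\<lambda>_ x. - x" "\<lambda>_. borel"] by simp
    have comp: "distr M borel (\<lambda>\<omega>. (- W \<omega>) $ c) = distr M borel (\<lambda>\<omega>. W \<omega> $ c)" for c
    proof -
      have "distributed M lborel (\<lambda>\<omega>. 0 + (-1) * (W \<omega> $ c)) (\<lambda>x. ennreal (normal_density (0 + (-1) * 0) (\<bar>-1\<bar> * sqrt \<Delta>) x))"
        by (rule normal_density_affine[OF dis s]) auto
      then have "distributed M lborel (\<lambda>\<omega>. (- W \<omega>) $ c) (\<lambda>x. ennreal (normal_density 0 (sqrt \<Delta>) x))" by simp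
      then have "distr M lborel (\<lambda>\<omega>. (- W \<omega>) $ c) = distr M lborel (\<lambda>\<omega>. W \<omega> $ c)"
        using dis[of c] by (simp add: distributed_distr_eq_density)
      then show ?thesis by (metis (no_types, lifting) distr_cong sets_lborel)
    qed
    have "distr M (\<Pi>\<^sub>M c\<in>UNIV. borel) (\<lambda>\<omega>. \<lambda>c\<in>UNIV. (- W \<omega>) $ c) = (\<Pi>\<^sub>M c\<in>UNIV. distr M borel (\<lambda>\<omega>. (- W \<omega>) $ c))"
      by (rule indep_vars_iff_distr_eq_PiM[THEN iffD1, OF _ _ ind']) auto
    also have "\<dots> = (\<Pi>\<^sub>M c\<in>UNIV. distr M borel (\<lambda>\<omega>. W \<omega> $ c))" unfolding comp ..
    also have "\<dots> = distr M (\<Pi>\<^sub>M c\<in>UNIV. borel) (\<lambda>\<omega>. \<lambda>c\<in>UNIV. W \<omega> $ c)"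
      by (rule indep_vars_iff_distr_eq_PiM[THEN iffD1, OF _ _ ind, symmetric]) auto
    finally show ?thesis using dV[of W] dV[of "\<lambda>\<omega>. - W \<omega>"] by simp
  qed
  have mom: "has_bochner_integral M (\<lambda>\<omega>. (W \<omega> $ c) ^ (2 * j)) (\<Delta> ^ j * (fact (2 * j) / (2 ^ j * fact j)))" for c j
  proof -
    have h: "has_bochner_integral lborel (\<lambda>x. normal_density 0 (sqrt \<Delta>) x * x ^ (2 * j)) (\<Delta> ^ j * (fact (2 * j) / (2 ^ j * fact j)))"
      using normal_moment_even[OF s, of 0 j] \<Delta> by (simp add: power_divide field_simps)
    have "integrable M (\<lambda>\<omega>. (W \<omega> $ c) ^ (2 * j))"
      using distributed_integrable[OF dis[of c], of "\<lambda>x. x ^ (2 * j)"] h by (auto simp: has_bochner_integral_iff)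
    moreover have "(\<integral>\<omega>. (W \<omega> $ c) ^ (2 * j) \<partial>M) = \<Delta> ^ j * (fact (2 * j) / (2 ^ j * fact j))"
      using distributed_integral[OF dis[of c], of "\<lambda>x. x ^ (2 * j)"] h by (auto simp: has_bochner_integral_iff)
    ultimately show ?thesis by (simp add: has_bochner_integral_iff)
  qed
  have m1: "integrable M (\<lambda>\<omega>. W \<omega> $ c)" "(\<integral>\<omega>. W \<omega> $ c \<partial>M) = 0" for c
  proof -
    have h: "has_bochner_integral lborel (\<lambda>x. normal_density 0 (sqrt \<Delta>) x * x) 0"
      using normal_moment_odd[OF s, of 0 0] by simp
    show "integrable M (\<lambda>\<omega>. W \<omega> $ c)"
      using distributed_integrable[OF dis[of c], of "\<lambda>x. x"] h by (auto simp: has_bochner_integral_iff)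
    show "(\<integral>\<omega>. W \<omega> $ c \<partial>M) = 0"
      using distributed_integral[OF dis[of c], of "\<lambda>x. x"] h by (auto simp: has_bochner_integral_iff)
  qed
  have norm_le: "norm x ^ (2 * j) \<le> real CARD('d) ^ j * (\<Sum>c\<in>UNIV. (x $ c) ^ (2 * j))" for x :: "real^'d" and j
  proof -
    have "norm x ^ (2 * j) = (\<Sum>c\<in>UNIV. (x $ c)^2) ^ j"
      by (simp add: power_mult norm_vec_sq)
    also have "\<dots> \<le> real CARD('d) ^ j * (\<Sum>c\<in>UNIV. ((x $ c)^2) ^ j)" by (rule sum_power_le) simp
    finally show ?thesis by (simp add: power_mult)
  qed
  have int: "integrable M (\<lambda>\<omega>. norm (W \<omega>) ^ (2 * j))" for j
  proof (rule Bochner_Integration.integrable_bound)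
    show "integrable M (\<lambda>\<omega>. real CARD('d) ^ j * (\<Sum>c\<in>UNIV. (W \<omega> $ c) ^ (2 * j)))"
      using mom by (intro integrable_mult_right Bochner_Integration.integrable_sum) (auto simp: has_bochner_integral_iff)
    show "AE \<omega> in M. norm (norm (W \<omega>) ^ (2 * j)) \<le> norm (real CARD('d) ^ j * (\<Sum>c\<in>UNIV. (W \<omega> $ c) ^ (2 * j)))"
    proof (rule AE_I2)
      fix \<omega>
      have "norm (norm (W \<omega>) ^ (2 * j)) \<le> real CARD('d) ^ j * (\<Sum>c\<in>UNIV. (W \<omega> $ c) ^ (2 * j))"
        using norm_le[of "W \<omega>" j] by simp
      also have "\<dots> \<le> norm (real CARD('d) ^ j * (\<Sum>c\<in>UNIV. (W \<omega> $ c) ^ (2 * j)))"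
        unfolding real_norm_def by (rule abs_ge_self)
      finally show "norm (norm (W \<omega>) ^ (2 * j)) \<le> norm (real CARD('d) ^ j * (\<Sum>c\<in>UNIV. (W \<omega> $ c) ^ (2 * j)))" .
    qed
  qed measurable
  have bound: "(\<integral>\<omega>. norm (W \<omega>) ^ (2 * j) \<partial>M) \<le> gauss_const CARD('d) j * \<Delta> ^ j" for j
  proof -
    have "(\<integral>\<omega>. norm (W \<omega>) ^ (2 * j) \<partial>M) \<le> (\<integral>\<omega>. real CARD('d) ^ j * (\<Sum>c\<in>UNIV. (W \<omega> $ c) ^ (2 * j)) \<partial>M)"
      using mom norm_le by (intro integral_mono int integrable_mult_right Bochner_Integration.integrable_sum) (auto simp: has_bochner_integral_iff)
    also have "\<dots> = real CARD('d) ^ j * (\<Sum>c\<in>(UNIV :: 'd set). \<Delta> ^ j * (fact (2 * j) / (2 ^ j * fact j)))"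
      using mom by (simp add: has_bochner_integral_iff)
    also have "\<dots> = gauss_const CARD('d) j * \<Delta> ^ j" by (simp add: gauss_const_def)
    finally show ?thesis .
  qed
  \<comment> \<open>Off the diagonal, independence and zero means remove the product; this makes the
    covariance \<Delta> times the identity.\<close>
  have cov: "integrable M (\<lambda>\<omega>. W \<omega> $ c * W \<omega> $ c')" "(\<integral>\<omega>. W \<omega> $ c * W \<omega> $ c' \<partial>M) = (if c = c' then \<Delta> else 0)" for c c'
  proof -
    have "has_bochner_integral M (\<lambda>\<omega>. W \<omega> $ c * W \<omega> $ c') (if c = c' then \<Delta> else 0)"
    proof (cases "c = c'")
      case True then show ?thesis using mom[of c 1] by (simp add: power2_eq_square)
    next
      case False
      have i: "indep_vars (\<lambda>_. borel) (\<lambda>c \<omega>. W \<omega> $ c) {c, c'}" using ind by (rule indep_vars_subset) simp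
      show ?thesis
        using indep_vars_lebesgue_integral[OF _ i m1(1)] indep_vars_integrable[OF _ i m1(1)] False
        by (simp add: m1 has_bochner_integral_iff)
    qed
    then show "integrable M (\<lambda>\<omega>. W \<omega> $ c * W \<omega> $ c')" "(\<integral>\<omega>. W \<omega> $ c * W \<omega> $ c' \<partial>M) = (if c = c' then \<Delta> else 0)"
      by (simp_all add: has_bochner_integral_iff)
  qed
  have var: "(\<integral>\<omega>. (u \<bullet> W \<omega>)^2 \<partial>M) = (norm u)^2 * \<Delta>" for u
  proof -
    have "(u \<bullet> W \<omega>)^2 = (\<Sum>c\<in>UNIV. \<Sum>c'\<in>UNIV. (u $ c * u $ c') * (W \<omega> $ c * W \<omega> $ c'))" for \<omega>
      by (simp add: inner_vec_def power2_eq_square sum_product mult_ac)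
    then have "(\<integral>\<omega>. (u \<bullet> W \<omega>)^2 \<partial>M) = (\<Sum>c\<in>UNIV. \<Sum>c'\<in>UNIV. (u $ c * u $ c') * (if c = c' then \<Delta> else 0))"
      using cov by simp
    also have "\<dots> = (\<Sum>c\<in>UNIV. (u $ c)^2 * \<Delta>)"
      by (simp add: if_distrib power2_eq_square cong: if_cong)
    finally show ?thesis by (simp add: norm_vec_sq sum_distrib_right)
  qed
  show ?thesis
    unfolding sym_incr_def using sym int bound var \<Delta> W prob_space_axioms by blast
qed

lemma std_BM_increments:
  fixes B :: "real \<Rightarrow> 'w \<Rightarrow> real^'d"
  assumes BM: "std_BM M B" and \<Delta>: "0 < \<Delta>"
  defines "D \<equiv> \<lambda>k \<omega>. B (real (Suc k) * \<Delta>) \<omega> - B (real k * \<Delta>) \<omega>"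
  shows "prob_space.indep_vars M (\<lambda>_. borel) (\<lambda>(i, c) \<omega>. D i \<omega> $ c) ({..<n} \<times> UNIV)"
    and "sym_incr M (D k) \<Delta> (gauss_const CARD('d))"
proof -
  interpret prob_space M using BM by (simp add: std_BM_def)
  have "indep_vars (\<lambda>_. borel) (\<lambda>(i, c) \<omega>. D i \<omega> $ c) ({..<n} \<times> UNIV) \<and>
    (\<forall>i<n. \<forall>c. distributed M lborel (\<lambda>\<omega>. D i \<omega> $ c) (\<lambda>x. ennreal (normal_density 0 (sqrt \<Delta>) x)))" for n
  proof -
    \<comment> \<open>n + 1 grid times, so that the increments of the list are exactly those of
      index below n.\<close>
    define ts where "ts = map (\<lambda>i. real i * \<Delta>) [0..<Suc n]"
    have len: "length ts - 1 = n" by (simp add: ts_def)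
    have nth: "ts ! i = real i * \<Delta>" if "i \<le> n" for i using that by (simp add: ts_def nth_append del: upt_Suc)
    have "sorted_wrt (<) ts"
      using \<Delta> by (auto simp: sorted_wrt_iff_nth_less ts_def nth_append simp del: upt_Suc)
    moreover have "\<forall>t\<in>set ts. 0 \<le> t" using \<Delta> by (auto simp: ts_def)
    ultimately have *: "indep_vars (\<lambda>_. borel) (\<lambda>(i, c) \<omega>. (B (ts ! Suc i) \<omega> - B (ts ! i) \<omega>) $ c) ({..<n} \<times> UNIV)
       \<and> (\<forall>i < n. \<forall>c. distributed M lborel (\<lambda>\<omega>. (B (ts ! Suc i) \<omega> - B (ts ! i) \<omega>) $ c)
              (\<lambda>x. ennreal (normal_density 0 (sqrt (ts ! Suc i - ts ! i)) x)))"
      using BM unfolding std_BM_def len[symmetric] by blast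
    have diff: "B (ts ! Suc i) \<omega> - B (ts ! i) \<omega> = D i \<omega>" "ts ! Suc i - ts ! i = \<Delta>" if "i < n" for i \<omega>
      using that by (simp_all add: nth D_def algebra_simps)
    have "indep_vars (\<lambda>_. borel) (\<lambda>(i, c) \<omega>. D i \<omega> $ c) ({..<n} \<times> UNIV)
      = indep_vars (\<lambda>_. borel) (\<lambda>(i, c) \<omega>. (B (ts ! Suc i) \<omega> - B (ts ! i) \<omega>) $ c) ({..<n} \<times> UNIV)"
      by (rule indep_vars_cong) (auto simp: diff(1)[symmetric] fun_eq_iff)
    then show ?thesis using * by (auto simp: diff)
  qed
  note n = this
  show "indep_vars (\<lambda>_. borel) (\<lambda>(i, c) \<omega>. D i \<omega> $ c) ({..<n} \<times> UNIV)" using n by blast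
  show "sym_incr M (D k) \<Delta> (gauss_const CARD('d))"
  proof (rule sym_incr_gaussian[OF \<Delta>])
    have i: "indep_vars (\<lambda>_. borel) (\<lambda>(i, c) \<omega>. D i \<omega> $ c) ({k} \<times> UNIV)"
      by (rule indep_vars_subset[OF n[of "Suc k", THEN conjunct1]]) auto
    show "indep_vars (\<lambda>_. borel) (\<lambda>c \<omega>. D k \<omega> $ c) UNIV"
    proof -
      \<comment> \<open>Singleton blocks reindex the family from pairs (k, c) to components
        c.\<close>
      have "indep_vars (\<lambda>c. PiM {(k, c)} (\<lambda>_. borel)) (\<lambda>c \<omega>. restrict (\<lambda>ic. case ic of (i, c) \<Rightarrow> D i \<omega> $ c) {(k, c)}) UNIV"
        using indep_vars_restrict[OF i, of UNIV "\<lambda>c. {(k, c)}"] 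
        by (simp add: disjoint_family_on_def case_prod_unfold)
      then have "indep_vars (\<lambda>_. borel) (\<lambda>c \<omega>. (\<lambda>x. x (k, c)) (restrict (\<lambda>ic. case ic of (i, c) \<Rightarrow> D i \<omega> $ c) {(k, c)})) UNIV"
        by (rule indep_vars_compose2) simp
      then show ?thesis by simp
    qed
    show "distributed M lborel (\<lambda>\<omega>. D k \<omega> $ c) (\<lambda>x. ennreal (normal_density 0 (sqrt \<Delta>) x))" for c
      using n[of "Suc k"] by blast
  qed
qed

text \<open>Takes the place of conditioning on the past: X is frozen and the bound is required for
  each fixed value of it. Nonnegativity of F permits Tonelli on the product law without prior
  integrability of F along (X, Y).\<close>

lemma (in prob_space) expectation_le_of_indep:
  fixes F :: "'b \<Rightarrow> 'b \<Rightarrow> real"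
  assumes ind: "indep_var S X T Y" and F [measurable]: "case_prod F \<in> borel_measurable (S \<Otimes>\<^sub>M T)"
    and F0: "\<And>x y. 0 \<le> F x y"
    and int: "\<And>\<omega>. \<omega> \<in> space M \<Longrightarrow> integrable M (\<lambda>\<omega>'. F (X \<omega>) (Y \<omega>'))"
    and le: "\<And>\<omega>. \<omega> \<in> space M \<Longrightarrow> (\<integral>\<omega>'. F (X \<omega>) (Y \<omega>') \<partial>M) \<le> R \<omega>"
    and R: "integrable M R"
  shows "(\<integral>\<omega>. F (X \<omega>) (Y \<omega>) \<partial>M) \<le> (\<integral>\<omega>. R \<omega> \<partial>M)"
proof -
  have rv [measurable]: "X \<in> measurable M S" "Y \<in> measurable M T"
    using ind by (auto dest: indep_var_rv1 indep_var_rv2)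
  have R0: "0 \<le> R \<omega>" if "\<omega> \<in> space M" for \<omega>
    using le[OF that] F0 by (intro order_trans[OF _ le[OF that]] integral_nonneg_AE) auto
  interpret Y: prob_space "distr M T Y" by (rule prob_space_distr) simp
  have "(\<integral>\<^sup>+\<omega>. F (X \<omega>) (Y \<omega>) \<partial>M) = (\<integral>\<^sup>+z. case_prod F z \<partial>distr M (S \<Otimes>\<^sub>M T) (\<lambda>\<omega>. (X \<omega>, Y \<omega>)))"
    by (subst nn_integral_distr) auto
  also have "distr M (S \<Otimes>\<^sub>M T) (\<lambda>\<omega>. (X \<omega>, Y \<omega>)) = distr M S X \<Otimes>\<^sub>M distr M T Y"
    using ind unfolding indep_var_distribution_eq by simp
  also have "(\<integral>\<^sup>+z. case_prod F z \<partial>(distr M S X \<Otimes>\<^sub>M distr M T Y)) = (\<integral>\<^sup>+x. \<integral>\<^sup>+y. F x y \<partial>distr M T Y \<partial>distr M S X)"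
    by (subst Y.nn_integral_fst[symmetric]) auto
  also have "\<dots> = (\<integral>\<^sup>+\<omega>. \<integral>\<^sup>+y. F (X \<omega>) y \<partial>distr M T Y \<partial>M)"
    by (subst nn_integral_distr) auto
  also have "\<dots> = (\<integral>\<^sup>+\<omega>. \<integral>\<^sup>+\<omega>'. F (X \<omega>) (Y \<omega>') \<partial>M \<partial>M)"
    by (intro nn_integral_cong, subst nn_integral_distr) auto
  also have "\<dots> \<le> (\<integral>\<^sup>+\<omega>. R \<omega> \<partial>M)"
  proof (rule nn_integral_mono)
    fix \<omega> assume w: "\<omega> \<in> space M"
    have "(\<integral>\<^sup>+\<omega>'. F (X \<omega>) (Y \<omega>') \<partial>M) = ennreal (\<integral>\<omega>'. F (X \<omega>) (Y \<omega>') \<partial>M)"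
      by (rule nn_integral_eq_integral[OF int[OF w]]) (use F0 in auto)
    then show "(\<integral>\<^sup>+\<omega>'. F (X \<omega>) (Y \<omega>') \<partial>M) \<le> ennreal (R \<omega>)" using le[OF w] by (simp add: ennreal_leI)
  qed
  also have "\<dots> = ennreal (\<integral>\<omega>. R \<omega> \<partial>M)"
    using R R0 by (intro nn_integral_eq_integral) auto
  finally show ?thesis
    using R0 by (intro integral_real_bounded) (auto intro!: integral_nonneg_AE)
qed

section \<open>The truncated scheme\<close>

lemma norm_Lam_le: "0 \<le> r \<Longrightarrow> norm (Lam r x) \<le> r"
  by (auto simp: Lam_def norm_sgn min_def)

lemma norm_Lam_le_norm: "0 \<le> r \<Longrightarrow> norm (Lam r x) \<le> norm x"
  by (auto simp: Lam_def norm_sgn min_def)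

lemma borel_measurable_Lam [measurable (raw)]:
  fixes F :: "'a \<Rightarrow> 'b::euclidean_space"
  assumes [measurable]: "F \<in> borel_measurable M"
  shows "(\<lambda>x. Lam r (F x)) \<in> borel_measurable M"
  unfolding Lam_def sgn_div_norm by measurable

lemma norm_tem_hist_le: "0 \<le> r \<Longrightarrow> norm (tem_hist \<Delta> N r f g \<xi> b m j) \<le> r"
  by (induction m arbitrary: j) (auto simp: norm_Lam_le Let_def)

text \<open>Each step writes only the next index, so entries up to N + m are final after m steps.
  Later entries still hold placeholders from the initial clause.\<close>

lemma tem_hist_stable: "j \<le> N + m \<Longrightarrow> tem_hist \<Delta> N r f g \<xi> b (m + k) j = tem_hist \<Delta> N r f g \<xi> b m j"
  by (induction k) (auto simp: Let_def)

lemma borel_measurable_matrix_vector_mult: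
  fixes A :: "'a \<Rightarrow> real^'d^'n"
  assumes "A \<in> borel_measurable M" "v \<in> borel_measurable M"
  shows "(\<lambda>x. A x *v v x) \<in> borel_measurable M"
proof (rule borel_measurable_vec_componentwise)
  fix i
  have "(\<lambda>x. \<Sum>j\<in>UNIV. A x $ i $ j * v x $ j) \<in> borel_measurable M"
    using assms by (intro borel_measurable_sum borel_measurable_times borel_measurable_vec_nth)
  then show "(\<lambda>x. (A x *v v x) $ i) \<in> borel_measurable M"
    by (simp add: matrix_vector_mult_def)
qed

lemma norm_seg_diff_le:
  assumes D: "0 < \<Delta>" and N: "1 \<le> N" and t: "\<theta> \<in> {- (real N * \<Delta>)..0}"
  shows "norm (seg \<Delta> h (N + m) \<theta> - seg \<Delta> h' (N + m) \<theta>) \<le> (\<Sum>i\<le>N. norm (h (m + i) - h' (m + i)))"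
proof -
  have "norm (seg \<Delta> h (N + m) \<theta> - seg \<Delta> h' (N + m) \<theta>) = norm (\<Sum>i\<le>N. hat \<Delta> N i \<theta> *\<^sub>R (h (m + i) - h' (m + i)))"
    unfolding seg_eq_sum_hat[OF D N t] by (simp add: scaleR_diff_right sum_subtractf)
  also have "\<dots> \<le> (\<Sum>i\<le>N. norm (hat \<Delta> N i \<theta> *\<^sub>R (h (m + i) - h' (m + i))))" by (rule norm_sum)
  also have "\<dots> \<le> (\<Sum>i\<le>N. norm (h (m + i) - h' (m + i)))"
    by (intro sum_mono) (auto simp: hat_def intro!: mult_left_le_one_le)
  finally show ?thesis .
qed

definition locally_Lipschitz_C ::
    "real \<Rightarrow> ((real \<Rightarrow> 'a::real_normed_vector) \<Rightarrow> 'b::real_normed_vector) \<Rightarrow> bool" where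
  "locally_Lipschitz_C \<tau> F \<longleftrightarrow> (\<forall>ell>0. \<exists>R>0. \<forall>\<phi> \<psi>.
     in_C \<tau> \<phi> \<and> in_C \<tau> \<psi> \<and> supn \<tau> \<phi> \<le> ell \<and> supn \<tau> \<psi> \<le> ell \<longrightarrow>
     norm (F \<phi> - F \<psi>) \<le> R * (norm (\<phi> 0 - \<psi> 0) + (1/\<tau>) * integral {-\<tau>..0} (\<lambda>\<theta>. norm (\<phi> \<theta> - \<psi> \<theta>))))"

text \<open>The coefficients are functionals of arbitrary functions, so the measurability of the
  scheme has to be derived. In the product topology on histories only N + 1 coordinates matter, and
  the local Lipschitz bound gives continuity, hence Borel measurability.\<close>

lemma continuous_comp_seg:
  fixes F :: "(real \<Rightarrow> 'a::euclidean_space) \<Rightarrow> 'b::real_normed_vector"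
  assumes D: "0 < \<Delta>" and N: "1 \<le> N" and tau: "\<tau> = real N * \<Delta>"
    and Lip: "locally_Lipschitz_C \<tau> F"
  shows "continuous_on UNIV (\<lambda>h. F (seg \<Delta> h (N + m)))"
  unfolding continuous_on_def
proof (intro ballI)
  fix h0 :: "nat \<Rightarrow> 'a"
  have \<tau>: "0 < \<tau>" using D N tau by simp
  define S where "S = (\<lambda>h. \<Sum>i\<le>N. norm (h (m + i) - h0 (m + i)))"
  \<comment> \<open>The margin 1 keeps every history with S h < 1 inside the ball on which the
    Lipschitz constant R is valid.\<close>
  define ell where "ell = 1 + (\<Sum>i\<le>N. norm (h0 (m + i)))"
  have ell: "ell > 0" unfolding ell_def by (intro add_pos_nonneg sum_nonneg) auto
  obtain R where R: "R > 0" "\<And>\<phi> \<psi>. in_C \<tau> \<phi> \<Longrightarrow> in_C \<tau> \<psi> \<Longrightarrow> supn \<tau> \<phi> \<le> ell \<Longrightarrow> supn \<tau> \<psi> \<le> ell \<Longrightarrow>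
             norm (F \<phi> - F \<psi>) \<le> R * (norm (\<phi> 0 - \<psi> 0) + (1/\<tau>) * integral {-\<tau>..0} (\<lambda>\<theta>. norm (\<phi> \<theta> - \<psi> \<theta>)))"
    using Lip[unfolded locally_Lipschitz_C_def, rule_format, OF ell] by blast
  have cS: "continuous_on UNIV S"
    unfolding S_def by (intro continuous_intros continuous_on_product_coordinates)
  then have "(S \<longlongrightarrow> S h0) (at h0)" by (simp add: continuous_on_def)
  then have S0: "(S \<longlongrightarrow> 0) (at h0)" by (simp add: S_def)
  have inC: "in_C \<tau> (seg \<Delta> h (N + m))" for h :: "nat \<Rightarrow> 'a"
    unfolding in_C_def tau by (rule continuous_on_seg[OF D N])
  have le: "norm (F (seg \<Delta> h (N + m)) - F (seg \<Delta> h0 (N + m))) \<le> R * (2 * S h)" if S1: "S h < 1" for h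
  proof -
    have diff: "norm (seg \<Delta> h (N + m) \<theta> - seg \<Delta> h0 (N + m) \<theta>) \<le> S h" if "\<theta> \<in> {-\<tau>..0}" for \<theta>
      unfolding S_def using norm_seg_diff_le[OF D N] that by (simp add: tau)
    have h0: "norm (h0 (m + i)) \<le> ell - 1" if "i \<le> N" for i
      unfolding ell_def using that by (auto intro!: member_le_sum[of i "{..N}" "\<lambda>i. norm (h0 (m + i))"])
    have s0: "norm (seg \<Delta> h0 (N + m) \<theta>) \<le> ell - 1" if "\<theta> \<in> {-\<tau>..0}" for \<theta>
      using that h0 by (intro norm_seg_le[OF D N]) (auto simp: tau)
    have s1: "norm (seg \<Delta> h (N + m) \<theta>) \<le> ell" if "\<theta> \<in> {-\<tau>..0}" for \<theta>
      using s0[OF that] diff[OF that] S1 norm_triangle_sub[of "seg \<Delta> h (N + m) \<theta>" "seg \<Delta> h0 (N + m) \<theta>"] by linarith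
    have n0: "norm (seg \<Delta> h0 (N + m) \<theta>) \<le> ell" if "\<theta> \<in> {-\<tau>..0}" for \<theta>
      using s0[OF that] by linarith
    have c: "continuous_on {-\<tau>..0} (\<lambda>\<theta>. norm (seg \<Delta> h (N + m) \<theta> - seg \<Delta> h0 (N + m) \<theta>))"
      using inC by (intro continuous_intros) (auto simp: in_C_def)
    have "integral {-\<tau>..0} (\<lambda>\<theta>. norm (seg \<Delta> h (N + m) \<theta> - seg \<Delta> h0 (N + m) \<theta>)) \<le> integral {-\<tau>..0} (\<lambda>\<theta>. S h)"
      by (intro integral_le integrable_continuous_interval c continuous_on_const diff)
    also have "\<dots> = \<tau> * S h" using \<tau> by simp
    finally have i: "(1/\<tau>) * integral {-\<tau>..0} (\<lambda>\<theta>. norm (seg \<Delta> h (N + m) \<theta> - seg \<Delta> h0 (N + m) \<theta>)) \<le> S h"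
      using \<tau> by (simp add: field_simps)
    have "norm (F (seg \<Delta> h (N + m)) - F (seg \<Delta> h0 (N + m)))
      \<le> R * (norm (seg \<Delta> h (N + m) 0 - seg \<Delta> h0 (N + m) 0)
        + (1/\<tau>) * integral {-\<tau>..0} (\<lambda>\<theta>. norm (seg \<Delta> h (N + m) \<theta> - seg \<Delta> h0 (N + m) \<theta>)))"
      by (intro R(2) inC supn_le s1 n0) (use \<tau> in auto)
    also have "\<dots> \<le> R * (S h + S h)"
      using R(1) \<tau> by (intro mult_left_mono add_mono i diff) auto
    finally show ?thesis by simp
  qed
  have "((\<lambda>h. F (seg \<Delta> h (N + m)) - F (seg \<Delta> h0 (N + m))) \<longlongrightarrow> 0) (at h0)"
  proof (rule Lim_null_comparison)
    have "\<forall>\<^sub>F h in at h0. S h < 1" using S0 by (rule order_tendstoD) simp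
    then show "\<forall>\<^sub>F h in at h0. norm (F (seg \<Delta> h (N + m)) - F (seg \<Delta> h0 (N + m))) \<le> R * (2 * S h)"
      by (rule eventually_mono) (rule le)
    show "((\<lambda>h. R * (2 * S h)) \<longlongrightarrow> 0) (at h0)" using S0 by (auto intro!: tendsto_eq_intros)
  qed
  then show "((\<lambda>h. F (seg \<Delta> h (N + m))) \<longlongrightarrow> F (seg \<Delta> h0 (N + m))) (at h0)"
    by (rule LIM_zero_cancel)
qed

text \<open>Hence the history up to step m is independent of the next increment.\<close>

lemma tem_hist_measurable:
  fixes f :: "(real \<Rightarrow> real^'n) \<Rightarrow> real^'n" and g :: "(real \<Rightarrow> real^'n) \<Rightarrow> real^'d^'n"
    and B :: "real \<Rightarrow> 'w \<Rightarrow> real^'d"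
  assumes f: "\<And>m. continuous_on UNIV (\<lambda>h. f (seg \<Delta> h (N + m)))"
    and g: "\<And>m. continuous_on UNIV (\<lambda>h. g (seg \<Delta> h (N + m)))"
  shows "\<exists>\<Phi>. \<Phi> \<in> measurable (\<Pi>\<^sub>M i\<in>{..<m} \<times> UNIV. borel) borel \<and>
    (\<forall>\<omega>. tem_hist \<Delta> N r f g \<xi> (\<lambda>t. B t \<omega>) m
       = \<Phi> (\<lambda>ic\<in>{..<m} \<times> UNIV. case ic of (i, c) \<Rightarrow> (B (real (Suc i) * \<Delta>) \<omega> - B (real i * \<Delta>) \<omega>) $ c))"
proof (induction m)
  case 0
  show ?case by (rule exI[of _ "\<lambda>_. tem_hist \<Delta> N r f g \<xi> undefined 0"]) simp
next
  case (Suc m)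
  define X where "X = (\<lambda>\<omega> ic. case ic of (i, c) \<Rightarrow> (B (real (Suc i) * \<Delta>) \<omega> - B (real i * \<Delta>) \<omega>) $ c)"
  let ?H = "\<lambda>\<omega> m. tem_hist \<Delta> N r f g \<xi> (\<lambda>t. B t \<omega>) m"
  obtain \<Phi> where \<Phi> [measurable]: "\<Phi> \<in> measurable (\<Pi>\<^sub>M i\<in>{..<m} \<times> UNIV. borel) borel"
    and eq: "\<And>\<omega>. ?H \<omega> m = \<Phi> (restrict (X \<omega>) ({..<m} \<times> UNIV))"
    using Suc.IH unfolding X_def by blast
  define P where "P = (\<Pi>\<^sub>M i\<in>{..<Suc m} \<times> (UNIV :: 'd set). (borel :: real measure))"
  \<comment> \<open>\<open>past\<close> reads only the increments of index below m and
    \<open>new\<close> only the increment m, both from one restricted family.\<close>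
  define past where "past = (\<lambda>x. \<Phi> (restrict x ({..<m} \<times> UNIV)))"
  define new where "new = (\<lambda>x :: nat \<times> 'd \<Rightarrow> real. (\<chi> c. x (m, c)))"
  have r: "(\<lambda>x. restrict x ({..<m} \<times> UNIV)) \<in> measurable P (\<Pi>\<^sub>M i\<in>{..<m} \<times> UNIV. borel)"
    unfolding P_def by (rule measurable_restrict_subset) auto
  have past: "past \<in> borel_measurable P"
    unfolding past_def by (rule measurable_compose[OF r \<Phi>])
  have new: "new \<in> borel_measurable P"
    unfolding new_def P_def by (rule borel_measurable_vec_componentwise) (simp add: measurable_component_singleton)
  have pj: "(\<lambda>x. past x j) \<in> borel_measurable P" for j
    using measurable_compose[OF past measurable_product_coordinates] .
  have fp: "(\<lambda>x. f (seg \<Delta> (past x) (N + m))) \<in> borel_measurable P"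
    by (rule borel_measurable_continuous_on[OF f past])
  have gp: "(\<lambda>x. g (seg \<Delta> (past x) (N + m))) \<in> borel_measurable P"
    by (rule borel_measurable_continuous_on[OF g past])
  define val where "val = (\<lambda>x. past x (N + m) + \<Delta> *\<^sub>R f (seg \<Delta> (past x) (N + m)) + g (seg \<Delta> (past x) (N + m)) *v new x)"
  have val: "val \<in> borel_measurable P"
    unfolding val_def
    by (intro borel_measurable_add borel_measurable_scaleR borel_measurable_const pj fp
         borel_measurable_matrix_vector_mult gp new)
  have "(\<lambda>x. (past x)(N + Suc m := Lam r (val x))) \<in> borel_measurable P"
  proof (rule measurable_coordinatewise_then_product)
    fix j
    have "(\<lambda>x. Lam r (val x)) \<in> borel_measurable P" using val by (rule borel_measurable_Lam)
    then show "(\<lambda>x. ((past x)(N + Suc m := Lam r (val x))) j) \<in> borel_measurable P"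
      using pj by (cases "j = N + Suc m") auto
  qed
  moreover have "?H \<omega> (Suc m) = (past x)(N + Suc m := Lam r (val x))"
    if x: "x = restrict (X \<omega>) ({..<Suc m} \<times> UNIV)" for \<omega> x
  proof -
    have "restrict x ({..<m} \<times> UNIV) = restrict (X \<omega>) ({..<m} \<times> UNIV)"
      unfolding x by (auto simp: restrict_def fun_eq_iff)
    then have p: "past x = ?H \<omega> m" by (simp add: past_def eq)
    have n: "new x = B (real (Suc m) * \<Delta>) \<omega> - B (real m * \<Delta>) \<omega>"
      unfolding new_def x by (simp add: X_def vec_eq_iff)
    show ?thesis by (simp add: p n val_def Let_def)
  qed
  ultimately show ?case
    unfolding P_def X_def by blast
qed

section \<open>Dissipative coefficients\<close>

lemma powr_Young:
  fixes x y s u :: real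
  assumes "0 < u" "0 < s" "0 \<le> x" "0 \<le> y"
  shows "y powr u * x powr s \<le> u / (u + s) * y powr (u + s) + s / (u + s) * x powr (u + s)"
proof (cases "x = 0 \<or> y = 0")
  case False
  have "(y powr (u + s)) powr (u / (u + s)) * (x powr (u + s)) powr (s / (u + s))
     \<le> u / (u + s) * y powr (u + s) + s / (u + s) * x powr (u + s)"
    using assms False by (intro Youngs_inequality_0) (auto simp flip: add_divide_distrib)
  then show ?thesis using assms by (simp add: powr_powr)
qed (use assms in auto)

text \<open>Decouples a power of the current value from delayed sums. It is applied with u = p - 2
  and s = 2 or s = 2 + \<open>vrho\<close>, so that only pure moments of order p and p +
  \<open>vrho\<close> remain.\<close>

lemma weighted_powr_Young:
  fixes x \<alpha> :: "nat \<Rightarrow> real" and y s u :: real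
  assumes a: "\<And>i. 0 \<le> \<alpha> i" "(\<Sum>i\<le>N. \<alpha> i) = 1" and us: "0 < u" "0 < s" and y: "0 \<le> y" and x: "\<And>i. 0 \<le> x i"
  shows "y powr u * (\<Sum>i\<le>N. \<alpha> i * x i powr s)
    \<le> u / (u + s) * y powr (u + s) + s / (u + s) * (\<Sum>i\<le>N. \<alpha> i * x i powr (u + s))"
proof -
  have "y powr u * (\<Sum>i\<le>N. \<alpha> i * x i powr s) = (\<Sum>i\<le>N. \<alpha> i * (y powr u * x i powr s))"
    by (simp add: sum_distrib_left mult_ac)
  also have "\<dots> \<le> (\<Sum>i\<le>N. \<alpha> i * (u / (u + s) * y powr (u + s) + s / (u + s) * x i powr (u + s)))"
    using us x y by (intro sum_mono mult_left_mono a powr_Young)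
  also have "\<dots> = (\<Sum>i\<le>N. \<alpha> i) * (u / (u + s) * y powr (u + s)) + s / (u + s) * (\<Sum>i\<le>N. \<alpha> i * x i powr (u + s))"
    by (simp add: distrib_left sum.distrib sum_distrib_left sum_distrib_right sum_divide_distrib mult_ac)
  finally show ?thesis using a by simp
qed

lemma weighted_powr_Jensen:
  fixes x \<alpha> :: "nat \<Rightarrow> real"
  assumes a: "\<And>i. 0 \<le> \<alpha> i" "(\<Sum>i\<le>N. \<alpha> i) = 1" and s: "1 \<le> s" and x: "\<And>i. 0 \<le> x i"
  shows "(\<Sum>i\<le>N. \<alpha> i * x i) powr s \<le> (\<Sum>i\<le>N. \<alpha> i * x i powr s)"
  using convex_on_sum[OF _ _ convex_on_powr_nonneg[OF s] a(2), of x] a x by simp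

locale dissipative_sfde =
  fixes \<tau> :: real
    and f :: "(real \<Rightarrow> real^'n) \<Rightarrow> real^'n"
    and g :: "(real \<Rightarrow> real^'n) \<Rightarrow> real^'d^'n"
    and p vrho b1 b2 b3 b4 :: real and \<rho>3 \<rho>4 :: "real \<Rightarrow> real"
    and \<Gamma> :: "real \<Rightarrow> real"
  assumes tau: "\<tau> > 0"
    and f0: "f (\<lambda>_. 0) = 0"
    and Lip: "locally_Lipschitz_C \<tau> f" "locally_Lipschitz_C \<tau> g"
    and p: "p \<ge> 2" and rho: "vrho > 0"
    and b: "b1 > 0" "b2 > 0" "b3 > 0" "b4 > 0" "b1 > b2" "b3 > b4"
    and w: "density_on \<tau> \<rho>3" "density_on \<tau> \<rho>4"
    and A2: "\<forall>\<phi>. in_C \<tau> \<phi> \<longrightarrow>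
             2 * (\<phi> 0 \<bullet> f \<phi>) + (p - 1) * (norm (g \<phi>))^2
               \<le> - b1 * (norm (\<phi> 0))^2 + b2 * integral {-\<tau>..0} (\<lambda>\<theta>. (norm (\<phi> \<theta>))^2 * \<rho>3 \<theta>)
                 - b3 * norm (\<phi> 0) powr (2 + vrho)
                 + b4 * integral {-\<tau>..0} (\<lambda>\<theta>. norm (\<phi> \<theta>) powr (2 + vrho) * \<rho>4 \<theta>)"
    and \<Gamma>0: "\<forall>l\<ge>1. \<Gamma> l \<ge> 0"
    and \<Gamma>f: "\<forall>l\<ge>1. \<forall>\<phi> \<psi>. in_C \<tau> \<phi> \<and> in_C \<tau> \<psi> \<and> supn \<tau> \<phi> \<le> l \<and> supn \<tau> \<psi> \<le> l
              \<and> (\<exists>\<theta>\<in>{-\<tau>..0}. \<phi> \<theta> \<noteq> \<psi> \<theta>) \<longrightarrow>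
             norm (f \<phi> - f \<psi>) / sqrt (Psi \<tau> \<phi> \<psi>) \<le> \<Gamma> l"
begin

lemma supn_zero_le: "0 \<le> l \<Longrightarrow> supn \<tau> (\<lambda>_. 0 :: real^'n) \<le> l"
  using tau by (intro supn_le) auto

lemma in_C_zero: "in_C \<tau> (\<lambda>_. 0 :: real^'n)"
  by (simp add: in_C_def)

lemma norm_f_le:
  assumes l: "1 \<le> l" and C: "in_C \<tau> \<phi>" and s: "supn \<tau> \<phi> \<le> l"
  shows "norm (f \<phi>) \<le> \<Gamma> l * sqrt (Psi \<tau> \<phi> (\<lambda>_. 0))"
proof (cases "\<exists>\<theta>\<in>{-\<tau>..0}. \<phi> \<theta> \<noteq> 0")
  case True
  then obtain \<theta> where th: "\<theta> \<in> {-\<tau>..0}" "\<phi> \<theta> \<noteq> 0" by blast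
  have "0 < Psi \<tau> \<phi> (\<lambda>_. 0)" by (rule Psi_pos[OF tau C in_C_zero th])
  moreover have "norm (f \<phi> - f (\<lambda>_. 0)) / sqrt (Psi \<tau> \<phi> (\<lambda>_. 0)) \<le> \<Gamma> l"
    using \<Gamma>f l C s in_C_zero supn_zero_le[of l] True by auto
  ultimately show ?thesis by (simp add: f0 field_simps)
next
  case False
  \<comment> \<open>\<phi> vanishes on [-\<tau>,0] but may differ from the zero function outside, so
    f(0) = 0 does not apply directly. The Lipschitz bound sees only [-\<tau>,0] and yields f \<phi>
    = 0.\<close>
  obtain R where R: "\<And>\<phi> \<psi>. in_C \<tau> \<phi> \<and> in_C \<tau> \<psi> \<and> supn \<tau> \<phi> \<le> l \<and> supn \<tau> \<psi> \<le> l \<longrightarrow>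
     norm (f \<phi> - f \<psi>) \<le> R * (norm (\<phi> 0 - \<psi> 0) + (1/\<tau>) * integral {-\<tau>..0} (\<lambda>\<theta>. norm (\<phi> \<theta> - \<psi> \<theta>)))"
    using Lip(1)[unfolded locally_Lipschitz_C_def, rule_format, of l] l by auto
  have "integral {-\<tau>..0} (\<lambda>\<theta>. norm (\<phi> \<theta> - 0)) = integral {-\<tau>..0} (\<lambda>\<theta>. 0 :: real)"
    using False by (intro integral_cong) auto
  moreover have "norm (\<phi> 0 - 0) = 0" using False tau by auto
  ultimately have "norm (f \<phi>) \<le> 0"
    using R[of \<phi> "\<lambda>_. 0"] C s in_C_zero supn_zero_le[of l] l by (simp add: f0)
  moreover have "0 \<le> Psi \<tau> \<phi> (\<lambda>_. 0)" using C tau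
    unfolding Psi_def by (intro add_nonneg_nonneg mult_nonneg_nonneg integral_nonneg integrable_continuous_interval continuous_intros) (auto simp: in_C_def)
  ultimately show ?thesis using \<Gamma>0 l by (smt (verit) mult_nonneg_nonneg real_sqrt_ge_zero)
qed

text \<open>Testing the dissipativity condition on constant functions shows that the growth function
  dominates the superlinear power, so the truncation radius cannot be too large.\<close>

lemma Gamma_lower:
  assumes l: "1 \<le> l"
  shows "(b3 - b4) * l powr vrho \<le> 2 * sqrt 2 * \<Gamma> l"
proof -
  obtain c :: "real^'n" where c: "norm c = l" using l vector_choose_size[of l] by auto
  have C: "in_C \<tau> (\<lambda>_. c)" by (simp add: in_C_def)
  have s: "supn \<tau> (\<lambda>_. c) \<le> l" using tau c by (intro supn_le) auto
  \<comment> \<open>The point value and the mean each contribute l^2, whence the factor sqrt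
    2.\<close>
  have Psi: "Psi \<tau> (\<lambda>_. c) (\<lambda>_. 0) = 2 * l^2" using tau c by (simp add: Psi_def)
  have fc: "norm (f (\<lambda>_. c)) \<le> \<Gamma> l * (sqrt 2 * l)"
    using norm_f_le[OF l C s] l by (simp add: Psi real_sqrt_mult)
  have i3: "integral {-\<tau>..0} (\<lambda>\<theta>. l^2 * \<rho>3 \<theta>) = l^2"
    using w(1) by (simp add: density_on_def)
  have i4: "integral {-\<tau>..0} (\<lambda>\<theta>. l powr (2 + vrho) * \<rho>4 \<theta>) = l powr (2 + vrho)"
    using w(2) by (simp add: density_on_def)
  have "2 * (c \<bullet> f (\<lambda>_. c)) + (p - 1) * (norm (g (\<lambda>_. c)))^2
     \<le> - b1 * l^2 + b2 * l^2 - b3 * l powr (2 + vrho) + b4 * l powr (2 + vrho)"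
    using A2[rule_format, OF C] unfolding c i3 i4 .
  \<comment> \<open>The quadratic terms and the diffusion have the favourable sign; what remains
    plays b3 - b4 against the drift alone.\<close>
  moreover have "b2 * l^2 \<le> b1 * l^2" using b by (intro mult_right_mono) auto
  moreover have "0 \<le> (p - 1) * (norm (g (\<lambda>_. c)))^2" using p by simp
  ultimately have "(b3 - b4) * l powr (2 + vrho) \<le> - 2 * (c \<bullet> f (\<lambda>_. c))"
    by (simp add: left_diff_distrib)
  also have "\<dots> \<le> 2 * (l * norm (f (\<lambda>_. c)))"
    using Cauchy_Schwarz_ineq2[of c "f (\<lambda>_. c)"] c by (auto simp: abs_le_iff)
  also have "\<dots> \<le> 2 * (l * (\<Gamma> l * (sqrt 2 * l)))" using fc l by (intro mult_left_mono) auto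
  finally have "l^2 * ((b3 - b4) * l powr vrho) \<le> l^2 * (2 * sqrt 2 * \<Gamma> l)"
    using l by (simp add: powr_add power2_eq_square mult_ac)
  then show ?thesis using l by (simp add: mult_le_cancel_left)
qed

lemma continuous_fg_seg:
  assumes "0 < \<Delta>" "1 \<le> N" "\<tau> = real N * \<Delta>"
  shows "continuous_on UNIV (\<lambda>h. f (seg \<Delta> h (N + m)))" "continuous_on UNIV (\<lambda>h. g (seg \<Delta> h (N + m)))"
  by (rule continuous_comp_seg[OF assms Lip(1)], rule continuous_comp_seg[OF assms Lip(2)])

context
  fixes \<Delta> :: real and N :: nat
  assumes \<Delta>: "0 < \<Delta>" and N: "1 \<le> N" and grid: "\<tau> = real N * \<Delta>"
begin

text \<open>The third family belongs to the uniform density 1/\<tau>, which represents the mean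
  value in \<open>Psi\<close>.\<close>

abbreviation "wa \<equiv> hatw \<Delta> N \<rho>3"
abbreviation "wb \<equiv> hatw \<Delta> N \<rho>4"
abbreviation "wc \<equiv> hatw \<Delta> N (\<lambda>_. 1 / (real N * \<Delta>))"

lemma densities: "density_on (real N * \<Delta>) \<rho>3" "density_on (real N * \<Delta>) \<rho>4"
  "density_on (real N * \<Delta>) (\<lambda>_. 1 / (real N * \<Delta>))"
  using w density_on_uniform[OF tau] by (simp_all add: grid)

lemma w_nonneg: "0 \<le> wa i" "0 \<le> wb i" "0 \<le> wc i"
  by (intro hatw_nonneg densities \<Delta>)+

lemma w_sum: "(\<Sum>i\<le>N. wa i) = 1" "(\<Sum>i\<le>N. wb i) = 1" "(\<Sum>i\<le>N. wc i) = 1"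
  by (intro sum_hatw densities \<Delta> N)+

lemma in_C_seg: "in_C \<tau> (seg \<Delta> h (N + m))"
  unfolding in_C_def grid by (rule continuous_on_seg[OF \<Delta> N])

text \<open>The interpolation is exact at \<theta> = 0, so the negative terms pass to the grid
  unchanged. The integrals carry the positive coefficients b2 and b4, so Jensen acts in the right
  direction.\<close>

lemma dissipative_seg:
  fixes h :: "nat \<Rightarrow> real^'n"
  shows "2 * (h (N + m) \<bullet> f (seg \<Delta> h (N + m))) + (p - 1) * (norm (g (seg \<Delta> h (N + m))))^2
    \<le> - b1 * (norm (h (N + m)))^2 + b2 * (\<Sum>i\<le>N. wa i * norm (h (m + i)) powr 2)
      - b3 * norm (h (N + m)) powr (2 + vrho) + b4 * (\<Sum>i\<le>N. wb i * norm (h (m + i)) powr (2 + vrho))"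
proof -
  have "b2 * integral {-\<tau>..0} (\<lambda>\<theta>. norm (seg \<Delta> h (N + m) \<theta>) powr 2 * \<rho>3 \<theta>) \<le> b2 * (\<Sum>i\<le>N. wa i * norm (h (m + i)) powr 2)"
    using integral_seg_powr_le[OF densities(1) \<Delta> N, of 2 h m] b by (intro mult_left_mono) (auto simp: grid)
  moreover have "b4 * integral {-\<tau>..0} (\<lambda>\<theta>. norm (seg \<Delta> h (N + m) \<theta>) powr (2 + vrho) * \<rho>4 \<theta>) \<le> b4 * (\<Sum>i\<le>N. wb i * norm (h (m + i)) powr (2 + vrho))"
    using integral_seg_powr_le[OF densities(2) \<Delta> N, of "2 + vrho" h m] b rho by (intro mult_left_mono) (auto simp: grid)
  ultimately show ?thesis using A2[rule_format, OF in_C_seg[of h m]]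
    by (simp add: seg_at_0[OF \<Delta>])
qed

lemma Psi_seg_le:
  fixes h :: "nat \<Rightarrow> real^'n"
  shows "Psi \<tau> (seg \<Delta> h (N + m)) (\<lambda>_. 0) \<le> (norm (h (N + m)))^2 + (\<Sum>i\<le>N. wc i * norm (h (m + i)) powr 2)"
proof -
  have "integral {-\<tau>..0} (\<lambda>\<theta>. norm (seg \<Delta> h (N + m) \<theta>) powr 2 * (1 / \<tau>)) \<le> (\<Sum>i\<le>N. wc i * norm (h (m + i)) powr 2)"
    using integral_seg_powr_le[OF densities(3) \<Delta> N, of 2 h m] by (simp add: grid)
  then show ?thesis
    by (simp add: Psi_def seg_at_0[OF \<Delta>])
qed

lemma norm_f_seg_le:
  fixes h :: "nat \<Rightarrow> real^'n"
  assumes r: "1 \<le> r" "\<And>i. i \<le> N \<Longrightarrow> norm (h (m + i)) \<le> r"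
  shows "norm (f (seg \<Delta> h (N + m))) \<le> \<Gamma> r * sqrt ((norm (h (N + m)))^2 + (\<Sum>i\<le>N. wc i * norm (h (m + i)) powr 2))"
proof -
  have "supn \<tau> (seg \<Delta> h (N + m)) \<le> r"
    using tau r(2) by (intro supn_le norm_seg_le[OF \<Delta> N]) (auto simp: grid)
  then have "norm (f (seg \<Delta> h (N + m))) \<le> \<Gamma> r * sqrt (Psi \<tau> (seg \<Delta> h (N + m)) (\<lambda>_. 0))"
    by (intro norm_f_le r in_C_seg)
  also have "\<dots> \<le> \<Gamma> r * sqrt ((norm (h (N + m)))^2 + (\<Sum>i\<le>N. wc i * norm (h (m + i)) powr 2))"
    using \<Gamma>0 r(1) by (intro mult_left_mono real_sqrt_le_mono Psi_seg_le) auto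
  finally show ?thesis .
qed

end

end

section \<open>The one-step moment inequality\<close>

lemma powr_eventually_small:
  fixes s \<epsilon> C :: real
  assumes "0 < s" "0 < \<epsilon>" "0 \<le> C"
  obtains \<delta> where "0 < \<delta>" "\<delta> \<le> 1" "\<And>x. 0 < x \<Longrightarrow> x \<le> \<delta> \<Longrightarrow> C * x powr s \<le> \<epsilon>"
proof -
  define e where "e = \<epsilon> / (C + 1)"
  have e: "0 < e" using assms by (simp add: e_def)
  show ?thesis
  proof (rule that[of "min 1 (e powr (1 / s))"])
    fix x :: real assume x: "0 < x" "x \<le> min 1 (e powr (1 / s))"
    have "x powr s \<le> (e powr (1 / s)) powr s" using x assms by (intro powr_mono2) auto
    also have "\<dots> = e" using e assms by (simp add: powr_powr)
    finally have "C * x powr s \<le> C * e" using assms by (intro mult_left_mono)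
    also have "\<dots> \<le> \<epsilon>" using assms by (simp add: e_def field_simps)
    finally show "C * x powr s \<le> \<epsilon>" .
  qed (use e in auto)
qed

text \<open>The exact substitute for the expansion at p = 2: averaging over both signs is the
  parallelogram identity.\<close>

lemma sym_incr_second_moment:
  fixes A :: "real^'d^'n"
  assumes inc: "sym_incr M W \<Delta> m"
  shows "(\<integral>\<omega>. norm (z + A *v W \<omega>) powr 2 \<partial>M) = (norm z)^2 + (norm A)^2 * \<Delta>"
proof -
  interpret prob_space M using inc by (rule sym_incr_prob)
  have ip: "integrable M (\<lambda>\<omega>. norm (z + A *v W \<omega>) powr 2)"
    by (intro sym_incr_integrable_powr[OF inc]) auto
  have im: "integrable M (\<lambda>\<omega>. norm (z - A *v W \<omega>) powr 2)"
  proof -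
    have "(- A) *v W \<omega> = - (A *v W \<omega>)" for \<omega>
      by (simp add: matrix_vector_mult_def sum_negf vec_eq_iff)
    then show ?thesis using sym_incr_integrable_powr[OF inc, of 2 z "- A"] by simp
  qed
  have i2: "integrable M (\<lambda>\<omega>. (norm (A *v W \<omega>))^2)" using sym_incr_moment(1)[OF inc, of A 1] by simp
  have par: "norm (z + v) powr 2 + norm (z - v) powr 2 = 2 * ((norm z)^2 + (norm v)^2)" for v
    by (simp add: power2_norm_eq_inner inner_add_left inner_add_right inner_diff_left inner_diff_right inner_commute)
  have "2 * (\<integral>\<omega>. norm (z + A *v W \<omega>) powr 2 \<partial>M)
     = (\<integral>\<omega>. norm (z + A *v W \<omega>) powr 2 + norm (z - A *v W \<omega>) powr 2 \<partial>M)"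
    using ip im sym_incr_symmetric[OF inc, of z A 2] by simp
  also have "\<dots> = 2 * ((norm z)^2 + (norm A)^2 * \<Delta>)"
    unfolding par using i2 sym_incr_variance[OF inc, of A] by (simp add: prob_space)
  finally show ?thesis by simp
qed

context dissipative_sfde
begin

text \<open>The dissipativity bound multiplied by (p/2)|y|^(p-2), with the mixed products split by
  Young's inequality, which supplies the fractions. The \<epsilon> terms collect all errors, at most
  \<epsilon> for each of the five moments.\<close>

definition step_bound :: "real \<Rightarrow> real \<Rightarrow> nat \<Rightarrow> (nat \<Rightarrow> real^'n) \<Rightarrow> nat \<Rightarrow> real" where
  "step_bound \<epsilon> \<Delta> N h m = (let P = (\<lambda>i. norm (h (m + i)) powr p); Q = (\<lambda>i. norm (h (m + i)) powr (p + vrho));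
      Pa = (\<Sum>i\<le>N. hatw \<Delta> N \<rho>3 i * P i); Pc = (\<Sum>i\<le>N. hatw \<Delta> N (\<lambda>_. 1 / (real N * \<Delta>)) i * P i);
      Qb = (\<Sum>i\<le>N. hatw \<Delta> N \<rho>4 i * Q i)
    in P N + \<Delta> * (p / 2 * (- b1 * P N + b2 * ((p - 2) / p * P N + 2 / p * Pa)
         - b3 * Q N + b4 * ((p - 2) / (p + vrho) * Q N + (2 + vrho) / (p + vrho) * Qb))
       + \<epsilon> * (P N + Pa + Pc + Q N + Qb)))"

text \<open>The history is frozen and only the increment W is random. A single \<delta> serves all
  grids, radii and histories, as the final step size bound demands.\<close>

definition step_valid :: "real \<Rightarrow> real \<Rightarrow> real \<Rightarrow> (nat \<Rightarrow> real) \<Rightarrow> real \<Rightarrow> 'w measure \<Rightarrow> ('w \<Rightarrow> real^'d) \<Rightarrow> bool" where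
  "step_valid \<epsilon> K lam mc \<delta> M W \<longleftrightarrow> (\<forall>N \<Delta> r m h.
    0 < \<Delta> \<longrightarrow> \<Delta> \<le> \<delta> \<longrightarrow> 1 \<le> N \<longrightarrow> \<tau> = real N * \<Delta> \<longrightarrow> 1 \<le> r \<longrightarrow> \<Gamma> r = K * \<Delta> powr (- lam) \<longrightarrow>
    (\<forall>i\<le>N. norm (h (m + i)) \<le> r) \<longrightarrow> sym_incr M W \<Delta> mc \<longrightarrow>
    (\<integral>\<omega>. norm (h (N + m) + \<Delta> *\<^sub>R f (seg \<Delta> h (N + m)) + g (seg \<Delta> h (N + m)) *v W \<omega>) powr p \<partial>M)
      \<le> step_bound \<epsilon> \<Delta> N h m)"

text \<open>In the output of \<open>moment_step\<close>, T1 reproduces the dissipativity bound. T2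
  is small by the choice of \<epsilon>1; T3, T4 and T5 each leave a positive power of \<Delta> after
  one factor \<Delta> is split off.\<close>

lemma step_inequality_gt2:
  fixes K lam \<epsilon> :: real and mc :: "nat \<Rightarrow> real"
  assumes p2: "p > 2" and lam: "0 < lam" "lam < 1/2" and K: "0 \<le> K" and eps: "0 < \<epsilon>" and mc: "\<And>j. 0 \<le> mc j"
  shows "\<exists>\<delta>. 0 < \<delta> \<and> \<delta> \<le> 1 \<and> (\<forall>(M :: 'w measure) (W :: 'w \<Rightarrow> real^'d). step_valid \<epsilon> K lam mc \<delta> M W)"
proof -
  \<comment> \<open>D carries the factors b2 and b4, so \<epsilon>1 D costs at most \<epsilon>/4 per
    moment.\<close>
  define \<epsilon>1 where "\<epsilon>1 = \<epsilon> / (4 * (b2 + b4))"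
  have e1: "0 < \<epsilon>1" using eps b by (simp add: \<epsilon>1_def)
  have e1b: "\<epsilon>1 * b2 \<le> \<epsilon> / 4" "\<epsilon>1 * b4 \<le> \<epsilon> / 4" using eps b by (auto simp: \<epsilon>1_def field_simps)
  obtain C where C: "C \<ge> 0" and key:
    "\<And>(M :: 'w measure) (W :: 'w \<Rightarrow> real^'d) \<Delta> (A :: real^'d^'n) (y :: real^'n) w a D.
       sym_incr M W \<Delta> mc \<Longrightarrow> norm w \<le> a \<Longrightarrow> 0 \<le> D \<Longrightarrow> (norm A)^2 * \<Delta> \<le> a * norm y + D \<Longrightarrow>
       (\<integral>\<omega>. norm (y + w + A *v W \<omega>) powr p \<partial>M)
         \<le> norm y powr p + norm y powr (p - 2) * (p * (y \<bullet> w) + p * (p - 1) / 2 * ((norm A)^2 * \<Delta>) + \<epsilon>1 * D + C * a^2)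
            + C * (D powr (p / 2) + a powr p)"
    by (fact moment_step[OF p2 mc e1])
  define c0 where "c0 = 2 * sqrt 2 / (b3 - b4)"
  have c0: "0 \<le> c0" using b by (simp add: c0_def)
  have e8: "0 < \<epsilon> / 8" using eps by simp
  \<comment> \<open>Four thresholds for four errors. \<delta>1 and \<delta>2 treat a^2 and a^p,
    where \<Delta>^(2-2\<lambda>) leaves the exponent 1 - 2\<lambda>. \<delta>3 and \<delta>4 treat
    the linear and the superlinear part of D^(p/2), with exponents p/2 - 1 and
    (1-\<lambda>)(p/2-1).\<close>
  obtain \<delta>1 where d1: "0 < \<delta>1" "\<delta>1 \<le> 1" "\<And>x. 0 < x \<Longrightarrow> x \<le> \<delta>1 \<Longrightarrow> (C * (4 * K^2)) * x powr (1 - 2 * lam) \<le> \<epsilon> / 8"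
    by (rule powr_eventually_small[of "1 - 2 * lam" "\<epsilon> / 8" "C * (4 * K^2)"]) (use lam e8 C in auto)
  obtain \<delta>2 where d2: "0 < \<delta>2" "\<delta>2 \<le> 1" "\<And>x. 0 < x \<Longrightarrow> x \<le> \<delta>2 \<Longrightarrow> (C * ((2 * K) powr p * 2 powr (p / 2))) * x powr (1 - 2 * lam) \<le> \<epsilon> / 8"
    by (rule powr_eventually_small[of "1 - 2 * lam" "\<epsilon> / 8" "C * ((2 * K) powr p * 2 powr (p / 2))"]) (use lam e8 C in auto)
  obtain \<delta>3 where d3: "0 < \<delta>3" "\<delta>3 \<le> 1" "\<And>x. 0 < x \<Longrightarrow> x \<le> \<delta>3 \<Longrightarrow> (C * (2 powr (p / 2) * b2 powr (p / 2))) * x powr (p / 2 - 1) \<le> \<epsilon> / 8"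
    by (rule powr_eventually_small[of "p / 2 - 1" "\<epsilon> / 8" "C * (2 powr (p / 2) * b2 powr (p / 2))"]) (use p2 e8 C in auto)
  obtain \<delta>4 where d4: "0 < \<delta>4" "\<delta>4 \<le> 1" "\<And>x. 0 < x \<Longrightarrow> x \<le> \<delta>4 \<Longrightarrow>
      (C * (2 powr (p / 2) * b4 powr (p / 2) * (c0 * K) powr (p / 2 - 1))) * x powr ((1 - lam) * (p / 2 - 1)) \<le> \<epsilon> / 8"
    by (rule powr_eventually_small[of "(1 - lam) * (p / 2 - 1)" "\<epsilon> / 8" "C * (2 powr (p / 2) * b4 powr (p / 2) * (c0 * K) powr (p / 2 - 1))"])
       (use p2 lam e8 C in auto)
  define \<delta> where "\<delta> = min (min \<delta>1 \<delta>2) (min \<delta>3 \<delta>4)"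
  show ?thesis
    unfolding step_valid_def
  proof (intro exI[of _ \<delta>] conjI allI impI)
    show "0 < \<delta>" "\<delta> \<le> 1" using d1 d2 d3 d4 by (auto simp: \<delta>_def)
    fix M :: "'w measure" and W :: "'w \<Rightarrow> real^'d" and N \<Delta> r m and h :: "nat \<Rightarrow> real^'n"
    assume \<Delta>: "0 < \<Delta>" "\<Delta> \<le> \<delta>" and N: "1 \<le> N" and grid: "\<tau> = real N * \<Delta>" and r: "1 \<le> r" and \<Gamma>r: "\<Gamma> r = K * \<Delta> powr (- lam)"
      and h: "\<forall>i\<le>N. norm (h (m + i)) \<le> r" and inc: "sym_incr M W \<Delta> mc"
    note wn = w_nonneg[OF \<Delta>(1) N grid] and ws = w_sum[OF \<Delta>(1) N grid]
    let ?wa = "hatw \<Delta> N \<rho>3" and ?wb = "hatw \<Delta> N \<rho>4" and ?wc = "hatw \<Delta> N (\<lambda>_. 1 / (real N * \<Delta>))"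
    have \<Delta>1: "\<Delta> \<le> 1" using \<Delta> d1 by (simp add: \<delta>_def)
    define x where "x = (\<lambda>i. norm (h (m + i)))"
    define y where "y = norm (h (N + m))"
    have xN: "x N = y" by (simp add: x_def y_def add.commute)
    have x0: "0 \<le> x i" for i by (simp add: x_def)
    have y0: "0 \<le> y" by (simp add: y_def)
    define fv where "fv = f (seg \<Delta> h (N + m))"
    define gv where "gv = g (seg \<Delta> h (N + m))"
    define Sa where "Sa = (\<Sum>i\<le>N. ?wa i * x i powr 2)"
    define Sb where "Sb = (\<Sum>i\<le>N. ?wb i * x i powr (2 + vrho))"
    define Sc where "Sc = (\<Sum>i\<le>N. ?wc i * x i powr 2)"
    define Pa where "Pa = (\<Sum>i\<le>N. ?wa i * x i powr p)"
    define Pc where "Pc = (\<Sum>i\<le>N. ?wc i * x i powr p)"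
    define Qb where "Qb = (\<Sum>i\<le>N. ?wb i * x i powr (p + vrho))"
    define yp where "yp = y powr p"
    define yq where "yq = y powr (p + vrho)"
    define Y where "Y = y powr (p - 2)"
    have nn: "0 \<le> Sa" "0 \<le> Sb" "0 \<le> Sc" "0 \<le> Pa" "0 \<le> Pc" "0 \<le> Qb" "0 \<le> yp" "0 \<le> yq" "0 \<le> Y"
      unfolding Sa_def Sb_def Sc_def Pa_def Pc_def Qb_def yp_def yq_def Y_def
      using wn by (auto intro!: sum_nonneg mult_nonneg_nonneg)
    define D where "D = \<Delta> * (b2 * Sa + b4 * Sb)"
    have D0: "0 \<le> D" using nn \<Delta> b by (simp add: D_def)
    \<comment> \<open>The factor 2 is that of 2 y.f in the dissipativity condition, so that a|y|
      appears in the variance bound; a also bounds the drift \<Delta> f itself.\<close>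
    define a where "a = 2 * \<Delta> * norm fv"
    have a0: "0 \<le> a" using \<Delta> by (simp add: a_def)
    have F1: "2 * (h (N + m) \<bullet> fv) + (p - 1) * (norm gv)^2
        \<le> - b1 * y^2 + b2 * Sa - b3 * y powr (2 + vrho) + b4 * Sb"
      using dissipative_seg[OF \<Delta>(1) N grid, of h m] unfolding fv_def gv_def y_def Sa_def Sb_def x_def .
    \<comment> \<open>Dissipativity is read as a bound on the diffusion: p - 1 \<ge> 1, the terms in
      b1 and b3 are dropped, and Cauchy-Schwarz handles the drift.\<close>
    have G: "(norm gv)^2 * \<Delta> \<le> a * norm (h (N + m)) + D"
    proof -
      have "(norm gv)^2 \<le> (p - 1) * (norm gv)^2" using p2 by (simp add: mult_le_cancel_right1)
      also have "\<dots> \<le> - 2 * (h (N + m) \<bullet> fv) + b2 * Sa + b4 * Sb"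
      proof -
        have "0 \<le> b1 * y^2" "0 \<le> b3 * y powr (2 + vrho)" using b by auto
        then show ?thesis using F1 by linarith
      qed
      also have "\<dots> \<le> 2 * (y * norm fv) + b2 * Sa + b4 * Sb"
      proof -
        have "- (h (N + m) \<bullet> fv) \<le> \<bar>h (N + m) \<bullet> fv\<bar>" by (rule abs_ge_minus_self)
        also have "\<dots> \<le> y * norm fv" unfolding y_def by (rule Cauchy_Schwarz_ineq2)
        finally show ?thesis by linarith
      qed
      finally have "(norm gv)^2 * \<Delta> \<le> (2 * (y * norm fv) + b2 * Sa + b4 * Sb) * \<Delta>"
        using \<Delta> by (intro mult_right_mono) auto
      then show ?thesis by (simp add: a_def D_def y_def algebra_simps)
    qed
    have wle: "norm (\<Delta> *\<^sub>R fv) \<le> a" using \<Delta> by (simp add: a_def)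
    have E: "(\<integral>\<omega>. norm (h (N + m) + \<Delta> *\<^sub>R fv + gv *v W \<omega>) powr p \<partial>M)
         \<le> yp + Y * (p * (h (N + m) \<bullet> (\<Delta> *\<^sub>R fv)) + p * (p - 1) / 2 * ((norm gv)^2 * \<Delta>) + \<epsilon>1 * D + C * a^2)
            + C * (D powr (p / 2) + a powr p)"
      unfolding yp_def Y_def y_def by (rule key[OF inc wle D0 G])
    have Yy: "Y * y^2 = yp" "Y * y powr (2 + vrho) = yq"
    proof -
      have "Y * y powr 2 = yp" "Y * y powr (2 + vrho) = yq"
        unfolding Y_def yp_def yq_def powr_add[symmetric] by simp_all
      then show "Y * y^2 = yp" "Y * y powr (2 + vrho) = yq" using y0 by simp_all
    qed
    define YA where "YA = (p - 2) / p * yp + 2 / p * Pa"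
    define YB where "YB = (p - 2) / (p + vrho) * yq + (2 + vrho) / (p + vrho) * Qb"
    have YA: "Y * Sa \<le> YA"
      using weighted_powr_Young[OF wn(1) ws(1), of "p - 2" 2 y x] p2 x0 y0
      by (simp add: Y_def Sa_def YA_def yp_def Pa_def)
    have YC: "Y * Sc \<le> (p - 2) / p * yp + 2 / p * Pc"
      using weighted_powr_Young[OF wn(3) ws(3), of "p - 2" 2 y x] p2 x0 y0
      by (simp add: Y_def Sc_def yp_def Pc_def)
    have YB: "Y * Sb \<le> YB"
      using weighted_powr_Young[OF wn(2) ws(2), of "p - 2" "2 + vrho" y x] p2 x0 y0 rho
      by (simp add: Y_def Sb_def YB_def yq_def Qb_def)
    have frac: "(p - 2) / p * u + 2 / p * v \<le> u + v" if "0 \<le> u" "0 \<le> v" for u v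
      using that p2 by (intro add_mono mult_left_le_one_le) auto
    have frac2: "(p - 2) / (p + vrho) * u + (2 + vrho) / (p + vrho) * v \<le> u + v" if "0 \<le> u" "0 \<le> v" for u v
      using that p2 rho by (intro add_mono mult_left_le_one_le) auto
    have T1: "Y * (p * (h (N + m) \<bullet> (\<Delta> *\<^sub>R fv)) + p * (p - 1) / 2 * ((norm gv)^2 * \<Delta>))
        \<le> \<Delta> * (p / 2 * (- b1 * yp + b2 * YA - b3 * yq + b4 * YB))"
    proof -
      have "Y * (p * (h (N + m) \<bullet> (\<Delta> *\<^sub>R fv)) + p * (p - 1) / 2 * ((norm gv)^2 * \<Delta>))
        = (\<Delta> * (p / 2)) * (Y * (2 * (h (N + m) \<bullet> fv) + (p - 1) * (norm gv)^2))"
        by (simp add: field_simps)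
      also have "\<dots> \<le> (\<Delta> * (p / 2)) * (Y * (- b1 * y^2 + b2 * Sa - b3 * y powr (2 + vrho) + b4 * Sb))"
        using F1 nn \<Delta> p2 by (intro mult_left_mono) auto
      also have "Y * (- b1 * y^2 + b2 * Sa - b3 * y powr (2 + vrho) + b4 * Sb)
         = - b1 * (Y * y^2) + b2 * (Y * Sa) - b3 * (Y * y powr (2 + vrho)) + b4 * (Y * Sb)"
        by (simp add: algebra_simps)
      also have "\<dots> = - b1 * yp + b2 * (Y * Sa) - b3 * yq + b4 * (Y * Sb)" by (simp only: Yy)
      also have "(\<Delta> * (p / 2)) * (- b1 * yp + b2 * (Y * Sa) - b3 * yq + b4 * (Y * Sb))
         \<le> (\<Delta> * (p / 2)) * (- b1 * yp + b2 * YA - b3 * yq + b4 * YB)"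
      proof (rule mult_left_mono)
        have "b2 * (Y * Sa) \<le> b2 * YA" "b4 * (Y * Sb) \<le> b4 * YB"
          using YA YB b by (auto intro: mult_left_mono)
        then show "- b1 * yp + b2 * (Y * Sa) - b3 * yq + b4 * (Y * Sb) \<le> - b1 * yp + b2 * YA - b3 * yq + b4 * YB"
          by linarith
      qed (use \<Delta> p2 in auto)
      finally show ?thesis by (simp add: mult.assoc)
    qed
    have T2: "Y * (\<epsilon>1 * D) \<le> \<Delta> * (\<epsilon> / 4 * (yp + Pa + yq + Qb))"
    proof -
      have "Y * (\<epsilon>1 * D) = \<Delta> * (\<epsilon>1 * b2 * (Y * Sa) + \<epsilon>1 * b4 * (Y * Sb))" by (simp add: D_def algebra_simps)
      also have "\<dots> \<le> \<Delta> * (\<epsilon> / 4 * (yp + Pa) + \<epsilon> / 4 * (yq + Qb))"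
      proof (intro mult_left_mono add_mono)
        have "Y * Sa \<le> yp + Pa" using YA frac[of yp Pa] nn unfolding YA_def by linarith
        then show "\<epsilon>1 * b2 * (Y * Sa) \<le> \<epsilon> / 4 * (yp + Pa)"
          using e1b e1 b nn eps by (intro mult_mono) auto
        have "Y * Sb \<le> yq + Qb" using YB frac2[of yq Qb] nn unfolding YB_def by linarith
        then show "\<epsilon>1 * b4 * (Y * Sb) \<le> \<epsilon> / 4 * (yq + Qb)"
          using e1b e1 b nn eps by (intro mult_mono) auto
      qed (use \<Delta> in auto)
      also have "\<dots> = \<Delta> * (\<epsilon> / 4 * (yp + Pa + yq + Qb))" by (simp only: distrib_left add.assoc)
      finally show ?thesis .
    qed
    \<comment> \<open>\<kappa> = \<Delta> \<Gamma>(r) is the size of a truncated drift step relative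
      to the state; its square is \<Delta> times a positive power of \<Delta> because \<lambda> <
      1/2.\<close>
    define \<kappa> where "\<kappa> = K * \<Delta> powr (1 - lam)"
    have k0: "0 \<le> \<kappa>" using K by (simp add: \<kappa>_def)
    have ak: "a \<le> 2 * \<kappa> * sqrt (y^2 + Sc)"
    proof -
      have "norm fv \<le> \<Gamma> r * sqrt (y^2 + Sc)"
        using norm_f_seg_le[OF \<Delta>(1) N grid r, of h m] h unfolding fv_def y_def Sc_def x_def by blast
      then have "2 * \<Delta> * norm fv \<le> 2 * \<Delta> * (\<Gamma> r * sqrt (y^2 + Sc))" using \<Delta> by (intro mult_left_mono) auto
      also have "\<dots> = 2 * \<kappa> * sqrt (y^2 + Sc)"
      proof -
        have "\<Delta> * \<Gamma> r = \<kappa>" unfolding \<Gamma>r \<kappa>_def using \<Delta> by (simp add: powr_diff powr_minus field_simps)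
        then show ?thesis by (metis mult.assoc)
      qed
      finally show ?thesis by (simp add: a_def)
    qed
    have ysc: "0 \<le> y^2 + Sc" using nn by simp
    have pw1: "\<Delta> powr (1 + s) = \<Delta> * \<Delta> powr s" for s using \<Delta> by (simp add: powr_add)
    have pw2: "\<Delta> powr ((1 - lam) * 2) = \<Delta> * \<Delta> powr (1 - 2 * lam)"
    proof -
      have "(1 - lam) * 2 = 1 + (1 - 2 * lam)" by simp
      then show ?thesis by (simp only: pw1)
    qed
    have kp: "\<kappa>^2 = \<Delta> * (K^2 * \<Delta> powr (1 - 2 * lam))"
    proof -
      have "(\<Delta> powr (1 - lam))^2 = (\<Delta> powr (1 - lam)) powr 2" by simp
      also have "\<dots> = \<Delta> powr ((1 - lam) * 2)" by (rule powr_powr)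
      finally have "(\<Delta> powr (1 - lam))^2 = \<Delta> powr ((1 - lam) * 2)" .
      then have "(\<Delta> powr (1 - lam))^2 = \<Delta> * \<Delta> powr (1 - 2 * lam)" by (simp only: pw2)
      then show ?thesis by (simp add: \<kappa>_def power_mult_distrib)
    qed
    have T3: "Y * (C * a^2) \<le> \<Delta> * (\<epsilon> / 8 * (2 * yp + Pc))"
    proof -
      have "a^2 \<le> (2 * \<kappa> * sqrt (y^2 + Sc))^2" using ak a0 by (intro power_mono)
      also have "\<dots> = 4 * \<kappa>^2 * (y^2 + Sc)" using ysc by (simp add: power_mult_distrib)
      finally have "Y * (C * a^2) \<le> Y * (C * (4 * \<kappa>^2 * (y^2 + Sc)))"
        using nn C by (intro mult_left_mono)
      also have "\<dots> = (C * (4 * \<kappa>^2)) * (Y * y^2 + Y * Sc)" by (simp add: algebra_simps)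
      also have "\<dots> \<le> (C * (4 * \<kappa>^2)) * (2 * yp + Pc)"
        using C YC frac[of yp Pc] nn unfolding Yy by (intro mult_left_mono) auto
      also have "\<dots> = \<Delta> * ((C * (4 * K^2)) * \<Delta> powr (1 - 2 * lam) * (2 * yp + Pc))"
        unfolding kp by (simp add: mult_ac)
      also have "\<dots> \<le> \<Delta> * (\<epsilon> / 8 * (2 * yp + Pc))"
        using d1(3)[of \<Delta>] \<Delta> nn by (intro mult_left_mono mult_right_mono) (auto simp: \<delta>_def)
      finally show ?thesis .
    qed
    have T5: "C * a powr p \<le> \<Delta> * (\<epsilon> / 8 * (yp + Pc))"
    proof -
      have ps: "(y^2 + Sc) powr (p / 2) \<le> 2 powr (p / 2) * ((y^2) powr (p / 2) + Sc powr (p / 2))"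
        using nn p2 by (intro powr_add_le) auto
      have "(y^2) powr (p / 2) = yp"
      proof -
        have "(y^2) powr (p / 2) = (y powr 2) powr (p / 2)" using y0 by simp
        then show ?thesis unfolding yp_def powr_powr by simp
      qed
      moreover have "Sc powr (p / 2) \<le> Pc"
        using weighted_powr_Jensen[OF wn(3) ws(3), of "p / 2" "\<lambda>i. x i powr 2"] p2
        unfolding Sc_def Pc_def powr_powr by simp
      ultimately have "(y^2) powr (p / 2) + Sc powr (p / 2) \<le> yp + Pc" by linarith
      then have "2 powr (p / 2) * ((y^2) powr (p / 2) + Sc powr (p / 2)) \<le> 2 powr (p / 2) * (yp + Pc)"
        by (intro mult_left_mono) auto
      with ps have s1: "(y^2 + Sc) powr (p / 2) \<le> 2 powr (p / 2) * (yp + Pc)" by linarith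
      have s2: "(2 * \<kappa>) powr p \<le> \<Delta> * ((2 * K) powr p * \<Delta> powr (1 - 2 * lam))"
      proof -
        \<comment> \<open>Since \<Delta> \<le> 1 and p \<ge> 2, the exponent can be lowered to that
          of \<kappa>^2, and the power 1 - 2\<lambda> reappears.\<close>
        have ex: "(1 - lam) * 2 \<le> (1 - lam) * p" using lam p2 by (intro mult_left_mono) auto
        have "(2 * \<kappa>) powr p = (2 * K) powr p * \<Delta> powr ((1 - lam) * p)"
          using K by (simp add: \<kappa>_def powr_mult powr_powr mult.assoc[symmetric])
        also have "\<dots> \<le> (2 * K) powr p * \<Delta> powr ((1 - lam) * 2)"
          using \<Delta> \<Delta>1 by (intro mult_left_mono powr_mono'[OF ex]) auto
        also have "\<dots> = \<Delta> * ((2 * K) powr p * \<Delta> powr (1 - 2 * lam))" by (simp only: pw2 mult.left_commute)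
        finally show ?thesis .
      qed
      have "a powr p \<le> (2 * \<kappa> * sqrt (y^2 + Sc)) powr p" using ak a0 p2 by (intro powr_mono2) auto
      also have "\<dots> = (2 * \<kappa>) powr p * (y^2 + Sc) powr (p / 2)"
        using k0 ysc by (simp add: powr_mult powr_half_sqrt[symmetric] powr_powr)
      also have "\<dots> \<le> (\<Delta> * ((2 * K) powr p * \<Delta> powr (1 - 2 * lam))) * (2 powr (p / 2) * (yp + Pc))"
        using \<Delta> by (intro mult_mono s1 s2) auto
      finally have "a powr p \<le> \<Delta> * ((2 * K) powr p * \<Delta> powr (1 - 2 * lam)) * (2 powr (p / 2) * (yp + Pc))" .
      then have "C * a powr p \<le> C * (\<Delta> * ((2 * K) powr p * \<Delta> powr (1 - 2 * lam)) * (2 powr (p / 2) * (yp + Pc)))"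
        using C by (intro mult_left_mono)
      also have "\<dots> = \<Delta> * ((C * ((2 * K) powr p * 2 powr (p / 2))) * \<Delta> powr (1 - 2 * lam) * (yp + Pc))" by (simp add: mult_ac)
      also have "\<dots> \<le> \<Delta> * (\<epsilon> / 8 * (yp + Pc))"
        using d2(3)[of \<Delta>] \<Delta> nn by (intro mult_left_mono mult_right_mono) (auto simp: \<delta>_def)
      finally show ?thesis .
    qed
    have T4: "C * D powr (p / 2) \<le> \<Delta> * (\<epsilon> / 8 * (Pa + Qb))"
    proof -
      have "D powr (p / 2) = (\<Delta> * b2 * Sa + \<Delta> * b4 * Sb) powr (p / 2)" by (simp add: D_def algebra_simps)
      also have "\<dots> \<le> 2 powr (p / 2) * ((\<Delta> * b2 * Sa) powr (p / 2) + (\<Delta> * b4 * Sb) powr (p / 2))"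
        using nn \<Delta> b p2 by (intro powr_add_le) auto
      finally have "D powr (p / 2) \<le> 2 powr (p / 2) * ((\<Delta> * b2 * Sa) powr (p / 2) + (\<Delta> * b4 * Sb) powr (p / 2))" .
      moreover have "(\<Delta> * b2 * Sa) powr (p / 2) \<le> \<Delta> * \<Delta> powr (p / 2 - 1) * b2 powr (p / 2) * Pa"
      proof -
        have "Sa powr (p / 2) \<le> Pa"
          using weighted_powr_Jensen[OF wn(1) ws(1), of "p / 2" "\<lambda>i. x i powr 2"] p2
          unfolding Sa_def Pa_def powr_powr by simp
        moreover have "\<Delta> powr (p / 2) = \<Delta> * \<Delta> powr (p / 2 - 1)" using \<Delta> by (simp add: powr_diff)
        moreover have "(\<Delta> * b2 * Sa) powr (p / 2) = \<Delta> powr (p / 2) * b2 powr (p / 2) * Sa powr (p / 2)"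
          using \<Delta> b nn by (simp add: powr_mult)
        ultimately show ?thesis using \<Delta> by (simp add: mult_left_mono)
      qed
      moreover have "(\<Delta> * b4 * Sb) powr (p / 2) \<le> \<Delta> * ((c0 * K) powr (p / 2 - 1) * \<Delta> powr ((1 - lam) * (p / 2 - 1))) * b4 powr (p / 2) * Qb"
      proof -
        have rv: "r powr vrho \<le> c0 * \<Gamma> r"
          using Gamma_lower[OF r] b by (simp add: c0_def field_simps)
        have "\<Delta> * r powr vrho \<le> \<Delta> * (c0 * \<Gamma> r)" using rv \<Delta> by (intro mult_left_mono) auto
        also have "\<dots> = (c0 * K) * \<Delta> powr (1 - lam)"
          unfolding \<Gamma>r using \<Delta> by (simp add: powr_diff powr_minus field_simps)
        finally have dr: "\<Delta> * r powr vrho \<le> (c0 * K) * \<Delta> powr (1 - lam)" .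
        have "Sb powr (p / 2) \<le> (\<Sum>i\<le>N. ?wb i * x i powr ((2 + vrho) * (p / 2)))"
          using weighted_powr_Jensen[OF wn(2) ws(2), of "p / 2" "\<lambda>i. x i powr (2 + vrho)"] p2
          unfolding Sb_def powr_powr by simp
        also have "\<dots> \<le> (\<Sum>i\<le>N. ?wb i * (x i powr (p + vrho) * (r powr vrho) powr (p / 2 - 1)))"
        proof (intro sum_mono mult_left_mono wn)
          fix i assume i: "i \<in> {..N}"
          \<comment> \<open>The order p + \<open>vrho\<close> is kept as a moment; the surplus
            \<open>vrho\<close> (p/2 - 1) is bounded through the truncation radius.\<close>
          have "(2 + vrho) * (p / 2) = p + vrho + vrho * (p / 2 - 1)" by (simp add: field_simps)
          then have "x i powr ((2 + vrho) * (p / 2)) = x i powr (p + vrho + vrho * (p / 2 - 1))" by (simp only:)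
          also have "\<dots> = x i powr (p + vrho) * x i powr (vrho * (p / 2 - 1))" by (rule powr_add)
          also have "\<dots> \<le> x i powr (p + vrho) * r powr (vrho * (p / 2 - 1))"
            using h i p2 rho x0 by (intro mult_left_mono powr_mono2) (auto simp: x_def)
          finally show "x i powr ((2 + vrho) * (p / 2)) \<le> x i powr (p + vrho) * (r powr vrho) powr (p / 2 - 1)"
            by (simp add: powr_powr)
        qed
        also have "\<dots> = (r powr vrho) powr (p / 2 - 1) * Qb" by (simp add: Qb_def sum_distrib_left mult_ac)
        finally have s: "Sb powr (p / 2) \<le> (r powr vrho) powr (p / 2 - 1) * Qb" .
        have "(\<Delta> * b4 * Sb) powr (p / 2) = \<Delta> powr (p / 2) * b4 powr (p / 2) * Sb powr (p / 2)"
          using \<Delta> b nn by (simp add: powr_mult)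
        also have "\<dots> \<le> \<Delta> powr (p / 2) * b4 powr (p / 2) * ((r powr vrho) powr (p / 2 - 1) * Qb)"
          using s by (intro mult_left_mono) auto
        also have "\<Delta> powr (p / 2) = \<Delta> * \<Delta> powr (p / 2 - 1)" using \<Delta> by (simp add: powr_diff)
        \<comment> \<open>The spare power of \<Delta> and the surplus power of r have the common
          exponent p/2 - 1, so they merge into a power of \<Delta> r^\<open>vrho\<close>, which is
          of order \<Delta>^(1-\<lambda>).\<close>
        also have "\<Delta> * \<Delta> powr (p / 2 - 1) * b4 powr (p / 2) * ((r powr vrho) powr (p / 2 - 1) * Qb)
           = \<Delta> * (\<Delta> * r powr vrho) powr (p / 2 - 1) * b4 powr (p / 2) * Qb"
          using \<Delta> by (simp add: powr_mult mult_ac)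
        also have "\<dots> \<le> \<Delta> * ((c0 * K) * \<Delta> powr (1 - lam)) powr (p / 2 - 1) * b4 powr (p / 2) * Qb"
          using dr \<Delta> nn p2 by (intro mult_right_mono mult_left_mono powr_mono2) auto
        also have "((c0 * K) * \<Delta> powr (1 - lam)) powr (p / 2 - 1) = (c0 * K) powr (p / 2 - 1) * \<Delta> powr ((1 - lam) * (p / 2 - 1))"
          using c0 K by (simp add: powr_mult powr_powr)
        finally show ?thesis .
      qed
      ultimately have "D powr (p / 2) \<le> 2 powr (p / 2) * (\<Delta> * \<Delta> powr (p / 2 - 1) * b2 powr (p / 2) * Pa
           + \<Delta> * ((c0 * K) powr (p / 2 - 1) * \<Delta> powr ((1 - lam) * (p / 2 - 1))) * b4 powr (p / 2) * Qb)"
        by (smt (verit) mult_left_mono powr_ge_zero)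
      then have "C * D powr (p / 2) \<le> C * (2 powr (p / 2) * (\<Delta> * \<Delta> powr (p / 2 - 1) * b2 powr (p / 2) * Pa
           + \<Delta> * ((c0 * K) powr (p / 2 - 1) * \<Delta> powr ((1 - lam) * (p / 2 - 1))) * b4 powr (p / 2) * Qb))"
        using C by (intro mult_left_mono)
      also have "\<dots> = \<Delta> * ((C * (2 powr (p / 2) * b2 powr (p / 2))) * \<Delta> powr (p / 2 - 1) * Pa
          + (C * (2 powr (p / 2) * b4 powr (p / 2) * (c0 * K) powr (p / 2 - 1))) * \<Delta> powr ((1 - lam) * (p / 2 - 1)) * Qb)"
        by (simp add: distrib_left mult_ac)
      also have "\<dots> \<le> \<Delta> * (\<epsilon> / 8 * Pa + \<epsilon> / 8 * Qb)"
        using d3(3)[of \<Delta>] d4(3)[of \<Delta>] \<Delta> nn by (intro mult_left_mono add_mono mult_right_mono) (auto simp: \<delta>_def)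
      finally show ?thesis by (simp add: distrib_left)
    qed
    have "(\<integral>\<omega>. norm (h (N + m) + \<Delta> *\<^sub>R fv + gv *v W \<omega>) powr p \<partial>M)
         \<le> yp + \<Delta> * (p / 2 * (- b1 * yp + b2 * YA - b3 * yq + b4 * YB)) + \<Delta> * (\<epsilon> / 4 * (yp + Pa + yq + Qb))
            + \<Delta> * (\<epsilon> / 8 * (2 * yp + Pc)) + \<Delta> * (\<epsilon> / 8 * (Pa + Qb)) + \<Delta> * (\<epsilon> / 8 * (yp + Pc))"
      using E T1 T2 T3 T4 T5 unfolding distrib_left[of Y] distrib_left[of C] by linarith
    also have "\<dots> = yp + \<Delta> * (p / 2 * (- b1 * yp + b2 * YA - b3 * yq + b4 * YB) + (\<epsilon> / 4 * (yp + Pa + yq + Qb)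
            + \<epsilon> / 8 * (2 * yp + Pc) + \<epsilon> / 8 * (Pa + Qb) + \<epsilon> / 8 * (yp + Pc)))"
      by (simp only: distrib_left add.assoc)
    also have "\<dots> \<le> yp + \<Delta> * (p / 2 * (- b1 * yp + b2 * YA - b3 * yq + b4 * YB) + \<epsilon> * (yp + Pa + Pc + yq + Qb))"
    proof (intro add_left_mono mult_left_mono)
      have "\<epsilon> / 4 * (yp + Pa + yq + Qb) + \<epsilon> / 8 * (2 * yp + Pc) + \<epsilon> / 8 * (Pa + Qb) + \<epsilon> / 8 * (yp + Pc)
         = \<epsilon> * (5 / 8 * yp + 3 / 8 * Pa + 1 / 4 * Pc + 1 / 4 * yq + 3 / 8 * Qb)" by (simp add: field_simps)
      also have "\<dots> \<le> \<epsilon> * (yp + Pa + Pc + yq + Qb)" using nn eps by (intro mult_left_mono) auto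
      finally show "\<epsilon> / 4 * (yp + Pa + yq + Qb) + \<epsilon> / 8 * (2 * yp + Pc) + \<epsilon> / 8 * (Pa + Qb) + \<epsilon> / 8 * (yp + Pc)
        \<le> \<epsilon> * (yp + Pa + Pc + yq + Qb)" .
    qed (use \<Delta> in auto)
    also have "\<dots> = step_bound \<epsilon> \<Delta> N h m"
      unfolding step_bound_def Let_def YA_def YB_def yp_def yq_def Pa_def Pc_def Qb_def x_def y_def
      by (simp add: add.commute[of N m])
    finally show "(\<integral>\<omega>. norm (h (N + m) + \<Delta> *\<^sub>R f (seg \<Delta> h (N + m)) + g (seg \<Delta> h (N + m)) *v W \<omega>) powr p \<partial>M)
      \<le> step_bound \<epsilon> \<Delta> N h m" unfolding fv_def gv_def .
  qed
qed

text \<open>The second moment of the step equals |y + \<Delta> f|^2 + |g|^2 \<Delta>, so the only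
  error is \<Delta>^2 |f|^2, of order \<Delta>^(2-2\<lambda>).\<close>

lemma step_inequality_eq2:
  fixes K lam \<epsilon> :: real and mc :: "nat \<Rightarrow> real"
  assumes p2: "p = 2" and lam: "0 < lam" "lam < 1/2" and K: "0 \<le> K" and eps: "0 < \<epsilon>"
  shows "\<exists>\<delta>. 0 < \<delta> \<and> \<delta> \<le> 1 \<and> (\<forall>(M :: 'w measure) (W :: 'w \<Rightarrow> real^'d). step_valid \<epsilon> K lam mc \<delta> M W)"
proof -
  obtain \<delta> where d: "0 < \<delta>" "\<delta> \<le> 1" "\<And>x. 0 < x \<Longrightarrow> x \<le> \<delta> \<Longrightarrow> K^2 * x powr (1 - 2 * lam) \<le> \<epsilon>"
    by (rule powr_eventually_small[of "1 - 2 * lam" \<epsilon> "K^2"]) (use lam eps in auto)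
  show ?thesis
    unfolding step_valid_def
  proof (intro exI[of _ \<delta>] conjI allI impI)
    show "0 < \<delta>" "\<delta> \<le> 1" using d by auto
    fix M :: "'w measure" and W :: "'w \<Rightarrow> real^'d" and N \<Delta> r m and h :: "nat \<Rightarrow> real^'n"
    assume \<Delta>: "0 < \<Delta>" "\<Delta> \<le> \<delta>" and N: "1 \<le> N" and grid: "\<tau> = real N * \<Delta>" and r: "1 \<le> r" and \<Gamma>r: "\<Gamma> r = K * \<Delta> powr (- lam)"
      and h: "\<forall>i\<le>N. norm (h (m + i)) \<le> r" and inc: "sym_incr M W \<Delta> mc"
    note wn = w_nonneg[OF \<Delta>(1) N grid]
    let ?wa = "hatw \<Delta> N \<rho>3" and ?wb = "hatw \<Delta> N \<rho>4" and ?wc = "hatw \<Delta> N (\<lambda>_. 1 / (real N * \<Delta>))"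
    define x where "x = (\<lambda>i. norm (h (m + i)))"
    define y where "y = norm (h (N + m))"
    define fv where "fv = f (seg \<Delta> h (N + m))"
    define gv where "gv = g (seg \<Delta> h (N + m))"
    define Sa where "Sa = (\<Sum>i\<le>N. ?wa i * x i powr 2)"
    define Sb where "Sb = (\<Sum>i\<le>N. ?wb i * x i powr (2 + vrho))"
    define Sc where "Sc = (\<Sum>i\<le>N. ?wc i * x i powr 2)"
    define yq where "yq = y powr (2 + vrho)"
    have nn: "0 \<le> Sa" "0 \<le> Sb" "0 \<le> Sc" "0 \<le> yq" "0 \<le> y^2"
      unfolding Sa_def Sb_def Sc_def yq_def using wn by (auto intro!: sum_nonneg mult_nonneg_nonneg)
    have F1: "2 * (h (N + m) \<bullet> fv) + (norm gv)^2 \<le> - b1 * y^2 + b2 * Sa - b3 * yq + b4 * Sb"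
      using dissipative_seg[OF \<Delta>(1) N grid, of h m] p2 unfolding fv_def gv_def y_def Sa_def Sb_def x_def yq_def by simp
    have F2: "(\<Delta> * norm fv)^2 \<le> \<Delta> * (\<epsilon> * (y^2 + Sc))"
    proof -
      have "norm fv \<le> \<Gamma> r * sqrt (y^2 + Sc)"
        using norm_f_seg_le[OF \<Delta>(1) N grid r, of h m] h unfolding fv_def y_def Sc_def x_def by blast
      then have "(\<Delta> * norm fv)^2 \<le> (\<Delta> * (\<Gamma> r * sqrt (y^2 + Sc)))^2"
        using \<Delta> by (intro power_mono mult_left_mono) auto
      also have "\<dots> = (\<Delta> * \<Delta> powr (- lam))^2 * K^2 * (y^2 + Sc)"
        using nn by (simp add: \<Gamma>r power_mult_distrib)
      also have "(\<Delta> * \<Delta> powr (- lam))^2 = \<Delta> * \<Delta> powr (1 - 2 * lam)"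
      proof -
        have "(\<Delta> * \<Delta> powr (- lam))^2 = \<Delta> * (\<Delta> * (\<Delta> powr (- lam) * \<Delta> powr (- lam)))" by (simp add: power2_eq_square)
        also have "\<Delta> powr (- lam) * \<Delta> powr (- lam) = \<Delta> powr (- 2 * lam)" by (simp flip: powr_add)
        also have "\<Delta> * \<Delta> powr (- 2 * lam) = \<Delta> powr (1 - 2 * lam)" using \<Delta> by (simp add: powr_mult_base)
        finally show ?thesis .
      qed
      also have "\<Delta> * \<Delta> powr (1 - 2 * lam) * K^2 * (y^2 + Sc) = \<Delta> * ((K^2 * \<Delta> powr (1 - 2 * lam)) * (y^2 + Sc))"
        by (simp add: mult_ac)
      also have "\<dots> \<le> \<Delta> * (\<epsilon> * (y^2 + Sc))"
        using d(3)[of \<Delta>] \<Delta> nn by (intro mult_left_mono mult_right_mono) auto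
      finally show ?thesis .
    qed
    have "(\<integral>\<omega>. norm (h (N + m) + \<Delta> *\<^sub>R fv + gv *v W \<omega>) powr p \<partial>M) = (norm (h (N + m) + \<Delta> *\<^sub>R fv))^2 + (norm gv)^2 * \<Delta>"
      unfolding p2 by (rule sym_incr_second_moment[OF inc])
    also have "(norm (h (N + m) + \<Delta> *\<^sub>R fv))^2 = y^2 + \<Delta> * (2 * (h (N + m) \<bullet> fv)) + (\<Delta> * norm fv)^2"
      unfolding y_def power_mult_distrib power2_norm_eq_inner
      by (simp add: inner_add_left inner_add_right inner_commute power2_eq_square algebra_simps)
    also have "y^2 + \<Delta> * (2 * (h (N + m) \<bullet> fv)) + (\<Delta> * norm fv)^2 + (norm gv)^2 * \<Delta>
       = y^2 + \<Delta> * (2 * (h (N + m) \<bullet> fv) + (norm gv)^2) + (\<Delta> * norm fv)^2" by (simp add: algebra_simps)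
    also have "\<dots> \<le> y^2 + \<Delta> * (- b1 * y^2 + b2 * Sa - b3 * yq + b4 * Sb) + \<Delta> * (\<epsilon> * (y^2 + Sc))"
      using mult_left_mono[OF F1 less_imp_le[OF \<Delta>(1)]] F2 by linarith
    also have "\<dots> \<le> y^2 + \<Delta> * (- b1 * y^2 + b2 * Sa - b3 * yq + b4 * Sb) + \<Delta> * (\<epsilon> * (y^2 + Sa + Sc + yq + Sb))"
      using nn \<Delta> eps by (intro add_left_mono mult_left_mono) auto
    also have "\<dots> = step_bound \<epsilon> \<Delta> N h m"
      unfolding step_bound_def Let_def Sa_def Sb_def Sc_def yq_def y_def x_def unfolding p2 using rho
      by (simp add: add.commute[of N m] distrib_left add.commute[of 2 vrho])
    finally show "(\<integral>\<omega>. norm (h (N + m) + \<Delta> *\<^sub>R f (seg \<Delta> h (N + m)) + g (seg \<Delta> h (N + m)) *v W \<omega>) powr p \<partial>M)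
      \<le> step_bound \<epsilon> \<Delta> N h m" unfolding fv_def gv_def .
  qed
qed

end

section \<open>Delayed linear inequalities and exponential decay\<close>

lemma sum_lessThan_add:
  fixes F :: "nat \<Rightarrow> 'a::comm_monoid_add"
  shows "(\<Sum>j<m + n. F j) = (\<Sum>j<m. F j) + (\<Sum>k<n. F (m + k))"
  by (induction n) (auto simp: add.assoc)

text \<open>Moving a delayed term to its own time changes the weight by a factor of at most
  e^(\<nu>\<tau>); this is the origin of b2 e^(\<nu>\<tau>) and b4 e^(\<nu>\<tau>) in the conditions
  on \<nu>.\<close>

lemma delayed_sum_le:
  fixes e u :: "nat \<Rightarrow> real" and \<nu> \<Delta> :: real
  assumes \<nu>: "0 \<le> \<nu>" and \<Delta>: "0 \<le> \<Delta>" and e: "\<And>j. 0 \<le> e j" and u: "\<And>i. 0 \<le> u i"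
  shows "(\<Sum>k<n. exp (\<nu> * real k * \<Delta>) * (\<Sum>i\<le>N. u i * e (k + i)))
    \<le> (\<Sum>i\<le>N. u i) * exp (\<nu> * (real N * \<Delta>)) * ((\<Sum>j<N. e j) + (\<Sum>k<n. exp (\<nu> * real k * \<Delta>) * e (N + k)))"
proof -
  \<comment> \<open>The weight e^(\<nu>t) at the time t = (j - N)\<Delta> of index j.\<close>
  define wt where "wt j = exp (\<nu> * (real j - real N) * \<Delta>)" for j
  define T where "T = (\<Sum>j<N. e j) + (\<Sum>k<n. exp (\<nu> * real k * \<Delta>) * e (N + k))"
  have one: "(\<Sum>k<n. exp (\<nu> * real k * \<Delta>) * e (k + i)) \<le> exp (\<nu> * (real N * \<Delta>)) * T" if i: "i \<le> N" for i
  proof -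
    have "(\<Sum>k<n. exp (\<nu> * real k * \<Delta>) * e (k + i)) \<le> (\<Sum>k<n. exp (\<nu> * (real N * \<Delta>)) * (wt (k + i) * e (k + i)))"
    proof (rule sum_mono)
      fix k
      have "exp (\<nu> * real k * \<Delta>) = exp (\<nu> * (real N - real i) * \<Delta>) * wt (k + i)"
        unfolding wt_def exp_add[symmetric] by (simp add: algebra_simps)
      also have "\<dots> \<le> exp (\<nu> * (real N * \<Delta>)) * wt (k + i)"
      proof (rule mult_right_mono)
        have "\<nu> * (real N - real i) * \<Delta> \<le> \<nu> * real N * \<Delta>"
          using \<nu> \<Delta> by (intro mult_right_mono mult_left_mono) auto
        then show "exp (\<nu> * (real N - real i) * \<Delta>) \<le> exp (\<nu> * (real N * \<Delta>))" by (simp add: mult.assoc)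
      qed (simp add: wt_def)
      finally show "exp (\<nu> * real k * \<Delta>) * e (k + i) \<le> exp (\<nu> * (real N * \<Delta>)) * (wt (k + i) * e (k + i))"
        using e by (simp add: mult_right_mono mult.assoc[symmetric])
    qed
    also have "\<dots> = exp (\<nu> * (real N * \<Delta>)) * (\<Sum>k<n. wt (k + i) * e (k + i))" by (simp add: sum_distrib_left)
    \<comment> \<open>For a fixed lag the shift is injective into the indices below N + n, so
      nonnegativity bounds the sum by the full one.\<close>
    also have "(\<Sum>k<n. wt (k + i) * e (k + i)) = (\<Sum>j\<in>(\<lambda>k. k + i) ` {..<n}. wt j * e j)"
      by (subst sum.reindex) (auto simp: inj_on_def)
    also have "\<dots> \<le> (\<Sum>j<N + n. wt j * e j)"
      using i e by (intro sum_mono2) (auto simp: wt_def)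
    also have "\<dots> = (\<Sum>j<N. wt j * e j) + (\<Sum>k<n. wt (N + k) * e (N + k))"
      by (rule sum_lessThan_add)
    also have "\<dots> \<le> T"
      unfolding T_def
    proof (intro add_mono sum_mono)
      fix j assume "j \<in> {..<N}"
      then have "\<nu> * (real j - real N) * \<Delta> \<le> 0" using \<nu> \<Delta> by (intro mult_nonpos_nonneg mult_nonneg_nonpos) auto
      then have "wt j \<le> 1" by (simp add: wt_def)
      then show "wt j * e j \<le> e j" using e[of j] by (intro mult_left_le_one_le) (auto simp: wt_def)
    qed (simp add: wt_def)
    finally show ?thesis by simp
  qed
  have "(\<Sum>k<n. exp (\<nu> * real k * \<Delta>) * (\<Sum>i\<le>N. u i * e (k + i)))
     = (\<Sum>i\<le>N. u i * (\<Sum>k<n. exp (\<nu> * real k * \<Delta>) * e (k + i)))"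
    unfolding sum_distrib_left by (subst sum.swap) (simp add: mult_ac)
  also have "\<dots> \<le> (\<Sum>i\<le>N. u i * (exp (\<nu> * (real N * \<Delta>)) * T))"
    using u one by (intro sum_mono mult_left_mono) auto
  also have "\<dots> = (\<Sum>i\<le>N. u i) * exp (\<nu> * (real N * \<Delta>)) * T" by (simp only: sum_distrib_right mult.assoc)
  finally show ?thesis by (simp add: T_def)
qed

text \<open>A discrete Gronwall argument with delay: the increments of e^(\<nu>k\<Delta>) e(N+k) are
  telescoped. The conditions on c1 and c3 say that the damping absorbs the accumulated delayed sums
  of e and of q separately.\<close>

lemma delayed_decay:
  fixes e q u v :: "nat \<Rightarrow> real" and \<nu> \<Delta> c1 c3 :: real
  assumes \<nu>: "0 \<le> \<nu>" and \<Delta>: "0 \<le> \<Delta>" and e: "\<And>j. 0 \<le> e j" and q: "\<And>j. 0 \<le> q j"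
    and u: "\<And>i. 0 \<le> u i" and v: "\<And>i. 0 \<le> v i"
    and rec: "\<And>k. e (N + Suc k) \<le> e (N + k) + \<Delta> * (- c1 * e (N + k) + (\<Sum>i\<le>N. u i * e (k + i))
        - c3 * q (N + k) + (\<Sum>i\<le>N. v i * q (k + i)))"
    and c1: "\<nu> + (\<Sum>i\<le>N. u i) * exp (\<nu> * (real N * \<Delta>)) \<le> c1"
    and c3: "(\<Sum>i\<le>N. v i) * exp (\<nu> * (real N * \<Delta>)) \<le> c3"
  shows "\<exists>C\<ge>0. \<forall>n. e (N + n) \<le> C * exp (- \<nu> * real n * \<Delta>)"
proof -
  define X where "X k = exp (\<nu> * real k * \<Delta>)" for k
  define U where "U = (\<Sum>i\<le>N. u i) * exp (\<nu> * (real N * \<Delta>))"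
  define V where "V = (\<Sum>i\<le>N. v i) * exp (\<nu> * (real N * \<Delta>))"
  have U: "0 \<le> U" unfolding U_def using u by (intro mult_nonneg_nonneg sum_nonneg) auto
  have V: "0 \<le> V" unfolding V_def using v by (intro mult_nonneg_nonneg sum_nonneg) auto
  \<comment> \<open>What survives the cancellation: the starting value and the initial segment,
    which no damping term covers.\<close>
  define C where "C = e N + exp (\<nu> * \<Delta>) * \<Delta> * (U * (\<Sum>j<N. e j) + V * (\<Sum>j<N. q j))"
  have C: "0 \<le> C"
    unfolding C_def using U V e q \<Delta> by (intro add_nonneg_nonneg mult_nonneg_nonneg sum_nonneg) auto
  have incr: "X (Suc k) * e (N + Suc k) - X k * e (N + k)
     \<le> exp (\<nu> * \<Delta>) * \<Delta> * (X k * ((\<nu> - c1) * e (N + k)) + X k * (\<Sum>i\<le>N. u i * e (k + i))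
        - X k * (c3 * q (N + k)) + X k * (\<Sum>i\<le>N. v i * q (k + i)))" for k
  proof -
    have XS: "X (Suc k) = exp (\<nu> * \<Delta>) * X k" unfolding X_def exp_add[symmetric] by (simp add: algebra_simps)
    \<comment> \<open>Equivalent to e^(\<nu>\<Delta>) - 1 \<le> \<nu>\<Delta> e^(\<nu>\<Delta>): the
      growth of the weight is charged at exactly the rate \<nu>, for any step size.\<close>
    have "1 - \<nu> * \<Delta> \<le> exp (- (\<nu> * \<Delta>))" using exp_ge_add_one_self[of "- (\<nu> * \<Delta>)"] by simp
    then have "exp (\<nu> * \<Delta>) * (1 - \<nu> * \<Delta>) \<le> exp (\<nu> * \<Delta>) * exp (- (\<nu> * \<Delta>))" by (intro mult_left_mono) auto
    then have "exp (\<nu> * \<Delta>) * (1 - \<nu> * \<Delta>) \<le> 1" by (simp flip: exp_add)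
    then have "(X k * e (N + k)) * (exp (\<nu> * \<Delta>) * (1 - \<nu> * \<Delta>)) \<le> (X k * e (N + k)) * 1"
      using e by (intro mult_left_mono) (auto simp: X_def)
    moreover have "X (Suc k) * e (N + Suc k) \<le> X (Suc k) * (e (N + k) + \<Delta> * (- c1 * e (N + k) + (\<Sum>i\<le>N. u i * e (k + i))
        - c3 * q (N + k) + (\<Sum>i\<le>N. v i * q (k + i))))"
      by (intro mult_left_mono rec) (simp add: X_def)
    ultimately show ?thesis unfolding XS by (simp add: algebra_simps)
  qed
  have "e (N + n) \<le> C * exp (- \<nu> * real n * \<Delta>)" for n
  proof -
    let ?S = "\<Sum>k<n. X k * e (N + k)" and ?Q = "\<Sum>k<n. X k * q (N + k)"
    have S0: "0 \<le> ?S" "0 \<le> ?Q" using e q by (auto intro!: sum_nonneg simp: X_def)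
    have "X n * e (N + n) - X 0 * e (N + 0) = (\<Sum>k<n. X (Suc k) * e (N + Suc k) - X k * e (N + k))"
      by (rule sum_lessThan_telescope[symmetric])
    also have "\<dots> \<le> (\<Sum>k<n. exp (\<nu> * \<Delta>) * \<Delta> * (X k * ((\<nu> - c1) * e (N + k)) + X k * (\<Sum>i\<le>N. u i * e (k + i))
        - X k * (c3 * q (N + k)) + X k * (\<Sum>i\<le>N. v i * q (k + i))))"
      by (intro sum_mono incr)
    also have "\<dots> = exp (\<nu> * \<Delta>) * \<Delta> * ((\<nu> - c1) * ?S + (\<Sum>k<n. X k * (\<Sum>i\<le>N. u i * e (k + i)))
        - c3 * ?Q + (\<Sum>k<n. X k * (\<Sum>i\<le>N. v i * q (k + i))))"
    proof -
      have "(\<nu> - c1) * ?S = (\<Sum>k<n. X k * ((\<nu> - c1) * e (N + k)))" "c3 * ?Q = (\<Sum>k<n. X k * (c3 * q (N + k)))"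
        by (simp_all add: sum_distrib_left mult_ac)
      then show ?thesis by (simp only: sum_distrib_left[symmetric] sum.distrib sum_subtractf)
    qed
    also have "\<dots> \<le> exp (\<nu> * \<Delta>) * \<Delta> * (U * (\<Sum>j<N. e j) + V * (\<Sum>j<N. q j))"
    proof (rule mult_left_mono)
      have "(\<Sum>k<n. X k * (\<Sum>i\<le>N. u i * e (k + i))) \<le> U * ((\<Sum>j<N. e j) + ?S)"
        unfolding X_def U_def by (rule delayed_sum_le[OF \<nu> \<Delta> e u])
      moreover have "(\<Sum>k<n. X k * (\<Sum>i\<le>N. v i * q (k + i))) \<le> V * ((\<Sum>j<N. q j) + ?Q)"
        unfolding X_def V_def by (rule delayed_sum_le[OF \<nu> \<Delta> q v])
      moreover have "(\<nu> + U) * ?S \<le> c1 * ?S" using c1 S0 unfolding U_def by (intro mult_right_mono)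
      moreover have "V * ?Q \<le> c3 * ?Q" using c3 S0 unfolding V_def by (intro mult_right_mono)
      ultimately show "(\<nu> - c1) * ?S + (\<Sum>k<n. X k * (\<Sum>i\<le>N. u i * e (k + i)))
        - c3 * ?Q + (\<Sum>k<n. X k * (\<Sum>i\<le>N. v i * q (k + i))) \<le> U * (\<Sum>j<N. e j) + V * (\<Sum>j<N. q j)"
        by (simp add: algebra_simps)
    qed (use \<Delta> in auto)
    finally have "X n * e (N + n) \<le> C" by (simp add: C_def X_def)
    then have "exp (- \<nu> * real n * \<Delta>) * (X n * e (N + n)) \<le> exp (- \<nu> * real n * \<Delta>) * C" by (intro mult_left_mono) auto
    moreover have "exp (- \<nu> * real n * \<Delta>) * X n = 1" unfolding X_def exp_add[symmetric] by simp
    then have "exp (- \<nu> * real n * \<Delta>) * (X n * e (N + n)) = e (N + n)" by (metis mult.assoc mult_1)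
    ultimately show ?thesis by (simp only: mult.commute[of C])
  qed
  with C show ?thesis by blast
qed

section \<open>From exponential bounds to limsup rates\<close>

lemma limsup_eln_le:
  fixes a :: "nat \<Rightarrow> real"
  assumes \<Delta>: "0 < \<Delta>" and ev: "\<forall>\<^sub>F k in sequentially. a k \<le> exp (- c * (real k * \<Delta>))"
  shows "limsup (\<lambda>k. ereal (1 / (real k * \<Delta>)) * eln (a k)) \<le> ereal (- c)"
proof (rule Limsup_bounded)
  show "\<forall>\<^sub>F k in sequentially. ereal (1 / (real k * \<Delta>)) * eln (a k) \<le> ereal (- c)"
    using ev eventually_gt_at_top[of 0]
  proof eventually_elim
    case (elim k)
    have k: "0 < real k * \<Delta>" using elim \<Delta> by simp
    show ?case
    proof (cases "a k \<le> 0")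
      case True
      \<comment> \<open>Here \<open>eln\<close> is minus infinity; this covers paths that are
        exactly 0.\<close>
      then show ?thesis using k elim(2) \<Delta> by (simp add: eln_def)
    next
      case False
      then have "ln (a k) \<le> - c * (real k * \<Delta>)" using elim by (metis ln_exp ln_mono not_le exp_gt_zero)
      then have "1 / (real k * \<Delta>) * ln (a k) \<le> - c" using k by (simp add: field_simps)
      then show ?thesis using False by (simp add: eln_def)
    qed
  qed
qed

text \<open>The surplus rate c - c' swallows the constant C.\<close>

lemma exp_decay_faster:
  assumes \<Delta>: "0 < \<Delta>" and c: "c' < c" and a: "\<And>k. a k \<le> C * exp (- c * real k * \<Delta>)"
  shows "\<forall>\<^sub>F k in sequentially. a k \<le> exp (- c' * (real k * \<Delta>))"
proof -
  have "(\<lambda>k. exp (- ((c - c') * \<Delta>)) ^ k) \<longlonglongrightarrow> 0"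
    using \<Delta> c by (intro LIMSEQ_power_zero) auto
  then have "(\<lambda>k. C * exp (- ((c - c') * \<Delta>)) ^ k) \<longlonglongrightarrow> C * 0" by (rule tendsto_mult_left)
  then have "\<forall>\<^sub>F k in sequentially. C * exp (- ((c - c') * \<Delta>)) ^ k < 1" by (intro order_tendstoD(2)) auto
  then show ?thesis
  proof eventually_elim
    case (elim k)
    have "a k \<le> C * exp (- c * real k * \<Delta>)" by (rule a)
    also have "\<dots> = (C * exp (- ((c - c') * \<Delta>)) ^ k) * exp (- c' * (real k * \<Delta>))"
      unfolding mult.assoc exp_of_nat_mult[symmetric] exp_add[symmetric] by (simp add: algebra_simps)
    also have "\<dots> \<le> 1 * exp (- c' * (real k * \<Delta>))" using elim by (intro mult_right_mono) auto
    finally show ?case by simp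
  qed
qed

text \<open>The strict gap between the rates makes the Markov bounds geometric and hence
  summable.\<close>

lemma (in prob_space) AE_eventually_exp_decay:
  fixes Z :: "nat \<Rightarrow> 'a \<Rightarrow> real"
  assumes \<Delta>: "0 < \<Delta>" and c: "c' < c" and Z: "\<And>k. integrable M (Z k)" and Z0: "\<And>k \<omega>. 0 \<le> Z k \<omega>"
    and le: "\<And>k. (\<integral>\<omega>. Z k \<omega> \<partial>M) \<le> C * exp (- c * real k * \<Delta>)"
  shows "AE \<omega> in M. \<forall>\<^sub>F k in sequentially. Z k \<omega> \<le> exp (- c' * (real k * \<Delta>))"
proof -
  have [measurable]: "Z k \<in> borel_measurable M" for k using Z by auto
  define A where "A k = {\<omega> \<in> space M. exp (- c' * (real k * \<Delta>)) \<le> Z k \<omega>}" for k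
  have A: "A k \<in> sets M" for k unfolding A_def by measurable
  have m: "measure M (A k) \<le> C * exp (- ((c - c') * \<Delta>)) ^ k" for k
  proof -
    have "measure M (A k) \<le> (\<integral>\<omega>. Z k \<omega> \<partial>M) / exp (- c' * (real k * \<Delta>))"
      unfolding A_def by (rule integral_Markov_inequality_measure[where A = "{}"]) (use Z Z0 in auto)
    also have "\<dots> \<le> C * exp (- c * real k * \<Delta>) / exp (- c' * (real k * \<Delta>))"
      using le by (intro divide_right_mono) auto
    also have "\<dots> = C * exp (- ((c - c') * \<Delta>)) ^ k"
      unfolding times_divide_eq_right[symmetric] exp_diff[symmetric] exp_of_nat_mult[symmetric] by (simp add: algebra_simps)
    finally show ?thesis .
  qed
  have "summable (\<lambda>k. measure M (A k))"
  proof (rule summable_comparison_test')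
    show "summable (\<lambda>k. C * exp (- ((c - c') * \<Delta>)) ^ k)"
      using \<Delta> c by (intro summable_mult summable_geometric) auto
    show "norm (measure M (A k)) \<le> C * exp (- ((c - c') * \<Delta>)) ^ k" if "0 \<le> k" for k using m by simp
  qed
  then have "AE \<omega> in M. \<forall>\<^sub>F k in sequentially. \<omega> \<in> space M - A k"
    using A by (intro borel_cantelli_AE1) (auto simp: emeasure_eq_measure)
  then show ?thesis
  proof (rule AE_mp, intro AE_I2 impI)
    fix \<omega> assume "\<forall>\<^sub>F k in sequentially. \<omega> \<in> space M - A k"
    then show "\<forall>\<^sub>F k in sequentially. Z k \<omega> \<le> exp (- c' * (real k * \<Delta>))"
      by (rule eventually_mono) (auto simp: A_def)
  qed
qed

section \<open>Exponential decay of the moments\<close>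

context dissipative_sfde
begin

text \<open>Sorts the bound by lag, as the delay inequality requires. Of the total p/2 b2, Young's
  inequality leaves the share b2 on the delayed moments and puts (p-2)/2 b2 on the current
  one.\<close>

lemma step_bound_eq:
  "step_bound \<epsilon> \<Delta> N h m = norm (h (m + N)) powr p + \<Delta> * (- (p / 2 * b1 - (p - 2) / 2 * b2 - \<epsilon>) * norm (h (m + N)) powr p
      + (\<Sum>i\<le>N. ((b2 + \<epsilon>) * hatw \<Delta> N \<rho>3 i + \<epsilon> * hatw \<Delta> N (\<lambda>_. 1 / (real N * \<Delta>)) i) * norm (h (m + i)) powr p)
      - (p / 2 * b3 - p / 2 * b4 * ((p - 2) / (p + vrho)) - \<epsilon>) * norm (h (m + N)) powr (p + vrho)
      + (\<Sum>i\<le>N. ((p / 2 * b4 * ((2 + vrho) / (p + vrho)) + \<epsilon>) * hatw \<Delta> N \<rho>4 i) * norm (h (m + i)) powr (p + vrho)))"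
proof -
  have s1: "(\<Sum>i\<le>N. ((b2 + \<epsilon>) * w1 i + \<epsilon> * w2 i) * z i) = (b2 + \<epsilon>) * (\<Sum>i\<le>N. w1 i * z i) + \<epsilon> * (\<Sum>i\<le>N. w2 i * z i)"
    for w1 w2 z :: "nat \<Rightarrow> real"
    by (simp add: distrib_right sum.distrib sum_distrib_left mult.assoc)
  have s2: "(\<Sum>i\<le>N. (c * w1 i) * z i) = c * (\<Sum>i\<le>N. w1 i * z i)" for c and w1 z :: "nat \<Rightarrow> real"
    by (simp add: sum_distrib_left mult.assoc)
  have r: "p / 2 * (- b1 * P + b2 * ((p - 2) / p * P + 2 / p * Pa) - b3 * Q + b4 * (x1 * Q + x2 * Qb)) + \<epsilon> * (P + Pa + Pc + Q + Qb)
    = - (p / 2 * b1 - (p - 2) / 2 * b2 - \<epsilon>) * P + ((b2 + \<epsilon>) * Pa + \<epsilon> * Pc) - (p / 2 * b3 - p / 2 * b4 * x1 - \<epsilon>) * Q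
      + (p / 2 * b4 * x2 + \<epsilon>) * Qb" for P Pa Pc Q Qb x1 x2
    using p by (simp add: field_simps)
  show ?thesis
    unfolding step_bound_def Let_def s1 s2 r ..
qed

lemma moment_decay:
  fixes B :: "real \<Rightarrow> 'w \<Rightarrow> real^'d" and M :: "'w measure" and \<xi> :: "real \<Rightarrow> real^'n"
  assumes BM: "std_BM M B" and lam: "0 < lam" "lam < 1/2" and K: "0 \<le> K"
    and nu: "\<nu> > 0" "p / 2 * (b1 - b2 * exp (\<nu> * \<tau>)) - \<nu> > 0" "b3 - b4 * exp (\<nu> * \<tau>) > 0"
  obtains \<delta> where "0 < \<delta>" "\<delta> \<le> 1" "\<And>N \<Delta> r. 0 < \<Delta> \<Longrightarrow> \<Delta> \<le> \<delta> \<Longrightarrow> 1 \<le> N \<Longrightarrow> \<tau> = real N * \<Delta> \<Longrightarrow> 1 \<le> r \<Longrightarrow>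
    \<Gamma> r = K * \<Delta> powr (- lam) \<Longrightarrow>
    (\<forall>k. integrable M (\<lambda>\<omega>. norm (tem_Y \<Delta> N r f g \<xi> (\<lambda>t. B t \<omega>) k) powr p)) \<and>
    (\<exists>C\<ge>0. \<forall>k. (\<integral>\<omega>. norm (tem_Y \<Delta> N r f g \<xi> (\<lambda>t. B t \<omega>) k) powr p \<partial>M) \<le> C * exp (- \<nu> * real k * \<Delta>))"
proof -
  interpret prob_space M using BM by (simp add: std_BM_def)
  define E where "E = exp (\<nu> * \<tau>)"
  have E: "1 \<le> E" using nu tau by (simp add: E_def)
  define g1 where "g1 = p / 2 * (b1 - b2 * E) - \<nu>"
  define g2 where "g2 = p / 2 * (b3 - b4 * E)"
  have g: "0 < g1" "0 < g2" using nu p by (auto simp: g1_def g2_def E_def)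
  \<comment> \<open>At order p the errors weaken the damping by \<epsilon> and add 2\<epsilon> of
    delayed mass, amplified by E; this must fit into the reserve g1. At order p +
    \<open>vrho\<close> the cost is \<epsilon>(E + 1), to be met by g2.\<close>
  define \<epsilon> where "\<epsilon> = min (g1 / (2 * E + 1)) (g2 / (E + 1))"
  have eps: "0 < \<epsilon>" using g E by (simp add: \<epsilon>_def)
  have "\<epsilon> * (2 * E + 1) \<le> g1 / (2 * E + 1) * (2 * E + 1)" "\<epsilon> * (E + 1) \<le> g2 / (E + 1) * (E + 1)"
    using E by (intro mult_right_mono; simp add: \<epsilon>_def)+
  then have epsg: "\<epsilon> * (2 * E + 1) \<le> g1" "\<epsilon> * (E + 1) \<le> g2" using E by auto
  define c1 where "c1 = p / 2 * b1 - (p - 2) / 2 * b2 - \<epsilon>"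
  define c3 where "c3 = p / 2 * b3 - p / 2 * b4 * ((p - 2) / (p + vrho)) - \<epsilon>"
  define V where "V = p / 2 * b4 * ((2 + vrho) / (p + vrho)) + \<epsilon>"
  have c1: "\<nu> + (b2 + 2 * \<epsilon>) * E \<le> c1"
  proof -
    \<comment> \<open>As E \<ge> 1, the undelayed share may be charged with the factor E as well,
      which restores the full p/2 b2 E of the hypothesis on \<nu>.\<close>
    have "(p - 2) / 2 * b2 * 1 \<le> (p - 2) / 2 * b2 * E" using p b E by (intro mult_left_mono) auto
    then have "b2 * E + (p - 2) / 2 * b2 \<le> p / 2 * (b2 * E)" by (simp add: field_simps)
    then show ?thesis using epsg(1) unfolding g1_def c1_def by (simp add: algebra_simps)
  qed
  have c3: "V * E \<le> c3"
  proof -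
    define t where "t = (p - 2) / (p + vrho)"
    have t: "0 \<le> t" "(2 + vrho) / (p + vrho) = 1 - t" using p rho by (auto simp: t_def field_simps)
    have "p / 2 * b4 * t * 1 \<le> p / 2 * b4 * t * E" using p b E t by (intro mult_left_mono) auto
    moreover have "p / 2 * b4 * (1 - t) * E + p / 2 * b4 * t * E = p / 2 * (b4 * E)" by (simp add: field_simps)
    ultimately have "p / 2 * b4 * (1 - t) * E + p / 2 * b4 * t \<le> p / 2 * (b4 * E)" by linarith
    then show ?thesis using epsg(2) unfolding g2_def c3_def V_def t(2) t_def[symmetric] by (simp add: algebra_simps)
  qed
  have V: "0 \<le> V" using p b rho eps by (simp add: V_def)
  have mc: "0 \<le> gauss_const CARD('d) j" for j by (simp add: gauss_const_def)
  have "\<exists>\<delta>. 0 < \<delta> \<and> \<delta> \<le> 1 \<and> (\<forall>(M :: 'w measure) (W :: 'w \<Rightarrow> real^'d). step_valid \<epsilon> K lam (gauss_const CARD('d)) \<delta> M W)"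
  proof (cases "p = 2")
    case True
    then show ?thesis by (rule step_inequality_eq2[OF _ lam K eps])
  next
    case False
    then show ?thesis using p by (intro step_inequality_gt2[OF _ lam K eps mc]) auto
  qed
  then obtain \<delta> where d: "0 < \<delta>" "\<delta> \<le> 1"
    and step: "\<And>(M :: 'w measure) (W :: 'w \<Rightarrow> real^'d). step_valid \<epsilon> K lam (gauss_const CARD('d)) \<delta> M W" by blast
  show ?thesis
  proof (rule that[OF d])
    fix N \<Delta> r
    assume \<Delta>: "0 < \<Delta>" "\<Delta> \<le> \<delta>" and N: "1 \<le> N" and grid: "\<tau> = real N * \<Delta>" and r: "1 \<le> r" and \<Gamma>r: "\<Gamma> r = K * \<Delta> powr (- lam)"
    let ?I = "\<lambda>m. {..<m} \<times> (UNIV :: 'd set)"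
    define D where "D = (\<lambda>k \<omega>. B (real (Suc k) * \<Delta>) \<omega> - B (real k * \<Delta>) \<omega>)"
    define X where "X = (\<lambda>\<omega> ic. case ic of (i, c) \<Rightarrow> D i \<omega> $ c)"
    define H where "H = (\<lambda>m \<omega>. tem_hist \<Delta> N r f g \<xi> (\<lambda>t. B t \<omega>) m)"
    \<comment> \<open>Entry j is already final after j steps, because j \<le> N + j. One sequence
      thus covers the initial data and the scheme.\<close>
    define U where "U = (\<lambda>j \<omega>. H j \<omega> j)"
    have r0: "0 \<le> r" using r by simp
    have indX: "indep_vars (\<lambda>_. borel) (\<lambda>ic \<omega>. X \<omega> ic) (?I n)" for n
      using std_BM_increments(1)[OF BM \<Delta>(1), of n] by (simp add: X_def D_def case_prod_unfold)
    have incD: "sym_incr M (D k) \<Delta> (gauss_const CARD('d))" for k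
      using std_BM_increments(2)[OF BM \<Delta>(1)] by (simp add: D_def)
    have "\<exists>\<Phi>. \<Phi> \<in> measurable (\<Pi>\<^sub>M i\<in>?I m. borel) borel \<and> (\<forall>\<omega>. H m \<omega> = \<Phi> (restrict (X \<omega>) (?I m)))" for m
      using tem_hist_measurable[OF continuous_fg_seg[OF \<Delta>(1) N grid], where B = B]
      unfolding H_def X_def D_def .
    then obtain \<Phi> where \<Phi>: "\<And>m. \<Phi> m \<in> measurable (\<Pi>\<^sub>M i\<in>?I m. borel) borel"
      and H\<Phi>: "\<And>m \<omega>. H m \<omega> = \<Phi> m (restrict (X \<omega>) (?I m))" by metis
    have Xm: "(\<lambda>\<omega>. restrict (X \<omega>) (?I m)) \<in> measurable M (\<Pi>\<^sub>M i\<in>?I m. borel)" for m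
      using indX[of m] by (intro measurable_restrict) (auto simp: indep_vars_def)
    have Hm: "H m \<in> borel_measurable M" for m
      using measurable_compose[OF Xm \<Phi>] by (simp add: H\<Phi>[abs_def])
    have Hj: "(\<lambda>\<omega>. H m \<omega> j) \<in> borel_measurable M" for m j
      using measurable_compose[OF Hm measurable_product_coordinates] .
    have [measurable]: "U j \<in> borel_measurable M" for j
      using Hj[of j j] by (simp add: U_def)
    have Hr: "norm (H m \<omega> j) \<le> r" for m \<omega> j unfolding H_def using r0 by (rule norm_tem_hist_le)
    have HU: "H k \<omega> j = U j \<omega>" if "j \<le> N + k" for k j \<omega>
    proof (cases "j \<le> k")
      case True
      then show ?thesis unfolding U_def H_def using tem_hist_stable[of j N j \<Delta> r f g \<xi> _ "k - j"] by simp
    next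
      case False
      then show ?thesis unfolding U_def H_def using tem_hist_stable[of j N k \<Delta> r f g \<xi> _ "j - k"] that by simp
    qed
    have Ur: "norm (U j \<omega>) \<le> r" for j \<omega> by (simp add: U_def Hr)
    \<comment> \<open>Truncation bounds every iterate by r, so all moments are finite without an a
      priori estimate.\<close>
    have int: "integrable M (\<lambda>\<omega>. norm (U j \<omega>) powr s)" if "0 \<le> s" for j s
      by (rule integrable_const_bound[of _ "r powr s"]) (use that Ur in \<open>auto intro!: AE_I2 powr_mono2\<close>)
    have p0: "0 \<le> p" "0 \<le> p + vrho" using p rho by auto
    define e where "e = (\<lambda>j. \<integral>\<omega>. norm (U j \<omega>) powr p \<partial>M)"
    define q where "q = (\<lambda>j. \<integral>\<omega>. norm (U j \<omega>) powr (p + vrho) \<partial>M)"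
    define u where "u = (\<lambda>i. (b2 + \<epsilon>) * hatw \<Delta> N \<rho>3 i + \<epsilon> * hatw \<Delta> N (\<lambda>_. 1 / (real N * \<Delta>)) i)"
    define v where "v = (\<lambda>i. V * hatw \<Delta> N \<rho>4 i)"
    note wn = w_nonneg[OF \<Delta>(1) N grid] and ws = w_sum[OF \<Delta>(1) N grid]
    have sb: "step_bound \<epsilon> \<Delta> N (H k \<omega>) k = norm (U (N + k) \<omega>) powr p + \<Delta> * (- c1 * norm (U (N + k) \<omega>) powr p
        + (\<Sum>i\<le>N. u i * norm (U (k + i) \<omega>) powr p) - c3 * norm (U (N + k) \<omega>) powr (p + vrho)
        + (\<Sum>i\<le>N. v i * norm (U (k + i) \<omega>) powr (p + vrho)))" for k \<omega>
      unfolding step_bound_eq c1_def c3_def u_def v_def V_def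
      by (simp add: HU add.commute[of k N])
    have isb: "integrable M (\<lambda>\<omega>. step_bound \<epsilon> \<Delta> N (H k \<omega>) k)" for k
      unfolding sb using p0 by (intro Bochner_Integration.integrable_add Bochner_Integration.integrable_diff integrable_mult_right
        Bochner_Integration.integrable_sum int)
    have esb: "(\<integral>\<omega>. step_bound \<epsilon> \<Delta> N (H k \<omega>) k \<partial>M) = e (N + k) + \<Delta> * (- c1 * e (N + k) + (\<Sum>i\<le>N. u i * e (k + i))
        - c3 * q (N + k) + (\<Sum>i\<le>N. v i * q (k + i)))" for k
      unfolding sb e_def q_def using int[OF p0(1)] int[OF p0(2)] by simp
    have rec: "e (N + Suc k) \<le> e (N + k) + \<Delta> * (- c1 * e (N + k) + (\<Sum>i\<le>N. u i * e (k + i))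
        - c3 * q (N + k) + (\<Sum>i\<le>N. v i * q (k + i)))" for k
    proof -
      let ?S = "\<Pi>\<^sub>M i\<in>?I k. (borel :: real measure)" and ?J = "{k} \<times> (UNIV :: 'd set)"
      let ?T = "\<Pi>\<^sub>M i\<in>?J. (borel :: real measure)"
      define val where "val = (\<lambda>h (d :: real^'d). h (N + k) + \<Delta> *\<^sub>R f (seg \<Delta> h (N + k)) + g (seg \<Delta> h (N + k)) *v d)"
      define F where "F = (\<lambda>x z. norm (Lam r (val (\<Phi> k x) (\<chi> c. z (k, c)))) powr p)"
      have ind: "indep_var ?S (\<lambda>\<omega>. restrict (X \<omega>) (?I k)) ?T (\<lambda>\<omega>. restrict (X \<omega>) ?J)"
        by (rule indep_var_restrict[OF indX[of "Suc k"]]) auto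
      have Y: "(\<chi> c. X \<omega> (k, c)) = D k \<omega>" for \<omega>
        by (simp add: X_def vec_eq_iff)
      have \<Phi>1: "(\<lambda>z. \<Phi> k (fst z)) \<in> borel_measurable (?S \<Otimes>\<^sub>M ?T)"
        by (rule measurable_compose[OF measurable_fst \<Phi>])
      have new: "(\<lambda>z. (\<chi> c. snd z (k, c)) :: real^'d) \<in> borel_measurable (?S \<Otimes>\<^sub>M ?T)"
      proof (rule borel_measurable_vec_componentwise)
        fix c
        have "(\<lambda>z. z (k, c)) \<in> borel_measurable ?T" by (rule measurable_component_singleton) simp
        from measurable_compose[OF measurable_snd this]
        show "(\<lambda>z. (\<chi> c. snd z (k, c)) $ c) \<in> borel_measurable (?S \<Otimes>\<^sub>M ?T)" by simp
      qed
      have "(\<lambda>z. val (\<Phi> k (fst z)) (\<chi> c. snd z (k, c))) \<in> borel_measurable (?S \<Otimes>\<^sub>M ?T)"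
        unfolding val_def
        by (intro borel_measurable_add borel_measurable_scaleR borel_measurable_const
            measurable_compose[OF \<Phi>1 measurable_product_coordinates]
            borel_measurable_matrix_vector_mult new
            borel_measurable_continuous_on[OF continuous_fg_seg(1)[OF \<Delta>(1) N grid] \<Phi>1]
            borel_measurable_continuous_on[OF continuous_fg_seg(2)[OF \<Delta>(1) N grid] \<Phi>1])
      then have "(\<lambda>z. norm (Lam r (val (\<Phi> k (fst z)) (\<chi> c. snd z (k, c)))) powr p) \<in> borel_measurable (?S \<Otimes>\<^sub>M ?T)"
        by measurable
      then have F: "case_prod F \<in> borel_measurable (?S \<Otimes>\<^sub>M ?T)"
        by (simp add: F_def case_prod_unfold)
      have "(\<integral>\<omega>. F (restrict (X \<omega>) (?I k)) (restrict (X \<omega>) ?J) \<partial>M) \<le> (\<integral>\<omega>. step_bound \<epsilon> \<Delta> N (H k \<omega>) k \<partial>M)"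
      proof (rule expectation_le_of_indep[OF ind F _ _ _ isb])
        fix \<omega> assume "\<omega> \<in> space M"
        have FH: "F (restrict (X \<omega>) (?I k)) (restrict (X \<omega>') ?J) = norm (Lam r (val (H k \<omega>) (D k \<omega>'))) powr p" for \<omega>'
          by (simp add: F_def Y H\<Phi>)
        have vm: "(\<lambda>\<omega>'. val (H k \<omega>) (D k \<omega>')) \<in> borel_measurable M"
          unfolding val_def by (intro borel_measurable_add borel_measurable_const sym_incr_mult_meas[OF incD])
        \<comment> \<open>Truncation never increases the norm, so the bound for the untruncated step
          carries over.\<close>
        have le: "norm (Lam r (val (H k \<omega>) (D k \<omega>'))) powr p \<le> norm (val (H k \<omega>) (D k \<omega>')) powr p" for \<omega>'
          using p r0 by (intro powr_mono2 norm_Lam_le_norm) auto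
        have iv: "integrable M (\<lambda>\<omega>'. norm (val (H k \<omega>) (D k \<omega>')) powr p)"
          unfolding val_def by (rule sym_incr_integrable_powr[OF incD p0(1)])
        have il: "integrable M (\<lambda>\<omega>'. norm (Lam r (val (H k \<omega>) (D k \<omega>'))) powr p)"
        proof (rule Bochner_Integration.integrable_bound[OF iv])
          show "(\<lambda>\<omega>'. norm (Lam r (val (H k \<omega>) (D k \<omega>'))) powr p) \<in> borel_measurable M"
            using vm by measurable
        qed (use le in \<open>auto intro!: AE_I2\<close>)
        then show "integrable M (\<lambda>\<omega>'. F (restrict (X \<omega>) (?I k)) (restrict (X \<omega>') ?J))" unfolding FH .
        have "(\<integral>\<omega>'. norm (Lam r (val (H k \<omega>) (D k \<omega>'))) powr p \<partial>M) \<le> (\<integral>\<omega>'. norm (val (H k \<omega>) (D k \<omega>')) powr p \<partial>M)"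
          by (intro integral_mono il iv le)
        also have "\<dots> \<le> step_bound \<epsilon> \<Delta> N (H k \<omega>) k"
          unfolding val_def by (rule step[unfolded step_valid_def, rule_format, OF \<Delta> N grid r \<Gamma>r Hr incD])
        finally show "(\<integral>\<omega>'. F (restrict (X \<omega>) (?I k)) (restrict (X \<omega>') ?J) \<partial>M) \<le> step_bound \<epsilon> \<Delta> N (H k \<omega>) k"
          unfolding FH .
      qed (simp add: F_def)
      also have "(\<lambda>\<omega>. F (restrict (X \<omega>) (?I k)) (restrict (X \<omega>) ?J)) = (\<lambda>\<omega>. norm (U (N + Suc k) \<omega>) powr p)"
      proof
        fix \<omega>
        have "U (N + Suc k) \<omega> = H (Suc k) \<omega> (N + Suc k)" by (rule HU[symmetric]) simp
        also have "\<dots> = Lam r (val (H k \<omega>) (D k \<omega>))"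
          by (simp add: H_def val_def D_def Let_def)
        finally show "F (restrict (X \<omega>) (?I k)) (restrict (X \<omega>) ?J) = norm (U (N + Suc k) \<omega>) powr p"
          by (simp add: F_def Y H\<Phi>)
      qed
      finally show ?thesis unfolding esb unfolding e_def .
    qed
    have "\<exists>C\<ge>0. \<forall>n. e (N + n) \<le> C * exp (- \<nu> * real n * \<Delta>)"
    proof (rule delayed_decay[OF _ _ _ _ _ _ rec])
      show "0 \<le> u i" for i using wn b eps by (simp add: u_def)
      show "0 \<le> v i" for i using wn V by (simp add: v_def)
      have "(\<Sum>i\<le>N. u i) = b2 + 2 * \<epsilon>"
        unfolding u_def sum.distrib sum_distrib_left[symmetric] ws by simp
      then show "\<nu> + (\<Sum>i\<le>N. u i) * exp (\<nu> * (real N * \<Delta>)) \<le> c1" using c1 by (simp add: E_def grid)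
      have "(\<Sum>i\<le>N. v i) = V" unfolding v_def sum_distrib_left[symmetric] ws by simp
      then show "(\<Sum>i\<le>N. v i) * exp (\<nu> * (real N * \<Delta>)) \<le> c3" using c3 by (simp add: E_def grid)
    qed (use nu \<Delta> in \<open>auto simp: e_def q_def\<close>)
    moreover have "tem_Y \<Delta> N r f g \<xi> (\<lambda>t. B t \<omega>) k = U (N + k) \<omega>" for k \<omega>
      using HU[of "N + k" k \<omega>] by (simp add: tem_Y_def H_def)
    ultimately show "(\<forall>k. integrable M (\<lambda>\<omega>. norm (tem_Y \<Delta> N r f g \<xi> (\<lambda>t. B t \<omega>) k) powr p)) \<and>
      (\<exists>C\<ge>0. \<forall>k. (\<integral>\<omega>. norm (tem_Y \<Delta> N r f g \<xi> (\<lambda>t. B t \<omega>) k) powr p \<partial>M) \<le> C * exp (- \<nu> * real k * \<Delta>))"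
      using int[OF p0(1)] by (simp add: e_def)
  qed
qed

end

section \<open>Exponential stability\<close>

text \<open>The intermediate value theorem shows that \<Gamma> attains every value above
  \<Gamma>(1), so the inverse in the truncation radius is genuine there.\<close>

lemma the_inv_into_radius:
  fixes \<Gamma> :: "real \<Rightarrow> real"
  assumes mono: "strict_mono_on {1..} \<Gamma>" and cont: "continuous_on {1..} \<Gamma>" and lim: "filterlim \<Gamma> at_top at_top"
    and v: "\<Gamma> 1 \<le> v"
  shows "1 \<le> the_inv_into {1..} \<Gamma> v" "\<Gamma> (the_inv_into {1..} \<Gamma> v) = v"
proof -
  have inj: "inj_on \<Gamma> {1..}" using mono by (rule strict_mono_on_imp_inj_on)
  have "\<forall>\<^sub>F x in at_top. v \<le> \<Gamma> x \<and> 1 \<le> x"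
    using lim eventually_ge_at_top[of "1::real"] by (auto simp: filterlim_at_top eventually_conj_iff)
  then obtain x where x: "v \<le> \<Gamma> x" "1 \<le> x" using eventually_happens[of _ at_top] by force
  have "\<exists>l\<ge>1. l \<le> x \<and> \<Gamma> l = v"
    by (rule IVT') (use x v cont in \<open>auto intro: continuous_on_subset\<close>)
  then have im: "v \<in> \<Gamma> ` {1..}" by auto
  show "\<Gamma> (the_inv_into {1..} \<Gamma> v) = v" by (rule f_the_inv_into_f[OF inj im])
  show "1 \<le> the_inv_into {1..} \<Gamma> v" using the_inv_into_into[OF inj im order_refl] by simp
qed

theorem theorem4p2:
  fixes \<tau> :: real
    and f :: "(real \<Rightarrow> real^'n) \<Rightarrow> real^'n"
    and g :: "(real \<Rightarrow> real^'n) \<Rightarrow> real^'d^'n"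
    and M :: "'w measure" and B :: "real \<Rightarrow> 'w \<Rightarrow> real^'d"
    and \<xi> :: "real \<Rightarrow> real^'n"
    and p vrho b1 b2 b3 b4 :: real and \<rho>3 \<rho>4 :: "real \<Rightarrow> real"
    and \<Gamma> :: "real \<Rightarrow> real" and lam \<nu> \<nu>1 :: real
  assumes tau: "\<tau> > 0"
    and BM: "std_BM M B"
    and f0: "f (\<lambda>_. 0) = 0" and g0: "g (\<lambda>_. 0) = 0"
    and xi: "in_C \<tau> \<xi>"
    and A1: "\<forall>ell>0. \<exists>R>0. \<forall>\<phi> \<psi>. in_C \<tau> \<phi> \<and> in_C \<tau> \<psi> \<and> supn \<tau> \<phi> \<le> ell \<and> supn \<tau> \<psi> \<le> ell \<longrightarrow>
             max (norm (f \<phi> - f \<psi>)) (norm (g \<phi> - g \<psi>))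
               \<le> R * (norm (\<phi> 0 - \<psi> 0) + (1/\<tau>) * integral {-\<tau>..0} (\<lambda>\<theta>. norm (\<phi> \<theta> - \<psi> \<theta>)))"
    and p: "p \<ge> 2" and rho: "vrho > 0"
    and b: "b1 > 0" "b2 > 0" "b3 > 0" "b4 > 0" "b1 > b2" "b3 > b4"
    and w: "weight \<tau> \<rho>3" "weight \<tau> \<rho>4"
    and A2: "\<forall>\<phi>. in_C \<tau> \<phi> \<longrightarrow>
             2 * (\<phi> 0 \<bullet> f \<phi>) + (p - 1) * (norm (g \<phi>))\<^sup>2
               \<le> - b1 * (norm (\<phi> 0))\<^sup>2 + b2 * integral {-\<tau>..0} (\<lambda>\<theta>. (norm (\<phi> \<theta>))\<^sup>2 * \<rho>3 \<theta>)
                 - b3 * norm (\<phi> 0) powr (2 + vrho)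
                 + b4 * integral {-\<tau>..0} (\<lambda>\<theta>. norm (\<phi> \<theta>) powr (2 + vrho) * \<rho>4 \<theta>)"
    and Gamma: "strict_mono_on {1..} \<Gamma>" "continuous_on {1..} \<Gamma>" "\<forall>l\<ge>1. \<Gamma> l \<ge> 0"
      "filterlim \<Gamma> at_top at_top"
      "\<forall>l\<ge>1. \<forall>\<phi> \<psi>. in_C \<tau> \<phi> \<and> in_C \<tau> \<psi> \<and> supn \<tau> \<phi> \<le> l \<and> supn \<tau> \<psi> \<le> l
              \<and> (\<exists>\<theta>\<in>{-\<tau>..0}. \<phi> \<theta> \<noteq> \<psi> \<theta>) \<longrightarrow>
             norm (f \<phi> - f \<psi>) / sqrt (Psi \<tau> \<phi> \<psi>) \<le> \<Gamma> l
           \<and> (norm (g \<phi> - g \<psi>))\<^sup>2 / Psi \<tau> \<phi> \<psi> \<le> \<Gamma> l"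
    and lam: "0 < lam" "lam < 1/2"
    and nu: "\<nu> > 0" "p / 2 * (b1 - b2 * exp (\<nu> * \<tau>)) - \<nu> > 0" "b3 - b4 * exp (\<nu> * \<tau>) > 0"
    and nu1: "0 < \<nu>1" "\<nu>1 < \<nu>"
  shows "\<exists>\<Delta>h. 0 < \<Delta>h \<and> \<Delta>h \<le> 1 \<and>
    (\<forall>N::nat. real N \<ge> \<tau> \<and> \<tau> / real N \<le> \<Delta>h \<longrightarrow>
      (let \<Delta> = \<tau> / real N;
           K = max (\<Gamma> 1) (max (norm (f (\<lambda>_. 0))) ((norm (g (\<lambda>_. 0)))\<^sup>2));
           r = the_inv_into {1..} \<Gamma> (K * \<Delta> powr (- lam));
           Y = (\<lambda>k \<omega>. tem_Y \<Delta> N r f g \<xi> (\<lambda>t. B t \<omega>) k)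
       in limsup (\<lambda>k. ereal (1 / (real k * \<Delta>)) * eln (\<integral>\<omega>. norm (Y k \<omega>) powr p \<partial>M))
            \<le> ereal (- \<nu>1)
        \<and> (AE \<omega> in M. limsup (\<lambda>k. ereal (1 / (real k * \<Delta>)) * eln (norm (Y k \<omega>)))
            \<le> ereal (- \<nu>1 / p))))"
proof -
  interpret prob_space M using BM by (simp add: std_BM_def)
  have Lip: "locally_Lipschitz_C \<tau> f" "locally_Lipschitz_C \<tau> g"
  proof -
    let ?D = "\<lambda>\<phi> \<psi>. norm (\<phi> 0 - \<psi> 0) + (1/\<tau>) * integral {-\<tau>..0} (\<lambda>\<theta>. norm (\<phi> \<theta> - \<psi> \<theta> :: real^'n))"
    have "\<exists>R>0. (\<forall>\<phi> \<psi>. in_C \<tau> \<phi> \<and> in_C \<tau> \<psi> \<and> supn \<tau> \<phi> \<le> ell \<and> supn \<tau> \<psi> \<le> ell \<longrightarrow> norm (f \<phi> - f \<psi>) \<le> R * ?D \<phi> \<psi>)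
        \<and> (\<forall>\<phi> \<psi>. in_C \<tau> \<phi> \<and> in_C \<tau> \<psi> \<and> supn \<tau> \<phi> \<le> ell \<and> supn \<tau> \<psi> \<le> ell \<longrightarrow> norm (g \<phi> - g \<psi>) \<le> R * ?D \<phi> \<psi>)"
      if "ell > 0" for ell
    proof -
      obtain R where R: "R > 0" "\<forall>\<phi> \<psi>. in_C \<tau> \<phi> \<and> in_C \<tau> \<psi> \<and> supn \<tau> \<phi> \<le> ell \<and> supn \<tau> \<psi> \<le> ell \<longrightarrow>
          max (norm (f \<phi> - f \<psi>)) (norm (g \<phi> - g \<psi>)) \<le> R * ?D \<phi> \<psi>"
        using A1 \<open>ell > 0\<close> by blast
      show ?thesis
        by (rule exI[of _ R]) (use R in \<open>simp only: max.bounded_iff simp_thms\<close>, blast)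
    qed
    then show "locally_Lipschitz_C \<tau> f" "locally_Lipschitz_C \<tau> g"
      unfolding locally_Lipschitz_C_def by meson+
  qed
  have \<Gamma>f: "\<forall>l\<ge>1. \<forall>\<phi> \<psi>. in_C \<tau> \<phi> \<and> in_C \<tau> \<psi> \<and> supn \<tau> \<phi> \<le> l \<and> supn \<tau> \<psi> \<le> l
      \<and> (\<exists>\<theta>\<in>{-\<tau>..0}. \<phi> \<theta> \<noteq> \<psi> \<theta>) \<longrightarrow> norm (f \<phi> - f \<psi>) / sqrt (Psi \<tau> \<phi> \<psi>) \<le> \<Gamma> l"
    using Gamma(5) by blast
  interpret dissipative_sfde \<tau> f g p vrho b1 b2 b3 b4 \<rho>3 \<rho>4 \<Gamma>
    by unfold_locales (fact tau f0 Lip p rho b density_on_weight[OF w(1)] density_on_weight[OF w(2)] A2 Gamma(3) \<Gamma>f)+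
  define K where "K = max (\<Gamma> 1) (max (norm (f (\<lambda>_. 0))) ((norm (g (\<lambda>_. 0)))\<^sup>2))"
  have K: "K = \<Gamma> 1" "0 \<le> K" using Gamma(3) by (auto simp: K_def f0 g0)
  obtain \<delta> where d: "0 < \<delta>" "\<delta> \<le> 1" and decay: "\<And>N \<Delta> r. 0 < \<Delta> \<Longrightarrow> \<Delta> \<le> \<delta> \<Longrightarrow> 1 \<le> N \<Longrightarrow> \<tau> = real N * \<Delta> \<Longrightarrow> 1 \<le> r \<Longrightarrow>
    \<Gamma> r = K * \<Delta> powr (- lam) \<Longrightarrow>
    (\<forall>k. integrable M (\<lambda>\<omega>. norm (tem_Y \<Delta> N r f g \<xi> (\<lambda>t. B t \<omega>) k) powr p)) \<and>
    (\<exists>C\<ge>0. \<forall>k. (\<integral>\<omega>. norm (tem_Y \<Delta> N r f g \<xi> (\<lambda>t. B t \<omega>) k) powr p \<partial>M) \<le> C * exp (- \<nu> * real k * \<Delta>))"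
    by (fact moment_decay[OF BM lam K(2) nu])
  have main: "limsup (\<lambda>k. ereal (1 / (real k * \<Delta>)) * eln (\<integral>\<omega>. norm (tem_Y \<Delta> N r f g \<xi> (\<lambda>t. B t \<omega>) k) powr p \<partial>M))
            \<le> ereal (- \<nu>1)
        \<and> (AE \<omega> in M. limsup (\<lambda>k. ereal (1 / (real k * \<Delta>)) * eln (norm (tem_Y \<Delta> N r f g \<xi> (\<lambda>t. B t \<omega>) k)))
            \<le> ereal (- \<nu>1 / p))"
    if N: "\<tau> \<le> real N" "\<tau> / real N \<le> \<delta>" and \<Delta>_def: "\<Delta> = \<tau> / real N"
      and r_def: "r = the_inv_into {1..} \<Gamma> (K * \<Delta> powr (- lam))" for N \<Delta> r
  proof -
    let ?Y = "\<lambda>k \<omega>. tem_Y \<Delta> N r f g \<xi> (\<lambda>t. B t \<omega>) k"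
    have N1: "1 \<le> N" using N tau by (cases N) auto
    have \<Delta>: "0 < \<Delta>" "\<Delta> \<le> \<delta>" "\<tau> = real N * \<Delta>" using N N1 tau by (auto simp: \<Delta>_def)
    \<comment> \<open>With K = \<Gamma>(1) and \<Delta> \<le> 1, the argument of the inverse lies in
      the range of \<Gamma>.\<close>
    have "1 \<le> \<Delta> powr (- lam)"
      using \<Delta> d lam powr_mono'[of "- lam" 0 \<Delta>] by simp
    then have "K * 1 \<le> K * \<Delta> powr (- lam)" using K by (intro mult_left_mono) auto
    then have v: "\<Gamma> 1 \<le> K * \<Delta> powr (- lam)" using K by simp
    note r = the_inv_into_radius[OF Gamma(1,2,4) v, folded r_def]
    obtain C where int: "\<And>k. integrable M (\<lambda>\<omega>. norm (?Y k \<omega>) powr p)"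
      and C: "\<And>k. (\<integral>\<omega>. norm (?Y k \<omega>) powr p \<partial>M) \<le> C * exp (- \<nu> * real k * \<Delta>)"
      using decay[OF \<Delta>(1,2) N1 \<Delta>(3) r] by blast
    have "AE \<omega> in M. \<forall>\<^sub>F k in sequentially. norm (?Y k \<omega>) powr p \<le> exp (- \<nu>1 * (real k * \<Delta>))"
      by (rule AE_eventually_exp_decay[OF \<Delta>(1) nu1(2) int _ C]) simp
    moreover have "limsup (\<lambda>k. ereal (1 / (real k * \<Delta>)) * eln (norm (?Y k \<omega>))) \<le> ereal (- \<nu>1 / p)"
      if ev: "\<forall>\<^sub>F k in sequentially. norm (?Y k \<omega>) powr p \<le> exp (- \<nu>1 * (real k * \<Delta>))" for \<omega>
    proof -
      have "\<forall>\<^sub>F k in sequentially. norm (?Y k \<omega>) \<le> exp (- (\<nu>1 / p) * (real k * \<Delta>))"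
        using ev
      proof eventually_elim
        case (elim k)
        have "(norm (?Y k \<omega>) powr p) powr (1 / p) \<le> exp (- \<nu>1 * (real k * \<Delta>)) powr (1 / p)"
          using elim p by (intro powr_mono2) auto
        moreover have "(norm (?Y k \<omega>) powr p) powr (1 / p) = norm (?Y k \<omega>)" using p by (simp add: powr_powr)
        moreover have "exp (- \<nu>1 * (real k * \<Delta>)) powr (1 / p) = exp (- (\<nu>1 / p) * (real k * \<Delta>))"
          by (simp add: exp_powr_real)
        ultimately show ?case by simp
      qed
      from limsup_eln_le[OF \<Delta>(1) this] show ?thesis by simp
    qed
    ultimately have "AE \<omega> in M. limsup (\<lambda>k. ereal (1 / (real k * \<Delta>)) * eln (norm (?Y k \<omega>))) \<le> ereal (- \<nu>1 / p)"
      by (auto elim: AE_mp)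
    moreover have "limsup (\<lambda>k. ereal (1 / (real k * \<Delta>)) * eln (\<integral>\<omega>. norm (?Y k \<omega>) powr p \<partial>M)) \<le> ereal (- \<nu>1)"
      by (rule limsup_eln_le[OF \<Delta>(1) exp_decay_faster[OF \<Delta>(1) nu1(2) C]])
    ultimately show ?thesis by blast
  qed
  show ?thesis
    unfolding Let_def K_def[symmetric] using d main[OF _ _ refl refl] by blast
qed

end
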